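(* Let $n\ge 3$, let $q_*=\frac{2n}{n-2}$, and let $2<q\le q_*$. Set $\alpha=\frac{q}{q-2}$ and \[ C_q=\left[\frac{2\pi^{n/2}}{\Gamma(n/2)}\right]^{1/\alpha}\left(\frac{q}{2}\right)^{2/q}\left[\frac{\Gamma(\alpha)\Gamma(\alpha+1)}{\Gamma(2\alpha)}\right]^{1/\alpha}. \] Then for every Schwartz function $f\in\mathcal S(\mathbb R^n)$, \[ \int_{\mathbb R^n}|\nabla f|^2\,dx\;\ge\;\frac{(n-1)(n-3)}{4}\int_{\mathbb R^n}\frac{1}{|x|^2}|f|^2\,dx\;+\;C_q\left[\int_{\mathbb R^n}|x|^{-n(q_*-q)/q_*}|f|^q\,dx\right]^{2/q}. \] *)

theory Defs
  imports "HOL-Analysis.Analysis"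
begin

definition partial_deriv :: "'n::finite \<Rightarrow> (real^'n \<Rightarrow> complex) \<Rightarrow> real^'n \<Rightarrow> complex" where
  "partial_deriv i f x = frechet_derivative f (at x) (axis i 1)"

fun iter_partial :: "'n::finite list \<Rightarrow> (real^'n \<Rightarrow> complex) \<Rightarrow> real^'n \<Rightarrow> complex" where
  "iter_partial [] f = f"
| "iter_partial (i # is) f = partial_deriv i (iter_partial is f)"

definition schwartz :: "(real^'n::finite \<Rightarrow> complex) \<Rightarrow> bool" where
  "schwartz f \<longleftrightarrow>
     (\<forall>is. \<forall>x. iter_partial is f differentiable (at x)) \<and>
     (\<forall>is. \<forall>N::nat. \<exists>C. \<forall>x. (1 + norm x) ^ N * norm (iter_partial is f x) \<le> C)"

definition grad_norm_sq :: "(real^'n::finite \<Rightarrow> complex) \<Rightarrow> real^'n \<Rightarrow> real" where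
  "grad_norm_sq f x = (\<Sum>i\<in>UNIV. (norm (partial_deriv i f x))\<^sup>2)"

end

theory Submission
  imports Defs
begin

text \<open>
  Symmetrization reduces the inequality to one dimension, but the rearrangement of \<open>f\<close> is never
  differentiated. Write \<open>r s\<close> for the radius of the ball with the volume of \<open>{\<bar>f\<bar> > s}\<close>, \<open>\<sigma>\<close> for the
  area of the unit sphere and \<open>p = (n - 2) / 2\<close>. Brunn--Minkowski, applied to the level sets, gives
  \<open>\<integral> a(\<bar>f\<bar>) \<bar>\<nabla>f\<bar> \<ge> \<sigma> \<integral> a(s) (r s)^(n - 1) ds\<close> for every Borel function \<open>a \<ge> 0\<close>; together with
  \<open>\<bar>\<nabla>f\<bar>^2 \<ge> 2 a \<bar>\<nabla>f\<bar> - a^2\<close> it bounds the Dirichlet integral from below by a functional of the level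
  sets alone.

  For a radial function \<open>v = \<bar>x\<bar>^p f\<close>, as a function of \<open>t = log \<bar>x\<bar>\<close>, turns the Dirichlet integral
  minus the Hardy term into \<open>\<sigma> \<integral> (v')^2 + v^2 / 4 dt\<close> and the weighted \<open>L^q\<close> term into
  \<open>\<sigma> \<integral> v^q dt\<close>. If \<open>M\<close> is the maximum of \<open>v\<close>, then \<open>(v')^2 + G(v)^2 \<ge> 2 \<bar>v'\<bar> G(v)\<close> with
  \<open>G(v)^2 = v^2 / 4 - M^(2 - q) v^q / 4\<close> yields
  \<open>\<integral> (v')^2 + v^2 / 4 \<ge> M^(2 - q) / 4 \<integral> v^q + 4 \<integral>_0^M G\<close>, and minimizing the right-hand side over \<open>M\<close>
  gives the sharp constant. The function \<open>a\<close> above is chosen as the slope field of this calibration;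
  the resulting integrals over the level sets are then evaluated by Tonelli's theorem. The two lower
  order terms only increase under rearrangement.
\<close>

section \<open>Brunn--Minkowski inequality\<close>

text \<open>The slope field comes from pretending that \<open>f\<close> is radial and decreasing.
  Put \<open>w = \<bar>x\<bar> powr p\<close> and \<open>v = w * u w\<close>. If \<open>v\<close>
  rises in \<open>log \<bar>x\<bar>\<close> with speed \<open>G v\<close> up to
  \<open>w = z0\<close> and falls with speed \<open>G v\<close> beyond, then the modulus of the
  gradient is \<open>w powr (- 1 / p) * (p * u w + \<epsilon> w * G (w * u w) / w)\<close> with
  \<open>\<epsilon>\<close> equal to -1 before \<open>z0\<close> and to 1 after it. In terms of the
  level \<open>s = u w\<close> this involves only \<open>s\<close> and \<open>z s\<close>, hence
  makes sense for every \<open>f\<close>. The term linear in \<open>a\<close> is an integral over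
  levels \<open>s\<close>, the quadratic one an integral over radii \<open>w\<close>. They are
  compared without integration by parts, as integrals over the one region \<open>w < z s\<close>,
  equivalently \<open>s < u w\<close>; the change of sign at \<open>z0\<close> leaves a rectangle
  under the graph, which is the source of the term \<open>4 \<integral> G\<close>. Level sets of
  positive volume make \<open>z\<close> jump, and there \<open>z\<close> and \<open>u\<close> are
  not inverse to each other; the weight \<open>a\<close> is put to 0 at these countably many levels,
  which leaves the linear term alone and can only lower the quadratic one. The condition
  \<open>n \<ge> 3\<close>, that is \<open>p \<ge> 1 / 2\<close>, makes both \<open>a\<close> and
  the Hardy coefficient nonnegative.\<close>

lemma prod_add_ge:
  fixes a b :: "'i \<Rightarrow> real"
  assumes fin: "finite I" "I \<noteq> {}"
    and pos: "\<And>i. i \<in> I \<Longrightarrow> a i > 0" "\<And>i. i \<in> I \<Longrightarrow> b i > 0"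
    and \<alpha>: "\<alpha> > 0" and \<beta>: "\<beta> > 0"
    and A: "(\<Prod>i\<in>I. a i) = \<alpha> ^ card I * t" and B: "(\<Prod>i\<in>I. b i) = \<beta> ^ card I * t"
  shows "(\<Prod>i\<in>I. a i + b i) \<ge> (\<alpha> + \<beta>) ^ card I * t"
proof -
  let ?n = "card I" and ?P = "\<Prod>i\<in>I. a i + b i"
  have n: "?n > 0" using fin by (simp add: card_gt_0_iff)
  have P: "?P > 0" using pos by (intro prod_pos) (simp add: add_pos_pos)
  have "(\<Prod>i\<in>I. a i) > 0" using pos by (intro prod_pos) auto
  then have t: "t > 0" using A \<alpha> by (simp add: zero_less_mult_iff)
  have root: "(\<gamma> ^ ?n * t / ?P) powr (1 / ?n) = \<gamma> * (t / ?P) powr (1 / ?n)" if "\<gamma> > 0" for \<gamma>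
  proof -
    have "(\<gamma> ^ ?n * t / ?P) powr (1 / ?n) = (\<gamma> ^ ?n) powr (1 / ?n) * (t / ?P) powr (1 / ?n)"
      using that t P by (subst powr_mult[symmetric]) auto
    also have "(\<gamma> ^ ?n) powr (1 / ?n) = \<gamma>"
      using that n by (simp add: powr_realpow[symmetric] powr_powr)
    finally show ?thesis .
  qed
  \<comment> \<open>The arithmetic-geometric mean inequality is applied to the ratios
    \<open>a i / (a i + b i)\<close> and \<open>b i / (a i + b i)\<close>; the two arithmetic means
    add up to 1.\<close>
  have "\<alpha> * (t / ?P) powr (1 / ?n) = (\<Prod>i\<in>I. a i / (a i + b i)) powr (1 / ?n)"
    using root[OF \<alpha>] A by (simp add: prod_dividef)
  also have "\<dots> \<le> (\<Sum>i\<in>I. a i / (a i + b i) / ?n)"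
    using fin pos by (intro arith_geom_mean) (auto intro!: divide_nonneg_nonneg simp: less_imp_le add_nonneg_nonneg)
  finally have 1: "\<alpha> * (t / ?P) powr (1 / ?n) \<le> (\<Sum>i\<in>I. a i / (a i + b i) / ?n)" .
  have "\<beta> * (t / ?P) powr (1 / ?n) = (\<Prod>i\<in>I. b i / (a i + b i)) powr (1 / ?n)"
    using root[OF \<beta>] B by (simp add: prod_dividef)
  also have "\<dots> \<le> (\<Sum>i\<in>I. b i / (a i + b i) / ?n)"
    using fin pos by (intro arith_geom_mean) (auto intro!: divide_nonneg_nonneg simp: less_imp_le add_nonneg_nonneg)
  finally have 2: "\<beta> * (t / ?P) powr (1 / ?n) \<le> (\<Sum>i\<in>I. b i / (a i + b i) / ?n)" .
  have "a i / (a i + b i) / ?n + b i / (a i + b i) / ?n = 1 / ?n" if "i \<in> I" for i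
    using pos[OF that] by (simp add: add_divide_distrib[symmetric])
  then have "(\<Sum>i\<in>I. a i / (a i + b i) / ?n) + (\<Sum>i\<in>I. b i / (a i + b i) / ?n) = (\<Sum>i\<in>I. 1 / ?n)"
    by (simp add: sum.distrib[symmetric])
  also have "\<dots> = 1" using n by simp
  finally have "(\<alpha> + \<beta>) * (t / ?P) powr (1 / ?n) \<le> 1"
    using 1 2 by (simp add: algebra_simps)
  then have "((\<alpha> + \<beta>) ^ ?n * t / ?P) powr (1 / ?n) \<le> 1"
    using root[of "\<alpha> + \<beta>"] \<alpha> \<beta> by simp
  then have "(((\<alpha> + \<beta>) ^ ?n * t / ?P) powr (1 / ?n)) ^ ?n \<le> 1"
    by (intro power_le_one) auto
  then have "(\<alpha> + \<beta>) ^ ?n * t / ?P \<le> 1"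
    using n t P \<alpha> \<beta> by (simp add: powr_realpow[symmetric] powr_powr)
  then show ?thesis using P by (simp add: field_simps)
qed

section \<open>Finite families of disjoint open boxes and their cuts by coordinate
  hyperplanes\<close>

definition box_family :: "'a::euclidean_space set set \<Rightarrow> bool" where
  "box_family \<A> \<longleftrightarrow> finite \<A> \<and> disjoint \<A> \<and> (\<forall>A\<in>\<A>. A \<noteq> {} \<and> (\<exists>a b. A = box a b))"

text \<open>Empty intersections are discarded so that the result is again a family of nonempty boxes
  and its cardinality drops as soon as one box misses \<open>H\<close>. The cardinality is the
  induction measure for Brunn--Minkowski.\<close>

definition cut_family :: "'a set \<Rightarrow> 'a set set \<Rightarrow> 'a set set" where
  "cut_family H \<A> = (\<lambda>A. A \<inter> H) ` \<A> - {{}}"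

lemma Union_cut_family: "\<Union>(cut_family H \<A>) = \<Union>\<A> \<inter> H"
  by (auto simp: cut_family_def)

lemma card_cut_family_le: "finite \<A> \<Longrightarrow> card (cut_family H \<A>) \<le> card \<A>"
  unfolding cut_family_def
  by (meson Diff_subset card_image_le card_mono finite_imageI le_trans)

lemma card_cut_family_less:
  assumes "finite \<A>" "A \<in> \<A>" "A \<inter> H = {}"
  shows "card (cut_family H \<A>) < card \<A>"
proof -
  have "cut_family H \<A> \<subseteq> (\<lambda>A. A \<inter> H) ` (\<A> - {A})"
    using assms by (auto simp: cut_family_def)
  then have "card (cut_family H \<A>) \<le> card (\<A> - {A})"
    by (meson assms(1) card_image_le card_mono finite_Diff finite_imageI le_trans)
  then show ?thesis using assms by (metis card_Diff1_less le_less_trans)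
qed

lemma box_Int_halfspace_lt:
  fixes a b :: "'a::euclidean_space"
  assumes "i \<in> Basis"
  shows "\<exists>b'. box a b \<inter> {x. x \<bullet> i < c} = box a b'"
proof
  show "box a b \<inter> {x. x \<bullet> i < c} =
      box a (\<Sum>j\<in>Basis. (if j = i then min (b \<bullet> i) c else b \<bullet> j) *\<^sub>R j)"
    using assms by (auto simp: mem_box inner_sum_left_Basis split: if_splits)
qed

lemma box_Int_halfspace_gt:
  fixes a b :: "'a::euclidean_space"
  assumes "i \<in> Basis"
  shows "\<exists>a'. box a b \<inter> {x. x \<bullet> i > c} = box a' b"
proof
  show "box a b \<inter> {x. x \<bullet> i > c} =
      box (\<Sum>j\<in>Basis. (if j = i then max (a \<bullet> i) c else a \<bullet> j) *\<^sub>R j) b"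
    using assms by (auto simp: mem_box inner_sum_left_Basis split: if_splits)
qed

lemma box_family_cut:
  assumes "box_family \<A>" "i \<in> Basis" "H = {x. x \<bullet> i < c} \<or> H = {x. x \<bullet> i > c}"
  shows "box_family (cut_family H \<A>)"
  unfolding box_family_def
proof (intro conjI ballI)
  show "finite (cut_family H \<A>)" using assms(1) by (auto simp: box_family_def cut_family_def)
  show "disjoint (cut_family H \<A>)"
  proof (rule pairwiseI)
    fix X Y assume XY: "X \<in> cut_family H \<A>" "Y \<in> cut_family H \<A>" "X \<noteq> Y"
    then obtain A B where "A \<in> \<A>" "B \<in> \<A>" "X = A \<inter> H" "Y = B \<inter> H" by (auto simp: cut_family_def)
    moreover then have "A \<noteq> B" using XY by auto
    ultimately show "disjnt X Y" using assms(1) by (auto simp: box_family_def pairwise_def disjnt_def)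
  qed
  fix X assume X: "X \<in> cut_family H \<A>"
  then show "X \<noteq> {}" by (auto simp: cut_family_def)
  from X obtain A where "A \<in> \<A>" "X = A \<inter> H" by (auto simp: cut_family_def)
  moreover from this assms(1) obtain a b where "A = box a b" unfolding box_family_def by blast
  ultimately show "\<exists>a b. X = box a b"
    using assms(2,3) box_Int_halfspace_lt box_Int_halfspace_gt by metis
qed

lemma box_family_fmeasurable:
  assumes "box_family \<A>"
  shows "\<Union>\<A> \<in> fmeasurable lborel"
proof (rule fmeasurable.finite_Union)
  show "finite \<A>" using assms by (simp add: box_family_def)
  show "\<A> \<subseteq> fmeasurable lborel"
  proof
    fix A assume "A \<in> \<A>"
    with assms obtain a b where "A = box a b" unfolding box_family_def by blast
    then show "A \<in> fmeasurable lborel" by simp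
  qed
qed

lemma box_family_pos:
  assumes "box_family \<A>" "\<A> \<noteq> {}"
  shows "measure lborel (\<Union>\<A>) > 0"
proof -
  obtain a b where ab: "box a b \<in> \<A>" "box a b \<noteq> {}"
    using assms by (force simp: box_family_def)
  then have "measure lborel (box a b) > 0"
    by (auto simp: measure_lborel_box_eq box_ne_empty inner_diff_left less_imp_le intro!: prod_pos)
  moreover have "measure lborel (box a b) \<le> measure lborel (\<Union>\<A>)"
    using ab box_family_fmeasurable[OF assms(1)] by (intro measure_mono_fmeasurable) auto
  ultimately show ?thesis by simp
qed

lemma AE_lborel_inner_neq:
  fixes i :: "'a::euclidean_space"
  assumes "i \<in> Basis"
  shows "AE x in lborel. x \<bullet> i \<noteq> d"
proof -
  have "{x. x \<bullet> i = d} \<in> null_sets (lborel::'a measure)"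
    using negligible_standard_hyperplane[OF assms, of d]
    by (auto simp: negligible_iff_null_sets null_sets_completion_iff)
  from AE_not_in[OF this] show ?thesis by simp
qed

text \<open>The hyperplane between the two halves is a null set, so cutting into open halves, which
  keeps boxes open, loses no volume.\<close>

lemma measure_halfspaces_add:
  fixes i :: "'a::euclidean_space"
  assumes "i \<in> Basis" "S \<in> fmeasurable lborel"
  shows "measure lborel (S \<inter> {x. x \<bullet> i < d}) + measure lborel (S \<inter> {x. x \<bullet> i > d}) = measure lborel S"
proof -
  let ?l = "{x::'a. x \<bullet> i < d}" and ?g = "{x::'a. x \<bullet> i > d}"
  have m: "S \<inter> ?l \<in> fmeasurable lborel" "S \<inter> ?g \<in> fmeasurable lborel"
    using assms(2) by (auto intro!: fmeasurable_Int_fmeasurable open_halfspace_component_lt open_halfspace_component_gt)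
  have "measure lborel (S \<inter> ?l) + measure lborel (S \<inter> ?g) = measure lborel ((S \<inter> ?l) \<union> (S \<inter> ?g))"
    using m by (subst measure_Un2) (auto intro!: arg_cong[where f="measure lborel"])
  also have "\<dots> = measure lborel S"
    using AE_lborel_inner_neq[OF assms(1), of d] m assms(2)
    by (intro measure_eq_AE) auto
  finally show ?thesis .
qed

text \<open>The cut volume depends continuously on \<open>d\<close> by dominated convergence, since
  the indicators converge off the null hyperplane. It runs from 0 to the full volume because
  \<open>S\<close> is bounded.\<close>

lemma halfspace_measure_IVT:
  fixes i :: "'a::euclidean_space"
  assumes i: "i \<in> Basis" and S: "S \<in> fmeasurable lborel" "bounded S"
    and m: "0 \<le> m" "m \<le> measure lborel S"
  shows "\<exists>d. measure lborel (S \<inter> {x. x \<bullet> i < d}) = m"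
proof -
  let ?H = "\<lambda>d. measure lborel (S \<inter> {x. x \<bullet> i < d})"
  obtain R where R: "R > 0" "\<And>x. x \<in> S \<Longrightarrow> norm x \<le> R"
    using S(2) by (auto simp: bounded_pos)
  have abs: "\<bar>x \<bullet> i\<bar> \<le> R" if "x \<in> S" for x
    using R(2)[OF that] Basis_le_norm[OF i, of x] by linarith
  have hm: "S \<inter> {x. x \<bullet> i < d} \<in> fmeasurable lborel" for d
    using S(1) by (auto intro!: fmeasurable_Int_fmeasurable open_halfspace_component_lt)
  have H: "?H d = (LBINT x. indicator (S \<inter> {x. x \<bullet> i < d}) x)" for d
    by simp
  have "S \<inter> {x. x \<bullet> i < - R} = {}"
    using abs by fastforce
  then have lo: "?H (- R) = 0" by simp
  have "S \<inter> {x. x \<bullet> i < R + 1} = S"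
    using abs by fastforce
  then have hi: "?H (R + 1) = measure lborel S" by simp
  have "continuous_on {-R..R+1} ?H"
  proof (unfold continuous_on_sequentially, intro allI ballI impI)
    fix X d assume "d \<in> {-R..R+1}" and X: "(\<forall>n. X n \<in> {-R..R+1}) \<and> X \<longlonglongrightarrow> d"
    have "(\<lambda>k. \<integral>x. indicator (S \<inter> {x. x \<bullet> i < X k}) x \<partial>lborel) \<longlonglongrightarrow>
        (LBINT x. (indicator (S \<inter> {x. x \<bullet> i < d}) x :: real))"
    proof (rule integral_dominated_convergence[where w="indicator S"])
      show "(indicator (S \<inter> {x. x \<bullet> i < d}) :: _ \<Rightarrow> real) \<in> borel_measurable lborel"
        using hm by (intro borel_measurable_indicator) (auto simp: fmeasurable_def)
      show "(indicator (S \<inter> {x. x \<bullet> i < X k}) :: _ \<Rightarrow> real) \<in> borel_measurable lborel" for k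
        using hm by (intro borel_measurable_indicator) (auto simp: fmeasurable_def)
      show "integrable lborel (indicator S :: _ \<Rightarrow> real)"
        using S(1) by (auto simp: fmeasurable_def)
      show "AE x in lborel. (\<lambda>k. indicator (S \<inter> {x. x \<bullet> i < X k}) x :: real) \<longlonglongrightarrow> indicator (S \<inter> {x. x \<bullet> i < d}) x"
        using AE_lborel_inner_neq[OF i, of d]
      proof eventually_elim
        case (elim x)
        have "eventually (\<lambda>k. indicator (S \<inter> {x. x \<bullet> i < X k}) x = (indicator (S \<inter> {x. x \<bullet> i < d}) x :: real)) sequentially"
        proof (cases "x \<bullet> i < d")
          case True
          then have "eventually (\<lambda>k. x \<bullet> i < X k) sequentially"
            using X by (auto intro: order_tendstoD)
          then show ?thesis by eventually_elim (use True in \<open>auto simp: indicator_def\<close>)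
        next
          case False
          then have "eventually (\<lambda>k. x \<bullet> i > X k) sequentially"
            using X elim by (intro order_tendstoD) auto
          then show ?thesis by eventually_elim (use False in \<open>auto simp: indicator_def\<close>)
        qed
        then show ?case by (rule tendsto_eventually)
      qed
      show "AE x in lborel. norm (indicator (S \<inter> {x. x \<bullet> i < X k}) x :: real) \<le> indicator S x" for k
        by (auto simp: indicator_def)
    qed
    then show "((\<lambda>d. ?H d) \<circ> X) \<longlonglongrightarrow> ?H d" by (simp add: o_def)
  qed
  then have "\<exists>x. -R \<le> x \<and> x \<le> R + 1 \<and> ?H x = m"
    using lo hi m R by (intro IVT') auto
  then show ?thesis by blast
qed

lemma box_family_bounded: "box_family \<A> \<Longrightarrow> bounded (\<Union>\<A>)"
  unfolding box_family_def by (metis bounded_Union bounded_box)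

text \<open>The common factor \<open>t\<close> makes the inequality additive when both families are cut by
  parallel hyperplanes in the same proportion, which is the Hadwiger--Ohmann induction.\<close>

definition bm_ineq :: "'a::euclidean_space set set \<Rightarrow> 'a set set \<Rightarrow> bool" where
  "bm_ineq \<A> \<B> \<longleftrightarrow> (\<forall>\<alpha> \<beta> t C. \<alpha> > 0 \<longrightarrow> \<beta> > 0 \<longrightarrow>
      measure lborel (\<Union>\<A>) = \<alpha> ^ DIM('a) * t \<longrightarrow> measure lborel (\<Union>\<B>) = \<beta> ^ DIM('a) * t \<longrightarrow>
      C \<in> fmeasurable lborel \<longrightarrow> (\<forall>x\<in>\<Union>\<A>. \<forall>y\<in>\<Union>\<B>. x + y \<in> C) \<longrightarrow>
      (\<alpha> + \<beta>) ^ DIM('a) * t \<le> measure lborel C)"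

lemma bm_ineqD:
  fixes \<A> \<B> :: "'a::euclidean_space set set"
  assumes "bm_ineq \<A> \<B>" "\<alpha> > 0" "\<beta> > 0"
    "measure lborel (\<Union>\<A>) = \<alpha> ^ DIM('a) * t" "measure lborel (\<Union>\<B>) = \<beta> ^ DIM('a) * t"
    "C \<in> fmeasurable lborel" "\<And>x y. x \<in> \<Union>\<A> \<Longrightarrow> y \<in> \<Union>\<B> \<Longrightarrow> x + y \<in> C"
  shows "(\<alpha> + \<beta>) ^ DIM('a) * t \<le> measure lborel C"
  using assms(1)[unfolded bm_ineq_def, rule_format, OF assms(2-6)] assms(7) by simp

lemma bm_ineq_commute:
  assumes "bm_ineq \<A> \<B>"
  shows "bm_ineq \<B> \<A>"
  unfolding bm_ineq_def
proof (intro allI impI)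
  fix \<alpha> \<beta> t :: real and C :: "'a set"
  assume h: "0 < \<alpha>" "0 < \<beta>" "measure lborel (\<Union>\<B>) = \<alpha> ^ DIM('a) * t"
    "measure lborel (\<Union>\<A>) = \<beta> ^ DIM('a) * t" "C \<in> fmeasurable lborel"
    "\<forall>x\<in>\<Union>\<B>. \<forall>y\<in>\<Union>\<A>. x + y \<in> C"
  have "(\<beta> + \<alpha>) ^ DIM('a) * t \<le> measure lborel C"
    using h(6) by (intro bm_ineqD[OF assms h(2,1,4,3,5)]) (metis add.commute)
  then show "(\<alpha> + \<beta>) ^ DIM('a) * t \<le> measure lborel C" by (simp add: add.commute)
qed

text \<open>Base case: the sum of two boxes is the box whose side lengths are added, so the claim is
  the product inequality for side lengths.\<close>

lemma bm_ineq_box: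
  fixes a b c d :: "'a::euclidean_space"
  assumes "box a b \<noteq> {}" "box c d \<noteq> {}"
  shows "bm_ineq {box a b} {box c d}"
  unfolding bm_ineq_def
proof (intro allI impI)
  fix \<alpha> \<beta> t :: real and C
  assume pos: "0 < \<alpha>" "0 < \<beta>"
    and A: "measure lborel (\<Union> {box a b}) = \<alpha> ^ DIM('a) * t"
    and B: "measure lborel (\<Union> {box c d}) = \<beta> ^ DIM('a) * t"
    and C: "C \<in> fmeasurable lborel" "\<forall>x\<in>\<Union> {box a b}. \<forall>y\<in>\<Union> {box c d}. x + y \<in> C"
  have ab: "a \<bullet> i < b \<bullet> i" and cd: "c \<bullet> i < d \<bullet> i" if "i \<in> Basis" for i
    using assms that by (auto simp: box_ne_empty)
  have sub: "box (a + c) (b + d) \<subseteq> C"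
  proof
    fix z assume z: "z \<in> box (a + c) (b + d)"
    \<comment> \<open>The relative position of \<open>z\<close> in coordinate \<open>i\<close>. The
      summands are taken at this same relative position in their own boxes.\<close>
    define l where "l i = (z \<bullet> i - a \<bullet> i - c \<bullet> i) / (b \<bullet> i + d \<bullet> i - a \<bullet> i - c \<bullet> i)" for i
    have l: "0 < l i" "l i < 1" if "i \<in> Basis" for i
      using z that ab[OF that] cd[OF that] by (auto simp: l_def mem_box inner_add_left field_simps)
    have interp: "p < p + k * (r - p) \<and> p + k * (r - p) < r" if "p < r" "0 < k" "k < 1" for p r k :: real
    proof -
      have "0 < k * (r - p)" "k * (r - p) < 1 * (r - p)"
        using that by (intro mult_pos_pos mult_strict_right_mono; simp)+
      then show ?thesis by simp
    qed
    define x where "x = (\<Sum>i\<in>Basis. (a \<bullet> i + l i * (b \<bullet> i - a \<bullet> i)) *\<^sub>R i)"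
    have xi: "x \<bullet> i = a \<bullet> i + l i * (b \<bullet> i - a \<bullet> i)" if "i \<in> Basis" for i
      using that by (simp add: x_def inner_sum_left_Basis)
    have "x \<in> box a b"
      using interp l ab by (auto simp: mem_box xi)
    moreover have "z \<bullet> i - x \<bullet> i = c \<bullet> i + l i * (d \<bullet> i - c \<bullet> i)" if "i \<in> Basis" for i
    proof -
      have "l i * (b \<bullet> i + d \<bullet> i - a \<bullet> i - c \<bullet> i) = z \<bullet> i - a \<bullet> i - c \<bullet> i"
        using ab[OF that] cd[OF that] by (simp add: l_def)
      then show ?thesis by (simp add: xi[OF that] algebra_simps)
    qed
    then have "z - x \<in> box c d"
      using interp l cd by (auto simp: mem_box inner_diff_left)
    ultimately show "z \<in> C" using C(2) by fastforce
  qed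
  have "(\<alpha> + \<beta>) ^ DIM('a) * t \<le> (\<Prod>i\<in>Basis. (b - a) \<bullet> i + (d - c) \<bullet> i)"
  proof (rule prod_add_ge[OF _ _ _ _ pos])
    show "(\<Prod>i\<in>Basis. (b - a) \<bullet> i) = \<alpha> ^ DIM('a) * t"
      using A ab by (simp add: measure_lborel_box_eq less_imp_le)
    show "(\<Prod>i\<in>Basis. (d - c) \<bullet> i) = \<beta> ^ DIM('a) * t"
      using B cd by (simp add: measure_lborel_box_eq less_imp_le)
  qed (use ab cd in \<open>auto simp: inner_diff_left\<close>)
  also have "\<dots> = (\<Prod>i\<in>Basis. (b + d - (a + c)) \<bullet> i)"
    by (intro prod.cong) (auto simp: algebra_simps)
  also have "\<dots> = measure lborel (box (a + c) (b + d))"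
    using ab cd by (subst measure_lborel_box_eq) (auto simp: inner_add_left add_mono less_imp_le)
  also have "\<dots> \<le> measure lborel C"
    using sub C(1) by (intro measure_mono_fmeasurable) auto
  finally show "(\<alpha> + \<beta>) ^ DIM('a) * t \<le> measure lborel C" .
qed

text \<open>A hyperplane separating two boxes of \<open>\<A>\<close> splits \<open>\<A>\<close> into
  two smaller families. A parallel hyperplane splits \<open>\<B>\<close> in the same volume ratio,
  and the induction hypothesis applies to the lower and to the upper halves. Their sums lie on
  opposite sides of a third hyperplane, so the two bounds add.\<close>

lemma bm_ineq_step:
  fixes \<A> \<B> :: "'a::euclidean_space set set"
  assumes fam: "box_family \<A>" "box_family \<B>" "\<B> \<noteq> {}" and card: "card \<A> \<ge> 2"
    and IH: "\<And>\<A>' \<B>' :: 'a set set. box_family \<A>' \<Longrightarrow> box_family \<B>' \<Longrightarrow> \<A>' \<noteq> {} \<Longrightarrow> \<B>' \<noteq> {} \<Longrightarrow>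
      card \<A>' + card \<B>' < card \<A> + card \<B> \<Longrightarrow> bm_ineq \<A>' \<B>'"
  shows "bm_ineq \<A> \<B>"
  unfolding bm_ineq_def
proof (intro allI impI)
  fix \<alpha> \<beta> t :: real and C
  assume pos: "0 < \<alpha>" "0 < \<beta>"
    and A: "measure lborel (\<Union>\<A>) = \<alpha> ^ DIM('a) * t"
    and B: "measure lborel (\<Union>\<B>) = \<beta> ^ DIM('a) * t"
    and C: "C \<in> fmeasurable lborel" "\<forall>x\<in>\<Union>\<A>. \<forall>y\<in>\<Union>\<B>. x + y \<in> C"
  have fin: "finite \<A>" "finite \<B>" using fam by (auto simp: box_family_def)
  have "\<not> is_singleton \<A>" "\<A> \<noteq> {}" using card by (auto simp: is_singleton_altdef)
  then obtain A1 A2 where A12: "A1 \<in> \<A>" "A2 \<in> \<A>" "A1 \<noteq> A2"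
    by (metis is_singletonI' )
  have sep: "\<exists>i\<in>Basis. \<exists>c. \<exists>P\<in>\<A>. \<exists>Q\<in>\<A>. P \<subseteq> {x. x \<bullet> i < c} \<and> Q \<subseteq> {x. x \<bullet> i > c}"
  proof -
    obtain a b c d where bx: "A1 = box a b" "A2 = box c d"
      using A12 fam(1) by (metis box_family_def)
    have ne: "box a b \<noteq> {}" "box c d \<noteq> {}" and "box a b \<inter> box c d = {}"
      using A12 fam(1) bx by (auto simp: box_family_def pairwise_def disjnt_def)
    then obtain i where i: "i \<in> Basis" "b \<bullet> i \<le> c \<bullet> i \<or> d \<bullet> i \<le> a \<bullet> i"
      unfolding disjoint_interval box_ne_empty by (metis not_le)
    from i(2) show ?thesis
    proof
      assume "b \<bullet> i \<le> c \<bullet> i"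
      then have "A1 \<subseteq> {x. x \<bullet> i < b \<bullet> i}" "A2 \<subseteq> {x. x \<bullet> i > b \<bullet> i}"
        using i(1) by (force simp: bx mem_box)+
      then show ?thesis using i(1) A12 by blast
    next
      assume "d \<bullet> i \<le> a \<bullet> i"
      then have "A2 \<subseteq> {x. x \<bullet> i < d \<bullet> i}" "A1 \<subseteq> {x. x \<bullet> i > d \<bullet> i}"
        using i(1) by (force simp: bx mem_box)+
      then show ?thesis using i(1) A12 by blast
    qed
  qed
  then obtain i c P Q where i: "i \<in> Basis" and P: "P \<in> \<A>" "P \<subseteq> {x. x \<bullet> i < c}"
    and Q: "Q \<in> \<A>" "Q \<subseteq> {x. x \<bullet> i > c}" by blast
  have ne: "P \<noteq> {}" "Q \<noteq> {}" using P Q fam(1) by (auto simp: box_family_def)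
  define Am where "Am = cut_family {x. x \<bullet> i < c} \<A>"
  define Ap where "Ap = cut_family {x. x \<bullet> i > c} \<A>"
  have famA: "box_family Am" "box_family Ap"
    unfolding Am_def Ap_def using fam(1) i by (auto intro!: box_family_cut)
  have neA: "Am \<noteq> {}" "Ap \<noteq> {}"
    using P Q ne Union_cut_family[of "{x. x \<bullet> i < c}" \<A>] Union_cut_family[of "{x. x \<bullet> i > c}" \<A>]
    unfolding Am_def Ap_def by blast+
  \<comment> \<open>\<open>Q\<close> misses the lower half-space and \<open>P\<close> the upper one,
    so both halves of \<open>\<A>\<close> lose a box. For \<open>\<B>\<close> it is enough that
    cutting does not increase the number of boxes.\<close>
  have cardA: "card Am < card \<A>" "card Ap < card \<A>"
    unfolding Am_def Ap_def using P Q fin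
    by (intro card_cut_family_less[where A=Q] card_cut_family_less[where A=P]; fastforce)+
  have sumA: "measure lborel (\<Union>Am) + measure lborel (\<Union>Ap) = measure lborel (\<Union>\<A>)"
    unfolding Am_def Ap_def Union_cut_family using i box_family_fmeasurable[OF fam(1)] by (rule measure_halfspaces_add)
  define tm where "tm = measure lborel (\<Union>Am) / \<alpha> ^ DIM('a)"
  define tp where "tp = measure lborel (\<Union>Ap) / \<alpha> ^ DIM('a)"
  have tt: "tm > 0" "tp > 0" "tm + tp = t"
    using box_family_pos[OF famA(1) neA(1)] box_family_pos[OF famA(2) neA(2)] pos sumA A
    by (auto simp: tm_def tp_def field_simps)
  have mA: "measure lborel (\<Union>Am) = \<alpha> ^ DIM('a) * tm" "measure lborel (\<Union>Ap) = \<alpha> ^ DIM('a) * tp"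
    using pos by (auto simp: tm_def tp_def)
  \<comment> \<open>The level \<open>d\<close> is chosen so that the scale factor \<open>tm\<close>
    is common to the lower halves; \<open>tp\<close> is then common to the upper ones, with the same
    \<open>\<alpha>\<close> and \<open>\<beta>\<close> throughout.\<close>
  obtain d where d: "measure lborel (\<Union>\<B> \<inter> {x. x \<bullet> i < d}) = \<beta> ^ DIM('a) * tm"
    using halfspace_measure_IVT[OF i box_family_fmeasurable[OF fam(2)] box_family_bounded[OF fam(2)], of "\<beta> ^ DIM('a) * tm"]
      B tt pos by auto
  have d': "measure lborel (\<Union>\<B> \<inter> {x. x \<bullet> i > d}) = \<beta> ^ DIM('a) * tp"
    using measure_halfspaces_add[OF i box_family_fmeasurable[OF fam(2)], of d] d B tt(3)
    by (auto simp: algebra_simps)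
  define Bm where "Bm = cut_family {x. x \<bullet> i < d} \<B>"
  define Bp where "Bp = cut_family {x. x \<bullet> i > d} \<B>"
  have famB: "box_family Bm" "box_family Bp"
    unfolding Bm_def Bp_def using fam(2) i by (auto intro!: box_family_cut)
  have mB: "measure lborel (\<Union>Bm) = \<beta> ^ DIM('a) * tm" "measure lborel (\<Union>Bp) = \<beta> ^ DIM('a) * tp"
    using d d' by (simp_all add: Bm_def Bp_def Union_cut_family)
  have neB: "Bm \<noteq> {}" "Bp \<noteq> {}"
    using mB tt pos by auto
  have cardB: "card Bm \<le> card \<B>" "card Bp \<le> card \<B>"
    unfolding Bm_def Bp_def using fin by (auto intro!: card_cut_family_le)
  have mC: "C \<inter> {x. x \<bullet> i < c + d} \<in> fmeasurable lborel" "C \<inter> {x. x \<bullet> i > c + d} \<in> fmeasurable lborel"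
    using C(1) by (auto intro!: fmeasurable_Int_fmeasurable open_halfspace_component_lt open_halfspace_component_gt)
  have "bm_ineq Am Bm" using IH[OF famA(1) famB(1) neA(1) neB(1)] cardA cardB by auto
  then have 1: "(\<alpha> + \<beta>) ^ DIM('a) * tm \<le> measure lborel (C \<inter> {x. x \<bullet> i < c + d})"
    using pos mA(1) mB(1) mC(1)
  proof (rule bm_ineqD)
    fix x y assume "x \<in> \<Union>Am" "y \<in> \<Union>Bm"
    then show "x + y \<in> C \<inter> {x. x \<bullet> i < c + d}"
      using C(2) unfolding Am_def Bm_def Union_cut_family by (auto simp: inner_add_left)
  qed
  have "bm_ineq Ap Bp" using IH[OF famA(2) famB(2) neA(2) neB(2)] cardA cardB by auto
  then have 2: "(\<alpha> + \<beta>) ^ DIM('a) * tp \<le> measure lborel (C \<inter> {x. x \<bullet> i > c + d})"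
    using pos mA(2) mB(2) mC(2)
  proof (rule bm_ineqD)
    fix x y assume "x \<in> \<Union>Ap" "y \<in> \<Union>Bp"
    then show "x + y \<in> C \<inter> {x. x \<bullet> i > c + d}"
      using C(2) unfolding Ap_def Bp_def Union_cut_family by (auto simp: inner_add_left)
  qed
  have "(\<alpha> + \<beta>) ^ DIM('a) * t = (\<alpha> + \<beta>) ^ DIM('a) * tm + (\<alpha> + \<beta>) ^ DIM('a) * tp"
    using tt(3) by (simp add: distrib_left[symmetric])
  then show "(\<alpha> + \<beta>) ^ DIM('a) * t \<le> measure lborel C"
    using 1 2 measure_halfspaces_add[OF i C(1), of "c + d"] by linarith
qed

lemma bm_ineq_box_families:
  fixes \<A> \<B> :: "'a::euclidean_space set set"
  assumes "box_family \<A>" "box_family \<B>" "\<A> \<noteq> {}" "\<B> \<noteq> {}"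
  shows "bm_ineq \<A> \<B>"
  using assms
proof (induction "card \<A> + card \<B>" arbitrary: \<A> \<B> rule: less_induct)
  case less
  have fin: "finite \<A>" "finite \<B>" using less.prems by (auto simp: box_family_def)
  have c: "card \<A> > 0" "card \<B> > 0" using fin less.prems by (auto simp: card_gt_0_iff)
  consider "card \<A> \<ge> 2" | "card \<B> \<ge> 2" | "card \<A> = 1" "card \<B> = 1" using c by linarith
  then show ?case
  proof cases
    case 1
    show ?thesis
      by (rule bm_ineq_step[OF less.prems(1,2,4) 1]) (rule less.hyps)
  next
    case 2
    have "bm_ineq \<B> \<A>"
      by (rule bm_ineq_step[OF less.prems(2,1,3) 2], rule less.hyps) (simp_all add: add.commute)
    then show ?thesis by (rule bm_ineq_commute)
  next
    case 3
    then obtain A B where "\<A> = {A}" "\<B> = {B}" by (auto simp: card_1_singleton_iff)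
    moreover from this less.prems obtain a b c d where "A = box a b" "B = box c d" "A \<noteq> {}" "B \<noteq> {}"
      by (simp add: box_family_def) metis
    ultimately show ?thesis using bm_ineq_box by blast
  qed
qed

section \<open>From box families to bounded open sets\<close>

lemma open_box_family_approx:
  fixes S :: "'a::euclidean_space set"
  assumes S: "open S" "bounded S" and e: "e > 0"
  obtains \<A> where "box_family \<A>" "\<Union>\<A> \<subseteq> S" "measure lborel S - e < measure lborel (\<Union>\<A>)"
proof -
  obtain a where a: "S \<subseteq> cbox (-a) a" using bounded_subset_cbox_symmetric[OF S(2)] by blast
  define b where "b = (\<Sum>i\<in>Basis. (\<bar>a \<bullet> i\<bar> + 1) *\<^sub>R i)"
  have bi: "b \<bullet> i = \<bar>a \<bullet> i\<bar> + 1" if "i \<in> Basis" for i using that by (simp add: b_def)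
  have "cbox (-a) a \<subseteq> cbox (-b) b" "box (-b) b \<noteq> {}"
    by (auto simp: subset_box box_ne_empty bi) 
  with a have Sb: "S \<subseteq> cbox (-b) b" "box (-b) b \<noteq> {}" by auto
  \<comment> \<open>The covering lemma produces tagged boxes that fit into the gauge set of their
    tag. As the tags lie in \<open>S\<close>, the gauge value \<open>S\<close> there forces every
    box into \<open>S\<close>.\<close>
  have "gauge (\<lambda>x. if x \<in> S then S else UNIV)" using S(1) by (auto simp: gauge_def)
  from covering_lemma[OF Sb this] obtain \<D> where \<D>: "countable \<D>"
      "\<And>K. K \<in> \<D> \<Longrightarrow> interior K \<noteq> {} \<and> (\<exists>c d. K = cbox c d)"
      "pairwise (\<lambda>A B. interior A \<inter> interior B = {}) \<D>"
      "\<And>K. K \<in> \<D> \<Longrightarrow> \<exists>x \<in> S \<inter> K. K \<subseteq> (if x \<in> S then S else UNIV)" "S \<subseteq> \<Union>\<D>"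
    by metis
  have sub: "K \<subseteq> S" if "K \<in> \<D>" for K using \<D>(4)[OF that] by (auto split: if_splits)
  then have US: "\<Union>\<D> = S" using \<D>(5) by blast
  have Slm: "S \<in> lmeasurable" using S by (rule lmeasurable_open[rotated])
  have lm: "K \<in> lmeasurable" if "K \<in> \<D>" for K using \<D>(2)[OF that] by auto
  obtain D' where D': "D' \<subseteq> \<D>" "finite D'" "measure lebesgue (\<Union>\<D>) - e < measure lebesgue (\<Union>D')"
  proof (rule measure_countable_Union_approachable[OF \<D>(1) e lm])
    fix D' assume "D' \<subseteq> \<D>" "finite D'"
    then show "measure lebesgue (\<Union>D') \<le> measure lebesgue S"
      using US lm Slm by (intro measure_mono_fmeasurable) (auto intro!: fmeasurable.finite_Union dest: fmeasurableD)
  qed auto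
  \<comment> \<open>The covering boxes are closed and overlap only along their boundaries; their
    interiors are disjoint open boxes of the same volume.\<close>
  define \<A> where "\<A> = interior ` D'"
  have inj: "inj_on interior D'"
  proof (rule inj_onI, rule ccontr)
    fix K L assume KL: "K \<in> D'" "L \<in> D'" "interior K = interior L" "K \<noteq> L"
    then have "K \<in> \<D>" "L \<in> \<D>" using D'(1) by auto
    then have "interior K \<inter> interior L = {}" using \<D>(3) KL(4) by (auto simp: pairwise_def)
    then show False using \<D>(2)[OF \<open>K \<in> \<D>\<close>] KL(3) by simp
  qed
  have disj: "disjoint \<A>"
    unfolding \<A>_def pairwise_image using D'(1) \<D>(3) by (auto simp: pairwise_def disjnt_def)
  have fam: "box_family \<A>"
    unfolding box_family_def
  proof (intro conjI ballI)
    fix A assume "A \<in> \<A>"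
    then obtain K where K: "K \<in> \<D>" "A = interior K" using D'(1) by (auto simp: \<A>_def)
    then show "A \<noteq> {}" using \<D>(2) by auto
    obtain c d where "K = cbox c d" using \<D>(2)[OF K(1)] by blast
    then show "\<exists>a b. A = box a b" using K(2) by (auto simp: interior_cbox)
  qed (use D'(2) disj in \<open>auto simp: \<A>_def\<close>)
  have "measure lebesgue (\<Union>D') \<le> (\<Sum>K\<in>D'. measure lebesgue K)"
    using measure_UNION_le[OF D'(2), of "\<lambda>K. K" lebesgue] D'(1) lm by (auto dest: fmeasurableD)
  also have "\<dots> = (\<Sum>K\<in>D'. measure lborel (interior K))"
  proof (rule sum.cong)
    fix K assume "K \<in> D'"
    then obtain c d where "K = cbox c d" using \<D>(2) D'(1) by blast
    then show "measure lebesgue K = measure lborel (interior K)"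
      by (simp add: interior_cbox measure_lborel_box_eq measure_lborel_cbox_eq)
  qed simp
  also have "\<dots> = (\<Sum>A\<in>\<A>. measure lborel A)"
    unfolding \<A>_def by (simp add: sum.reindex[OF inj])
  also have "\<dots> = measure lborel (\<Union>\<A>)"
  proof (rule measure_Union'[symmetric])
    show "pairwise disjnt \<A>" by (rule disj)
    show "A \<in> fmeasurable lborel" if "A \<in> \<A>" for A
      using fam that unfolding box_family_def by (metis fmeasurable_box)
  qed (use D'(2) in \<open>simp add: \<A>_def\<close>)
  finally have "measure lborel S - e < measure lborel (\<Union>\<A>)"
    using D'(3) US S(1) by simp
  moreover have "\<Union>\<A> \<subseteq> S" unfolding \<A>_def using sub D'(1) interior_subset by blast
  ultimately show ?thesis using that fam by blast
qed

theorem brunn_minkowski_open: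
  fixes A B C :: "'a::euclidean_space set"
  assumes A: "open A" "bounded A" and B: "open B" "bounded B"
    and C: "C \<in> fmeasurable lborel" "\<And>x y. x \<in> A \<Longrightarrow> y \<in> B \<Longrightarrow> x + y \<in> C"
    and \<alpha>: "\<alpha> > 0" "measure lborel A = \<alpha> ^ DIM('a)"
    and \<beta>: "\<beta> > 0" "measure lborel B = \<beta> ^ DIM('a)"
  shows "(\<alpha> + \<beta>) ^ DIM('a) \<le> measure lborel C"
proof (rule field_le_mult_one_interval)
  fix z :: real assume z: "0 < z" "z < 1"
  let ?n = "DIM('a)"
  \<comment> \<open>Giving up the factor \<open>z\<close> in volume means giving up
    \<open>\<theta>\<close> in the linear sizes \<open>\<alpha>\<close> and \<open>\<beta>\<close>.
    This leaves room to replace both sets by box families inside them.\<close>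
  define \<theta> where "\<theta> = root ?n z"
  have \<theta>: "\<theta> ^ ?n = z" "0 < \<theta>" using z by (auto simp: \<theta>_def)
  have approx: "\<exists>\<A> \<alpha>'. box_family \<A> \<and> \<A> \<noteq> {} \<and> \<Union>\<A> \<subseteq> S \<and> measure lborel (\<Union>\<A>) = \<alpha>' ^ ?n * 1 \<and> \<theta> * \<gamma> \<le> \<alpha>' \<and> 0 < \<alpha>'"
    if S: "open S" "bounded S" and \<gamma>: "\<gamma> > 0" "measure lborel S = \<gamma> ^ ?n" for S :: "'a set" and \<gamma>
  proof -
    have "\<gamma> ^ ?n * (1 - z) > 0" using \<gamma> z by simp
    from open_box_family_approx[OF S this] obtain \<A> where
      \<A>: "box_family \<A>" "\<Union>\<A> \<subseteq> S" "measure lborel S - \<gamma> ^ ?n * (1 - z) < measure lborel (\<Union>\<A>)" .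
    then have gt: "(\<theta> * \<gamma>) ^ ?n < measure lborel (\<Union>\<A>)"
      using \<gamma>(2) \<theta> by (simp add: power_mult_distrib algebra_simps)
    have pos: "0 < (\<theta> * \<gamma>) ^ ?n" using \<theta>(2) \<gamma>(1) by simp
    define \<alpha>' where "\<alpha>' = root ?n (measure lborel (\<Union>\<A>))"
    have "\<alpha>' ^ ?n = measure lborel (\<Union>\<A>)" "0 < \<alpha>'" using gt pos by (auto simp: \<alpha>'_def)
    moreover then have "\<theta> * \<gamma> \<le> \<alpha>'"
      using gt by (metis less_eq_real_def power_less_imp_less_base)
    moreover have "\<A> \<noteq> {}" using less_trans[OF pos gt] by auto
    ultimately show ?thesis using \<A> by (intro exI[of _ \<A>] exI[of _ \<alpha>']) auto
  qed
  obtain \<A> \<alpha>' where 1: "box_family \<A>" "\<A> \<noteq> {}" "\<Union>\<A> \<subseteq> A" "measure lborel (\<Union>\<A>) = \<alpha>' ^ ?n * 1" "\<theta> * \<alpha> \<le> \<alpha>'" "0 < \<alpha>'"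
    using approx[OF A \<alpha>] by blast
  obtain \<B> \<beta>' where 2: "box_family \<B>" "\<B> \<noteq> {}" "\<Union>\<B> \<subseteq> B" "measure lborel (\<Union>\<B>) = \<beta>' ^ ?n * 1" "\<theta> * \<beta> \<le> \<beta>'" "0 < \<beta>'"
    using approx[OF B \<beta>] by blast
  have "z * (\<alpha> + \<beta>) ^ ?n = (\<theta> * \<alpha> + \<theta> * \<beta>) ^ ?n"
    using \<theta>(1) by (simp add: distrib_left[symmetric] power_mult_distrib)
  also have "\<dots> \<le> (\<alpha>' + \<beta>') ^ ?n"
    using 1 2 \<theta> \<alpha> \<beta> by (intro power_mono add_mono) auto
  also have "\<dots> * 1 \<le> measure lborel C"
    using 1 2 C by (intro bm_ineqD[OF bm_ineq_box_families]) auto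
  finally show "z * (\<alpha> + \<beta>) ^ ?n \<le> measure lborel C" by simp
qed

lemma bounded_neighbourhood:
  fixes A :: "'a::real_normed_vector set"
  assumes "bounded A"
  shows "bounded (\<Union>y\<in>A. ball y \<epsilon>)"
proof -
  obtain R where R: "\<And>x. x \<in> A \<Longrightarrow> norm x \<le> R" using assms by (auto simp: bounded_iff)
  show ?thesis
    unfolding bounded_iff
  proof (intro exI ballI)
    fix x assume "x \<in> (\<Union>y\<in>A. ball y \<epsilon>)"
    then obtain y where "y \<in> A" "dist y x < \<epsilon>" by auto
    then show "norm x \<le> R + \<epsilon>"
      using R[of y] norm_triangle_ineq2[of x y] by (simp add: dist_norm norm_minus_commute)
  qed
qed

text \<open>Isoperimetric inequality in its finite form: Brunn--Minkowski with a ball of radius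
  \<open>\<epsilon>\<close>, followed by Bernoulli's inequality, which keeps the part of
  \<open>(r + \<epsilon>) ^ n\<close> that is linear in \<open>\<epsilon>\<close>.\<close>

lemma measure_neighbourhood_ge:
  fixes A :: "'a::euclidean_space set"
  assumes A: "open A" "bounded A" and r: "r > 0" "measure lborel A = unit_ball_vol DIM('a) * r ^ DIM('a)"
    and \<epsilon>: "\<epsilon> > 0"
  shows "measure lborel A + \<epsilon> * (DIM('a) * unit_ball_vol DIM('a)) * r ^ (DIM('a) - 1)
    \<le> measure lborel (\<Union>y\<in>A. ball y \<epsilon>)"
proof -
  let ?n = "DIM('a)" and ?w = "unit_ball_vol (real DIM('a))"
  have w: "?w > 0" by simp
  define \<kappa> where "\<kappa> = root ?n ?w"
  have \<kappa>: "\<kappa> > 0" "\<kappa> ^ ?n = ?w" using w by (auto simp: \<kappa>_def)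
  have "bounded (\<Union>y\<in>A. ball y \<epsilon>)" using A(2) by (rule bounded_neighbourhood)
  then have fm: "(\<Union>y\<in>A. ball y \<epsilon>) \<in> fmeasurable lborel"
    by (intro fmeasurableI emeasure_bounded_finite) (auto simp: borel_open open_UN)
  have "?w * (r ^ ?n + ?n * r ^ (?n - 1) * \<epsilon>) \<le> ?w * (r + \<epsilon>) ^ ?n"
  proof (rule mult_left_mono)
    have "1 + ?n * (\<epsilon> / r) \<le> (1 + \<epsilon> / r) ^ ?n"
      using r \<epsilon> by (intro Bernoulli_inequality) (auto intro: order_trans[of _ 0])
    then have "r ^ ?n * (1 + ?n * (\<epsilon> / r)) \<le> r ^ ?n * (1 + \<epsilon> / r) ^ ?n"
      using r by (intro mult_left_mono) auto
    also have "\<dots> = (r + \<epsilon>) ^ ?n" using r by (simp add: power_mult_distrib[symmetric] distrib_left)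
    also have "r ^ ?n * (1 + ?n * (\<epsilon> / r)) = r ^ ?n + ?n * r ^ (?n - 1) * \<epsilon>"
      using r power_Suc[of r "?n - 1"] by (simp add: field_simps)
    finally show "r ^ ?n + ?n * r ^ (?n - 1) * \<epsilon> \<le> (r + \<epsilon>) ^ ?n" .
  qed (use w in simp)
  also have "\<dots> = (\<kappa> * r + \<kappa> * \<epsilon>) ^ ?n"
    using \<kappa> by (simp add: distrib_left[symmetric] power_mult_distrib)
  also have "\<dots> \<le> measure lborel (\<Union>y\<in>A. ball y \<epsilon>)"
  proof (rule brunn_minkowski_open[OF A, of "ball 0 \<epsilon>"])
    fix x y assume "x \<in> A" "y \<in> ball (0::'a) \<epsilon>"
    then show "x + y \<in> (\<Union>y\<in>A. ball y \<epsilon>)" by (auto simp: dist_norm intro!: bexI[of _ x])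
  qed (use \<kappa> r \<epsilon> fm in \<open>auto simp: power_mult_distrib content_ball\<close>)
  finally show ?thesis using r by (simp add: algebra_simps)
qed

section \<open>Isoperimetric coarea inequality\<close>

lemma emeasure_open_le_of_Ioc:
  fixes M N :: "real measure"
  assumes sets [measurable_cong]: "sets M = sets borel" "sets N = sets borel"
    and le: "\<And>t s. t < s \<Longrightarrow> emeasure N {t<..s} \<le> emeasure M {t<..s}"
    and U: "open U"
  shows "emeasure N U \<le> emeasure M U"
proof -
  \<comment> \<open>Dyadic cells, open on the left and closed on the right: those of one generation
    partition the line, and each lies in a cell of the previous generation. Hence the unions
    \<open>V k\<close> of the cells inside \<open>U\<close> increase to \<open>U\<close>.\<close>
  define I where "I k j = {real_of_int j / 2 ^ k <.. (real_of_int j + 1) / 2 ^ k}" for k :: nat and j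
  have I_lt: "real_of_int j / 2 ^ k < (real_of_int j + 1) / 2 ^ k" for k :: nat and j
    by (simp add: divide_strict_right_mono)
  define V where "V k = (\<Union>j\<in>{j. I k j \<subseteq> U}. I k j)" for k
  have I_iff: "x \<in> I k j \<longleftrightarrow> j = \<lceil>x * 2 ^ k\<rceil> - 1" for x k j
    by (auto simp: I_def field_simps) linarith+
  have Im[measurable]: "I k j \<in> sets borel" for k j by (simp add: I_def)
  have disj: "disjoint_family_on (I k) A" for k A
    by (auto simp: disjoint_family_on_def I_iff)
  have eqV: "emeasure K (V k) = (\<integral>\<^sup>+j. emeasure K (I k j) \<partial>count_space {j. I k j \<subseteq> U})"
    if "sets K = sets borel" for K k
    unfolding V_def using that by (intro emeasure_UN_countable disj) auto
  have VV: "emeasure N (V k) \<le> emeasure M (V k)" for k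
    unfolding eqV[OF sets(1)] eqV[OF sets(2)] I_def using le[OF I_lt] by (intro nn_integral_mono) auto
  have "V k \<subseteq> V (Suc k)" for k
  proof
    fix x assume "x \<in> V k"
    then obtain j where j: "I k j \<subseteq> U" "x \<in> I k j" by (auto simp: V_def)
    let ?i = "\<lceil>x * 2 ^ Suc k\<rceil> - 1"
    have x: "x \<in> I (Suc k) ?i" by (simp add: I_iff)
    have "I (Suc k) ?i \<subseteq> I k j"
    proof
      fix y assume "y \<in> I (Suc k) ?i"
      then have y: "\<lceil>y * 2 ^ Suc k\<rceil> = \<lceil>x * 2 ^ Suc k\<rceil>" by (simp add: I_iff)
      \<comment> \<open>Nesting of the cells: the index in the finer generation determines the index
        in the coarser one.\<close>
      have dbl: "\<lceil>u\<rceil> = \<lceil>v\<rceil>" if "\<lceil>2 * u\<rceil> = \<lceil>2 * v\<rceil>" for u v :: real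
      proof -
        have iff: "\<lceil>w\<rceil> \<le> m \<longleftrightarrow> \<lceil>2 * w\<rceil> \<le> 2 * m" for w :: real and m
          by (simp add: ceiling_le_iff)
        show ?thesis using iff[of u "\<lceil>v\<rceil>"] iff[of v "\<lceil>u\<rceil>"] iff[of u "\<lceil>u\<rceil>"] iff[of v "\<lceil>v\<rceil>"] that
          by simp
      qed
      have "\<lceil>y * 2 ^ k\<rceil> = \<lceil>x * 2 ^ k\<rceil>" using y by (rule_tac dbl) (simp add: mult_ac)
      then show "y \<in> I k j" using j(2) by (simp add: I_iff)
    qed
    then have "I (Suc k) ?i \<subseteq> U" using j(1) by blast
    then show "x \<in> V (Suc k)" using x by (auto simp: V_def)
  qed
  then have inc: "incseq V" by (rule incseq_SucI)
  have Vm: "V k \<in> sets borel" for k unfolding V_def by (intro sets.countable_UN'') auto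
  have UV: "(\<Union>k. V k) = U"
  proof
    show "(\<Union>k. V k) \<subseteq> U" by (auto simp: V_def)
    show "U \<subseteq> (\<Union>k. V k)"
    proof
      fix x assume "x \<in> U"
      then obtain e where e: "e > 0" "ball x e \<subseteq> U" using U open_contains_ball by blast
      obtain k where k: "(1 / 2 :: real) ^ k < e" using e(1) real_arch_pow_inv[of e "1/2"] by auto
      let ?j = "\<lceil>x * 2 ^ k\<rceil> - 1"
      have x: "x \<in> I k ?j" by (simp add: I_iff)
      have "I k ?j \<subseteq> ball x e"
      proof
        fix y assume "y \<in> I k ?j"
        with x have "\<bar>x - y\<bar> < (real_of_int ?j + 1) / 2 ^ k - real_of_int ?j / 2 ^ k"
          unfolding I_def by auto
        also have "\<dots> = (1 / 2) ^ k" by (simp add: diff_divide_distrib[symmetric] power_divide)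
        finally show "y \<in> ball x e" using k by (simp add: dist_real_def)
      qed
      then show "x \<in> (\<Union>k. V k)" using x e(2) by (auto simp: V_def)
    qed
  qed
  have "emeasure N U = (SUP k. emeasure N (V k))"
    using inc Vm UV sets by (subst SUP_emeasure_incseq) auto
  also have "\<dots> \<le> (SUP k. emeasure M (V k))" using VV by (intro SUP_mono) auto
  also have "\<dots> = emeasure M U"
    using inc Vm UV sets by (subst SUP_emeasure_incseq) auto
  finally show ?thesis .
qed

text \<open>Outer regularity carries the comparison from open sets to Borel sets, but needs a finite
  measure. Both measures are therefore restricted to intervals bounded away from 0 and from
  infinity, which then exhaust the half-line.\<close>

lemma nn_integral_le_of_Ioc:
  fixes M N :: "real measure"
  assumes sets [measurable_cong]: "sets M = sets borel" "sets N = sets borel"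
    and le: "\<And>t s. 0 < t \<Longrightarrow> t < s \<Longrightarrow> emeasure N {t<..s} \<le> emeasure M {t<..s}"
    and fin: "\<And>t s. 0 < t \<Longrightarrow> t < s \<Longrightarrow> emeasure M {t<..s} < \<infinity>"
    and a [measurable]: "a \<in> borel_measurable borel"
  shows "(\<integral>\<^sup>+s. a s * indicator {0<..} s \<partial>N) \<le> (\<integral>\<^sup>+s. a s * indicator {0<..} s \<partial>M)"
proof -
  have step1: "emeasure N (A \<inter> {c<..d}) \<le> emeasure M (A \<inter> {c<..d})"
    if A: "A \<in> sets borel" and c: "0 < c" "c < d" for A c d
  proof -
    define M1 where "M1 = density M (indicator {c<..d})"
    define N1 where "N1 = density N (indicator {c<..d})"
    have s1: "sets M1 = sets borel" "sets N1 = sets borel" by (auto simp: M1_def N1_def sets)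
    have em: "emeasure M1 B = emeasure M (B \<inter> {c<..d})" "emeasure N1 B = emeasure N (B \<inter> {c<..d})"
      if "B \<in> sets borel" for B
      using that by (simp_all add: M1_def N1_def emeasure_density indicator_inter_arith[symmetric] Int_commute)
    have "space M1 = UNIV" using sets_eq_imp_space_eq[OF s1(1)] by simp
    then have "emeasure M1 (space M1) \<noteq> \<infinity>" using fin[OF c] em[of UNIV] by simp
    from outer_regular[OF s1(1) this A]
    have "emeasure M1 A = (INF U\<in>{U. A \<subseteq> U \<and> open U}. emeasure M1 U)" .
    also have "emeasure N1 A \<le> \<dots>"
    proof (rule INF_greatest)
      fix U assume "U \<in> {U. A \<subseteq> U \<and> open U}"
      then have U: "A \<subseteq> U" "open U" by auto
      have "emeasure N1 A \<le> emeasure N1 U" using U s1 by (intro emeasure_mono) auto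
      also have "\<dots> \<le> emeasure M1 U"
      proof (rule emeasure_open_le_of_Ioc[OF s1 _ U(2)])
        fix t s :: real assume "t < s"
        have eq: "{t<..s} \<inter> {c<..d} = {max t c<..min s d}" by auto
        show "emeasure N1 {t<..s} \<le> emeasure M1 {t<..s}"
          using le[of "max t c" "min s d"] c by (cases "max t c < min s d") (auto simp: em eq)
      qed
      finally show "emeasure N1 A \<le> emeasure M1 U" .
    qed
    finally show ?thesis using A by (simp add: em)
  qed
  have step2: "emeasure N (A \<inter> {0<..}) \<le> emeasure M (A \<inter> {0<..})" if A: "A \<in> sets borel" for A
  proof -
    define B where "B k = A \<inter> {1 / (real k + 2) <.. real k + 1}" for k
    have inc: "incseq B"
      unfolding B_def
    proof (intro monoI Int_mono order_refl)
      fix k l :: nat assume "k \<le> l"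
      moreover then have "1 / (real l + 2) \<le> 1 / (real k + 2)" by (intro divide_left_mono) auto
      ultimately show "{1 / (real k + 2) <.. real k + 1} \<subseteq> {1 / (real l + 2) <.. real l + 1}" by auto
    qed
    have Bm: "B k \<in> sets borel" for k using A by (simp add: B_def)
    have "\<exists>k. 1 / (real k + 2) < x \<and> x \<le> real k + 1" if "x > 0" for x :: real
    proof -
      obtain k where k: "real k > max x (1 / x)" using reals_Archimedean2 by blast
      then have "1 / x < real k + 2" "x \<le> real k + 1" by auto
      then show ?thesis using that by (intro exI[of _ k]) (auto simp: field_simps)
    qed
    note ex = this
    have UB: "(\<Union>k. B k) = A \<inter> {0<..}"
    proof (intro equalityI subsetI)
      fix x assume "x \<in> (\<Union>k. B k)"
      then obtain k where k: "x \<in> A" "1 / (real k + 2) < x" by (auto simp: B_def)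
      have "0 < 1 / (real k + 2)" by simp
      also note k(2)
      finally show "x \<in> A \<inter> {0<..}" using k(1) by simp
    next
      fix x assume "x \<in> A \<inter> {0<..}"
      then show "x \<in> (\<Union>k. B k)" using ex[of x] by (auto simp: B_def)
    qed
    have "emeasure N (A \<inter> {0<..}) = (SUP k. emeasure N (B k))"
      using inc Bm UB sets by (subst SUP_emeasure_incseq) auto
    also have "\<dots> \<le> (SUP k. emeasure M (B k))"
    proof (intro SUP_mono bexI)
      fix k :: nat
      have "1 / (real k + 2) < 1" by simp
      also have "1 \<le> real k + 1" by simp
      finally show "emeasure N (B k) \<le> emeasure M (B k)"
        unfolding B_def using A by (intro step1) auto
    qed auto
    also have "\<dots> = emeasure M (A \<inter> {0<..})"
      using inc Bm UB sets by (subst SUP_emeasure_incseq) auto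
    finally show ?thesis .
  qed
  have "(\<integral>\<^sup>+s. a s * indicator {0<..} s \<partial>N) = (\<integral>\<^sup>+s. a s \<partial>density N (indicator {0<..}))"
    by (subst nn_integral_density) (auto simp: mult.commute)
  also have "\<dots> \<le> (\<integral>\<^sup>+s. a s \<partial>density M (indicator {0<..}))"
  proof (rule nn_integral_mono_measure)
    show "density N (indicator {0<..}) \<le> density M (indicator {0<..})"
      unfolding le_measure_iff
    proof (simp add: sets sets_eq_imp_space_eq[OF sets(1)] sets_eq_imp_space_eq[OF sets(2)], intro le_funI)
      fix A
      show "emeasure (density N (indicator {0<..})) A \<le> emeasure (density M (indicator {0<..})) A"
      proof (cases "A \<in> sets borel")
        case True
        then show ?thesis using step2[OF True]
          by (simp add: emeasure_density indicator_inter_arith[symmetric] Int_commute)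
      next
        case False
        then show ?thesis by (simp add: emeasure_notin_sets sets)
      qed
    qed
  qed (simp add: sets)
  also have "\<dots> = (\<integral>\<^sup>+s. a s * indicator {0<..} s \<partial>M)"
    by (subst nn_integral_density) (auto simp: mult.commute)
  finally show ?thesis .
qed

text \<open>The superlevel sets of the sup-convolution \<open>ge \<epsilon>\<close> of \<open>norm \<circ> f\<close> are the
  \<open>\<epsilon>\<close>-neighbourhoods of those of \<open>norm \<circ> f\<close>, and its difference quotients are asymptotically
  at most \<open>G\<close>.\<close>

lemma coarea_isoperimetric_Icc:
  fixes f :: "'a::euclidean_space \<Rightarrow> 'b::real_normed_vector"
  assumes n: "DIM('a) \<ge> 2"
    and L: "L \<ge> 0" and lip: "\<And>x y. norm (f x - f y) \<le> L * norm (x - y)"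
    and bdd: "\<And>t. t > 0 \<Longrightarrow> bounded {x. norm (f x) > t}"
    and der: "\<And>x. (f has_derivative D x) (at x)"
    and DG: "\<And>x h. norm (D x h) \<le> G x * norm h" and G0: "\<And>x. 0 \<le> G x"
    and G [measurable]: "G \<in> borel_measurable borel"
    and r [measurable]: "r \<in> borel_measurable borel" and r0: "\<And>v. v > 0 \<Longrightarrow> 0 \<le> r v"
    and r_eq: "\<And>v. v > 0 \<Longrightarrow> measure lborel {x. norm (f x) > v} = unit_ball_vol DIM('a) * r v ^ DIM('a)"
    and ts: "0 < t" "t < s"
  shows "(\<integral>\<^sup>+v. ennreal (DIM('a) * unit_ball_vol DIM('a) * r v ^ (DIM('a) - 1)) * indicator {t<..<s} v \<partial>lborel)
    \<le> (\<integral>\<^sup>+x. ennreal (G x) * indicator {x. t \<le> norm (f x) \<and> norm (f x) \<le> s} x \<partial>lborel)"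
    (is "?lhs \<le> ?rhs")
proof -
  let ?n = "DIM('a)" and ?w = "unit_ball_vol (real DIM('a))"
  define g where "g x = norm (f x)" for x
  define ge where "ge \<epsilon> x = (SUP y\<in>ball x \<epsilon>. g y)" for \<epsilon> x
  \<comment> \<open>Clipping the values to the interval from \<open>t\<close> to \<open>s\<close>
    confines the difference quotients to points near the shell \<open>t \<le> g x \<le> s\<close>, a
    bounded set because \<open>t > 0\<close>.\<close>
  define cl where "cl y = min s (max t y)" for y :: real
  have contf: "continuous_on UNIV f"
    using der by (meson has_derivative_continuous continuous_at_imp_continuous_on)
  have contg: "continuous_on UNIV g" unfolding g_def by (intro continuous_on_norm contf)
  then have gm [measurable]: "g \<in> borel_measurable borel" by (rule borel_measurable_continuous_onI)
  have fm [measurable]: "(\<lambda>x. norm (f x)) \<in> borel_measurable borel" using gm unfolding g_def .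
  have openg: "open {x. g x > v}" for v
    using open_Collect_less[OF continuous_on_const contg] by auto
  have glip: "g y \<le> g x + L * norm (y - x)" for x y
    using lip[of y x] norm_triangle_ineq2[of "f y" "f x"] by (simp add: g_def)
  have bddg: "bdd_above (g ` ball x \<epsilon>)" for x \<epsilon>
  proof (rule bdd_aboveI2)
    fix y assume "y \<in> ball x \<epsilon>"
    then have "L * norm (y - x) \<le> L * \<epsilon>"
      using L by (intro mult_left_mono) (auto simp: dist_norm norm_minus_commute)
    then show "g y \<le> g x + L * \<epsilon>" using glip[of y x] by linarith
  qed
  have ge_le: "ge \<epsilon> x \<le> b" if "\<epsilon> > 0" "\<And>y. norm (y - x) < \<epsilon> \<Longrightarrow> g y \<le> b" for \<epsilon> x b
    unfolding ge_def using that by (intro cSUP_least) (auto simp: dist_norm norm_minus_commute)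
  have g_le_ge: "g x \<le> ge \<epsilon> x" if "\<epsilon> > 0" for \<epsilon> x
    unfolding ge_def using that by (intro cSUP_upper bddg) auto
  have ge_lip: "ge \<epsilon> x \<le> g x + L * \<epsilon>" if "\<epsilon> > 0" for \<epsilon> x
  proof (rule ge_le[OF that])
    fix y assume "norm (y - x) < \<epsilon>"
    then have "L * norm (y - x) \<le> L * \<epsilon>" using L by (intro mult_left_mono) auto
    then show "g y \<le> g x + L * \<epsilon>" using glip[of y x] by linarith
  qed
  have level: "{x. ge \<epsilon> x > v} = (\<Union>y\<in>{x. g x > v}. ball y \<epsilon>)" if "\<epsilon> > 0" for \<epsilon> v
    unfolding ge_def using that less_cSUP_iff[OF _ bddg] by (auto simp: dist_commute)
  have gem: "ge \<epsilon> \<in> borel_measurable borel" if "\<epsilon> > 0" for \<epsilon>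
    unfolding borel_measurable_iff_greater using that
    by (auto simp: level intro!: borel_open open_UN)
  \<comment> \<open>The shell gained by the \<open>\<epsilon>\<close>-neighbourhood of a superlevel
    set has volume at least \<open>\<epsilon>\<close> times the surface area of the ball of radius
    \<open>r v\<close>. For \<open>r v = 0\<close> the left side vanishes because the exponent
    \<open>?n - 1\<close> is positive.\<close>
  have vol: "ennreal (?n * ?w * r v ^ (?n - 1)) * ennreal \<epsilon> \<le> emeasure lborel {x. g x \<le> v \<and> v < ge \<epsilon> x}"
    if \<epsilon>: "\<epsilon> > 0" and v: "v > 0" for \<epsilon> v
  proof (cases "r v = 0")
    case True
    then show ?thesis using n by (simp add: power_0_left)
  next
    case False
    let ?A = "{x. g x > v}" and ?B = "{x. ge \<epsilon> x > v}"
    have A: "open ?A" "bounded ?A" using openg bdd[OF v] by (auto simp: g_def)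
    have "bounded (\<Union>y\<in>?A. ball y \<epsilon>)" using A(2) by (rule bounded_neighbourhood)
    then have Bf: "?B \<in> fmeasurable lborel"
      unfolding level[OF \<epsilon>] by (intro fmeasurableI emeasure_bounded_finite) (auto simp: borel_open open_UN)
    have Af: "?A \<in> fmeasurable lborel"
      using A by (intro fmeasurableI emeasure_bounded_finite) (auto simp: borel_open)
    have sub: "?A \<subseteq> ?B" using g_le_ge[OF \<epsilon>] by (auto intro: less_le_trans)
    have "measure lborel ?A + \<epsilon> * (?n * ?w) * r v ^ (?n - 1) \<le> measure lborel ?B"
      unfolding level[OF \<epsilon>] using False r0[OF v] r_eq[OF v] A \<epsilon>
      by (intro measure_neighbourhood_ge) (auto simp: g_def)
    then have "?n * ?w * r v ^ (?n - 1) * \<epsilon> \<le> measure lborel (?B - ?A)"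
      using measurable_measure_Diff[OF Bf _ sub] Af by (simp add: fmeasurableD algebra_simps)
    also have "?B - ?A = {x. g x \<le> v \<and> v < ge \<epsilon> x}" by auto
    finally show ?thesis
      using \<epsilon> r0[OF v] Bf Af fmeasurable_Diff[OF Bf fmeasurableD[OF Af]]
      by (subst ennreal_mult[symmetric]) (auto simp: emeasure_eq_measure2 \<open>?B - ?A = _\<close> intro!: ennreal_leI)
  qed
  define e where "e k = 1 / (real k + 1)" for k :: nat
  have e0: "e k > 0" for k by (simp add: e_def)
  have e1: "e k \<le> 1" for k by (simp add: e_def field_simps)
  have e_tendsto: "e \<longlonglongrightarrow> 0" unfolding e_def
    using LIMSEQ_inverse_real_of_nat by (simp add: inverse_eq_divide add.commute)
  define h where "h k x = ennreal ((cl (ge (e k) x) - cl (g x)) / e k)" for k x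
  have clm [measurable]: "cl \<in> borel_measurable borel" unfolding cl_def by measurable
  have gekm [measurable]: "ge (e k) \<in> borel_measurable borel" for k using gem[OF e0] .
  have hm [measurable]: "h k \<in> borel_measurable borel" for k unfolding h_def by measurable
  have cl_mono: "cl x \<le> cl y" if "x \<le> y" for x y using that by (auto simp: cl_def)
  \<comment> \<open>The levels \<open>v\<close> between \<open>t\<close> and \<open>s\<close> whose
    shell contains a given point form an interval whose length is the clipped increment; this is the
    inner integral after exchanging the order of integration.\<close>
  have slice: "(\<integral>\<^sup>+v. indicator {t<..<s} v * indicator {x'. a \<le> x' \<and> x' < b} v \<partial>lborel) = ennreal (cl b - cl a)"
    if "a \<le> b" for a b
  proof -
    have "(\<integral>\<^sup>+v. indicator {t<..<s} v * indicator {x'. a \<le> x' \<and> x' < b} v \<partial>lborel)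
      = emeasure lborel ({t<..<s} \<inter> {a..<b})"
    proof -
      have "indicator {t<..<s} v * indicator {x'. a \<le> x' \<and> x' < b} v
        = (indicator ({t<..<s} \<inter> {a..<b}) v :: ennreal)" for v
        by (auto simp: indicator_def)
      then show ?thesis by simp
    qed
    also have "\<dots> = emeasure lborel {cl a..<cl b}"
    proof (rule emeasure_eq_AE)
      have "AE x in lborel. x \<noteq> t" "AE x in lborel. x \<noteq> s" by (rule AE_lborel_singleton)+
      then show "AE x in lborel. x \<in> {t<..<s} \<inter> {a..<b} \<longleftrightarrow> x \<in> {cl a..<cl b}"
        by eventually_elim (use ts in \<open>auto simp: cl_def\<close>)
    qed auto
    also have "\<dots> = ennreal (cl b - cl a)" using cl_mono[OF that] by simp
    finally show ?thesis .
  qed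
  have int_h: "?lhs \<le> (\<integral>\<^sup>+x. h k x \<partial>lborel)" for k
  proof -
    have "?lhs * ennreal (e k)
      = (\<integral>\<^sup>+v. ennreal (?n * ?w * r v ^ (?n - 1)) * indicator {t<..<s} v * ennreal (e k) \<partial>lborel)"
      by (rule nn_integral_multc[symmetric]) measurable
    also have "\<dots> \<le> (\<integral>\<^sup>+v. indicator {t<..<s} v * emeasure lborel {x. g x \<le> v \<and> v < ge (e k) x} \<partial>lborel)"
      using vol[OF e0] ts by (intro nn_integral_mono) (auto simp: indicator_def)
    also have "\<dots> = (\<integral>\<^sup>+v. (\<integral>\<^sup>+x. indicator {t<..<s} v * indicator {x'. g x \<le> x' \<and> x' < ge (e k) x} v \<partial>lborel) \<partial>lborel)"
    proof (rule nn_integral_cong)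
      fix v :: real
      have "{x \<in> space lborel. g x \<le> v \<and> v < ge (e k) x} \<in> sets lborel" by measurable
      then have m: "{x. g x \<le> v \<and> v < ge (e k) x} \<in> sets lborel" by simp
      show "indicator {t<..<s} v * emeasure lborel {x. g x \<le> v \<and> v < ge (e k) x}
        = (\<integral>\<^sup>+x. indicator {t<..<s} v * indicator {x'. g x \<le> x' \<and> x' < ge (e k) x} v \<partial>lborel)"
        using m by (subst nn_integral_cmult_indicator[symmetric])
                   (auto intro!: nn_integral_cong simp: indicator_def)
    qed
    also have "\<dots> = (\<integral>\<^sup>+x. (\<integral>\<^sup>+v. indicator {t<..<s} v * indicator {x'. g x \<le> x' \<and> x' < ge (e k) x} v \<partial>lborel) \<partial>lborel)"
      by (rule lborel_pair.Fubini') (simp add: indicator_def, measurable)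
    also have "\<dots> = (\<integral>\<^sup>+x. ennreal (cl (ge (e k) x) - cl (g x)) \<partial>lborel)"
      using slice[OF g_le_ge[OF e0]] by simp
    also have "\<dots> = (\<integral>\<^sup>+x. h k x * ennreal (e k) \<partial>lborel)"
      unfolding h_def using e0[of k] cl_mono[OF g_le_ge[OF e0]]
      by (intro nn_integral_cong) (subst ennreal_mult[symmetric], auto)
    also have "\<dots> = (\<integral>\<^sup>+x. h k x \<partial>lborel) * ennreal (e k)"
      by (rule nn_integral_multc) measurable
    finally show ?thesis
      using e0[of k] by (simp add: mult.commute[of _ "ennreal (e k)"] ennreal_mult_le_mult_iff)
  qed
  obtain R where R: "\<And>x. g x > t \<Longrightarrow> norm x \<le> R"
    using bdd[OF ts(1)] unfolding bounded_iff g_def by blast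
  \<comment> \<open>A dominating function for the reverse Fatou lemma: the quotients are at most
    \<open>L\<close> by the Lipschitz bound. They vanish outside radius \<open>R + 1\<close> since
    \<open>e k \<le> 1\<close>.\<close>
  define w where "w x = ennreal L * indicator (cball (0::'a) (R + 1)) x" for x
  have wm: "w \<in> borel_measurable lborel" unfolding w_def by (intro borel_measurable_times_ennreal borel_measurable_indicator) auto
  have "(\<integral>\<^sup>+x. w x \<partial>lborel) = ennreal L * emeasure lborel (cball (0::'a) (R + 1))"
    unfolding w_def by (simp add: nn_integral_cmult_indicator)
  also have "\<dots> < \<infinity>"
    using emeasure_bounded_finite[OF bounded_cball[of "0::'a" "R + 1"]] by (simp add: ennreal_mult_less_top)
  finally have w_fin: "(\<integral>\<^sup>+x. w x \<partial>lborel) < \<infinity>" .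
  have h_w: "h k x \<le> w x" for k x
  proof (cases "norm x \<le> R + 1")
    case True
    have "cl (ge (e k) x) - cl (g x) \<le> ge (e k) x - g x"
      using g_le_ge[OF e0, of x k] by (auto simp: cl_def)
    also have "\<dots> \<le> L * e k" using ge_lip[OF e0, of k x] by simp
    finally show ?thesis using True e0[of k] by (auto simp: h_def w_def divide_le_eq intro!: ennreal_leI)
  next
    case False
    have "ge (e k) x \<le> t"
    proof (rule ge_le[OF e0], rule ccontr)
      fix y assume y: "norm (y - x) < e k" "\<not> g y \<le> t"
      then have "norm y \<le> R" using R by auto
      then show False using False y(1) e1[of k] norm_triangle_ineq2[of x y] by (simp add: norm_minus_commute)
    qed
    moreover then have "g x \<le> t" using g_le_ge[OF e0, of x k] by linarith
    ultimately show ?thesis by (simp add: h_def cl_def)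
  qed
  \<comment> \<open>Below \<open>t\<close> the clipped increment vanishes eventually, above
    \<open>s\<close> it vanishes always. In between, differentiability bounds the growth of
    \<open>g\<close> over a small ball by \<open>G x + d\<close> times its radius.\<close>
  have lims: "limsup (\<lambda>k. h k x) \<le> ennreal (G x) * indicator {x. t \<le> norm (f x) \<and> norm (f x) \<le> s} x" for x
  proof -
    consider "g x < t" | "g x > s" | "t \<le> g x \<and> g x \<le> s" by linarith
    then show ?thesis
    proof cases
      case 1
      have "(\<lambda>k. g x + L * e k) \<longlonglongrightarrow> g x + L * 0" by (intro tendsto_intros e_tendsto)
      then have "eventually (\<lambda>k. g x + L * e k < t) sequentially" using 1 by (auto intro: order_tendstoD)
      then have "eventually (\<lambda>k. h k x \<le> 0) sequentially"
      proof eventually_elim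
        case (elim k)
        then have "ge (e k) x < t" using ge_lip[OF e0, of k x] by linarith
        then show ?case using 1 by (simp add: h_def cl_def)
      qed
      then have "limsup (\<lambda>k. h k x) \<le> 0" by (rule Limsup_bounded)
      then show ?thesis by (simp add: order_trans)
    next
      case 2
      have "h k x = 0" for k
        using g_le_ge[OF e0, of x k] 2 ts by (simp add: h_def cl_def)
      then show ?thesis by (simp add: Limsup_const)
    next
      case 3
      have "limsup (\<lambda>k. h k x) \<le> ennreal (G x)"
      proof (rule ennreal_le_epsilon)
        fix d :: real assume d: "d > 0"
        from der[of x] obtain \<delta> where \<delta>: "\<delta> > 0"
          "\<And>y. norm (y - x) < \<delta> \<Longrightarrow> norm (f y - f x - D x (y - x)) \<le> d * norm (y - x)"
          using d by (metis has_derivative_at_alt)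
        have "eventually (\<lambda>k. e k < \<delta>) sequentially" using e_tendsto \<delta>(1) by (rule order_tendstoD)
        then have "eventually (\<lambda>k. h k x \<le> ennreal (G x + d)) sequentially"
        proof eventually_elim
          case (elim k)
          have "ge (e k) x \<le> g x + (G x + d) * e k"
          proof (rule ge_le[OF e0])
            fix y assume y: "norm (y - x) < e k"
            have "g y - g x \<le> norm (f y - f x)" unfolding g_def by (rule norm_triangle_ineq2)
            also have "\<dots> \<le> norm (f y - f x - D x (y - x)) + norm (D x (y - x))"
              using norm_triangle_ineq[of "f y - f x - D x (y - x)" "D x (y - x)"] by simp
            also have "\<dots> \<le> d * norm (y - x) + G x * norm (y - x)"
              using \<delta>(2)[of y] y elim DG[of x "y - x"] by auto
            also have "\<dots> = (G x + d) * norm (y - x)" by (simp add: algebra_simps)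
            also have "\<dots> \<le> (G x + d) * e k" using y d G0[of x] by (intro mult_left_mono) auto
            finally show "g y \<le> g x + (G x + d) * e k" by simp
          qed
          moreover have "cl (ge (e k) x) - cl (g x) \<le> ge (e k) x - g x"
            using g_le_ge[OF e0, of x k] by (auto simp: cl_def)
          ultimately have "cl (ge (e k) x) - cl (g x) \<le> (G x + d) * e k" by linarith
          then show ?case using e0[of k] by (auto simp: h_def divide_le_eq intro!: ennreal_leI)
        qed
        then have "limsup (\<lambda>k. h k x) \<le> ennreal (G x + d)" by (rule Limsup_bounded)
        then show "limsup (\<lambda>k. h k x) \<le> ennreal (G x) + ennreal d" using G0[of x] d by simp
      qed
      then show ?thesis using 3 by (simp add: g_def)
    qed
  qed
  have "?lhs \<le> limsup (\<lambda>k. \<integral>\<^sup>+x. h k x \<partial>lborel)"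
    using int_h by (intro le_Limsup) auto
  also have "\<dots> \<le> (\<integral>\<^sup>+x. limsup (\<lambda>k. h k x) \<partial>lborel)"
    using h_w w_fin wm by (intro nn_integral_limsup[where w=w]) auto
  also have "\<dots> \<le> ?rhs" using lims by (intro nn_integral_mono) simp
  finally show ?thesis .
qed

text \<open>Both sides integrate \<open>a\<close> against measures on the set of levels: the surface
  areas \<open>r v ^ (n - 1)\<close> as a density, and the image of \<open>G\<close> under
  \<open>norm \<circ> f\<close>. It is enough to compare these on half-open intervals, and the bound
  \<open>K\<close> makes the second one finite there.\<close>

theorem coarea_isoperimetric:
  fixes f :: "'a::euclidean_space \<Rightarrow> 'b::real_normed_vector" and a :: "real \<Rightarrow> ennreal"
  assumes n: "DIM('a) \<ge> 2"
    and L: "L \<ge> 0" and lip: "\<And>x y. norm (f x - f y) \<le> L * norm (x - y)"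
    and bdd: "\<And>t. t > 0 \<Longrightarrow> bounded {x. norm (f x) > t}"
    and der: "\<And>x. (f has_derivative D x) (at x)"
    and DG: "\<And>x h. norm (D x h) \<le> G x * norm h" and G0: "\<And>x. 0 \<le> G x" and GK: "\<And>x. G x \<le> K"
    and G [measurable]: "G \<in> borel_measurable borel"
    and r [measurable]: "r \<in> borel_measurable borel" and r0: "\<And>v. v > 0 \<Longrightarrow> 0 \<le> r v"
    and r_eq: "\<And>v. v > 0 \<Longrightarrow> measure lborel {x. norm (f x) > v} = unit_ball_vol DIM('a) * r v ^ DIM('a)"
    and a [measurable]: "a \<in> borel_measurable borel"
  shows "(\<integral>\<^sup>+v. a v * indicator {0<..} v * ennreal (DIM('a) * unit_ball_vol DIM('a) * r v ^ (DIM('a) - 1)) \<partial>lborel)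
    \<le> (\<integral>\<^sup>+x. a (norm (f x)) * indicator {0<..} (norm (f x)) * ennreal (G x) \<partial>lborel)"
proof -
  let ?R = "\<lambda>v. ennreal (DIM('a) * unit_ball_vol DIM('a) * r v ^ (DIM('a) - 1))"
  have contf: "continuous_on UNIV f"
    using der by (meson has_derivative_continuous continuous_at_imp_continuous_on)
  have fm [measurable]: "(\<lambda>x. norm (f x)) \<in> borel_measurable borel"
    by (intro borel_measurable_continuous_onI continuous_on_norm contf)
  define N where "N = density lborel ?R"
  define M where "M = distr (density lborel (\<lambda>x. ennreal (G x))) borel (\<lambda>x. norm (f x))"
  have sets: "sets M = sets borel" "sets N = sets borel" by (auto simp: M_def N_def)
  have emM: "emeasure M A = (\<integral>\<^sup>+x. ennreal (G x) * indicator {x. norm (f x) \<in> A} x \<partial>lborel)"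
    if [measurable]: "A \<in> sets borel" for A
  proof -
    have "(\<lambda>x. norm (f x)) -` A \<in> sets borel" using measurable_sets[OF fm that] by simp
    then show ?thesis unfolding M_def
      by (subst emeasure_distr) (auto simp: emeasure_density vimage_def)
  qed
  have emN: "emeasure N A = (\<integral>\<^sup>+v. ?R v * indicator A v \<partial>lborel)" if "A \<in> sets borel" for A
    using that unfolding N_def by (intro emeasure_density) auto
  have "(\<integral>\<^sup>+v. a v * indicator {0<..} v \<partial>N) \<le> (\<integral>\<^sup>+v. a v * indicator {0<..} v \<partial>M)"
  proof (rule nn_integral_le_of_Ioc[OF sets])
    fix t s :: real assume ts: "0 < t" "t < s"
    have "emeasure M {t<..s} \<le> (\<integral>\<^sup>+x. ennreal K * indicator {x. norm (f x) > t} x \<partial>lborel)"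
      using GK by (subst emM, simp) (intro nn_integral_mono, auto simp: indicator_def intro!: ennreal_leI)
    also have "\<dots> = ennreal K * emeasure lborel {x. norm (f x) > t}"
      by (intro nn_integral_cmult_indicator) measurable
    also have "\<dots> < \<infinity>"
      using emeasure_bounded_finite[OF bdd[OF ts(1)]] by (simp add: ennreal_mult_less_top)
    finally show "emeasure M {t<..s} < \<infinity>" .
    \<comment> \<open>The available estimate has the closed shell \<open>t \<le> norm (f x)\<close>
      on the right. Starting slightly above \<open>t\<close> puts that shell inside
      \<open>t < norm (f x)\<close>, and monotone convergence recovers the full interval.\<close>
    define B where "B k = {t + 1 / (real k + 1)<..<s}" for k :: nat
    have inc: "incseq B"
      unfolding B_def
    proof (intro monoI)
      fix k l :: nat assume "k \<le> l"
      then have "1 / (real l + 1) \<le> 1 / (real k + 1)" by (intro divide_left_mono) auto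
      then show "{t + 1 / (real k + 1)<..<s} \<subseteq> {t + 1 / (real l + 1)<..<s}" by auto
    qed
    have UB: "(\<Union>k. B k) = {t<..<s}"
    proof
      show "(\<Union>k. B k) \<subseteq> {t<..<s}"
      proof
        fix x assume "x \<in> (\<Union>k. B k)"
        then obtain k where k: "t + 1 / (real k + 1) < x" "x < s" by (auto simp: B_def)
        have "t < t + 1 / (real k + 1)" by simp
        also note k(1)
        finally show "x \<in> {t<..<s}" using k(2) by simp
      qed
      show "{t<..<s} \<subseteq> (\<Union>k. B k)"
      proof
        fix x assume x: "x \<in> {t<..<s}"
        then obtain k where "1 / (real k + 1) < x - t"
          using reals_Archimedean[of "x - t"] by (auto simp: inverse_eq_divide add.commute)
        then show "x \<in> (\<Union>k. B k)" using x by (auto simp: B_def intro!: exI[of _ k])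
      qed
    qed
    have "emeasure N {t<..s} = emeasure N {t<..<s}"
    proof (rule emeasure_eq_AE)
      have "AE x in lborel. x \<noteq> s" by (rule AE_lborel_singleton)
      then have "AE x in N. x \<noteq> s"
        unfolding N_def by (subst AE_density) (auto elim: eventually_mono)
      then show "AE x in N. x \<in> {t<..s} \<longleftrightarrow> x \<in> {t<..<s}" by eventually_elim auto
    qed (auto simp: sets)
    also have "\<dots> = (SUP k. emeasure N (B k))"
      using inc UB sets by (subst SUP_emeasure_incseq) (auto simp: B_def)
    also have "\<dots> \<le> emeasure M {t<..s}"
    proof (rule SUP_least)
      fix k :: nat
      let ?t = "t + 1 / (real k + 1)"
      have t': "?t > t" by simp
      show "emeasure N (B k) \<le> emeasure M {t<..s}"
      proof (cases "?t < s")
        case True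
        have "emeasure N (B k) \<le> (\<integral>\<^sup>+x. ennreal (G x) * indicator {x. ?t \<le> norm (f x) \<and> norm (f x) \<le> s} x \<partial>lborel)"
          unfolding B_def using True less_trans[OF ts(1) t']
          by (subst emN, simp) (intro coarea_isoperimetric_Icc[OF n L lip bdd der DG G0 G r r0 r_eq]; simp)
        also have "\<dots> \<le> emeasure M {t<..s}"
          using less_le_trans[OF t'] by (subst emM, simp) (intro nn_integral_mono, auto simp: indicator_def)
        finally show ?thesis .
      next
        case False
        then show ?thesis by (simp add: B_def)
      qed
    qed
    finally show "emeasure N {t<..s} \<le> emeasure M {t<..s}" .
  qed measurable
  also have "(\<integral>\<^sup>+v. a v * indicator {0<..} v \<partial>N)
      = (\<integral>\<^sup>+v. a v * indicator {0<..} v * ?R v \<partial>lborel)"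
    unfolding N_def by (subst nn_integral_density) (auto simp: mult_ac)
  also have "(\<integral>\<^sup>+v. a v * indicator {0<..} v \<partial>M)
      = (\<integral>\<^sup>+x. a (norm (f x)) * indicator {0<..} (norm (f x)) * ennreal (G x) \<partial>lborel)"
    unfolding M_def by (subst nn_integral_distr, measurable) (subst nn_integral_density, auto simp: mult_ac)
  finally show ?thesis .
qed

section \<open>Calibration of the profile\<close>

text \<open>In the application \<open>u\<close> is the decreasing rearrangement of \<open>norm \<circ> f\<close> in the variable
  \<open>w = \<bar>x\<bar> powr ((n - 2) / 2)\<close>, and \<open>z s\<close> is the radius, in this variable, of the ball with the
  volume of \<open>{x. s < norm (f x)}\<close>.\<close>

locale level_pair =
  fixes z u :: "real \<Rightarrow> real"
  assumes z_nonneg: "\<And>s. 0 \<le> z s" and u_nonneg: "\<And>w. 0 \<le> u w"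
    and z_meas [measurable]: "z \<in> borel_measurable borel"
    and u_meas [measurable]: "u \<in> borel_measurable borel"
    and galois: "\<And>s w. 0 < s \<Longrightarrow> 0 < w \<Longrightarrow> w < z s \<longleftrightarrow> s < u w"
begin

text \<open>Both \<open>z s * s\<close> and \<open>w * u w\<close> are areas of rectangles under the
  same decreasing graph, hence share their upper bounds.\<close>

lemma mult_u_le:
  assumes "\<And>s. 0 < s \<Longrightarrow> z s * s \<le> M" "0 < w"
  shows "w * u w \<le> M"
proof (rule ccontr)
  assume "\<not> w * u w \<le> M"
  then have "M / w < u w" using assms(2) by (simp add: field_simps)
  then obtain s where s: "M / w < s" "s < u w" using dense by blast
  have "0 \<le> M" using assms(1)[of 1] z_nonneg[of 1] by simp
  then have "0 \<le> M / w" using assms(2) by simp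
  with s have s0: "0 < s" by linarith
  then have "w < z s" using s(2) galois assms(2) by simp
  then have "w * s < z s * s" using s0 by simp
  moreover have "M < w * s" using s assms(2) by (simp add: field_simps)
  ultimately show False using assms(1)[OF s0] by simp
qed

text \<open>The function \<open>W (w * s)\<close> is integrated over one planar region, described on
  the left as \<open>w < z s\<close> and on the right as \<open>s < u w\<close>. The set
  \<open>Z\<close> restricts \<open>w\<close>.\<close>

lemma level_tonelli:
  fixes W :: "real \<Rightarrow> ennreal"
  assumes [measurable]: "W \<in> borel_measurable borel" "Z \<in> sets borel"
  shows "(\<integral>\<^sup>+s. (\<integral>\<^sup>+w. W (w * s) * indicator Z w * indicator {0<..<z s} w \<partial>lborel) * indicator {0<..} s \<partial>lborel)
    = (\<integral>\<^sup>+w. (\<integral>\<^sup>+s. W (w * s) * indicator {0<..<u w} s \<partial>lborel) * indicator ({0<..} \<inter> Z) w \<partial>lborel)"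
proof -
  let ?F = "\<lambda>s w. W (w * s) * indicator Z w * indicator {0<..} s * indicator {0<..} w * of_bool (w < z s)"
  have Fm: "(\<lambda>(s, w). ?F s w) \<in> borel_measurable (lborel \<Otimes>\<^sub>M lborel)"
    by measurable
  have "(\<integral>\<^sup>+s. (\<integral>\<^sup>+w. W (w * s) * indicator Z w * indicator {0<..<z s} w \<partial>lborel) * indicator {0<..} s \<partial>lborel)
      = (\<integral>\<^sup>+s. (\<integral>\<^sup>+w. ?F s w \<partial>lborel) \<partial>lborel)"
    by (intro nn_integral_cong, subst nn_integral_multc[symmetric], measurable)
       (auto intro!: nn_integral_cong simp: indicator_def)
  also have "\<dots> = (\<integral>\<^sup>+w. (\<integral>\<^sup>+s. ?F s w \<partial>lborel) \<partial>lborel)"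
    using lborel_pair.Fubini'[OF Fm] by simp
  also have "\<dots> = (\<integral>\<^sup>+w. (\<integral>\<^sup>+s. W (w * s) * indicator {0<..<u w} s \<partial>lborel) * indicator ({0<..} \<inter> Z) w \<partial>lborel)"
    by (intro nn_integral_cong, subst nn_integral_multc[symmetric], measurable)
       (auto intro!: nn_integral_cong simp: indicator_def galois)
  finally show ?thesis .
qed

end

text \<open>\<open>T\<close> is an antiderivative of \<open>W\<close>, required only below
  \<open>M\<close>, where the density used later may become singular. The gap \<open>M1 < M\<close>
  keeps all products \<open>z s * s\<close> and \<open>w * u w\<close> away from that point.\<close>

locale level_potential = level_pair +
  fixes T W :: "real \<Rightarrow> real" and M M1 z0 :: real
  assumes T0: "T 0 = 0" and T_cont: "continuous_on {0..<M} T"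
    and T_deriv: "\<And>y. 0 < y \<Longrightarrow> y < M \<Longrightarrow> (T has_real_derivative W y) (at y)"
    and W_nonneg: "\<And>y. 0 \<le> y \<Longrightarrow> y < M \<Longrightarrow> 0 \<le> W y"
    and W_meas [measurable]: "W \<in> borel_measurable borel"
    and T_meas [measurable]: "T \<in> borel_measurable borel"
    and M1: "M1 < M" and M1_bound: "\<And>s. 0 < s \<Longrightarrow> z s * s \<le> M1"
    and z0: "0 < z0"
begin

text \<open>The chain rule makes \<open>T (w * s) / s\<close> an antiderivative of
  \<open>W (w * s)\<close> in \<open>w\<close>. By symmetry the lemma also evaluates slices in the
  other variable.\<close>

lemma T_slice:
  assumes "0 < s" "0 \<le> b" "b * s < M"
  shows "(\<integral>\<^sup>+w. ennreal (W (w * s)) * indicator {0<..<b} w \<partial>lborel) = ennreal (T (b * s) / s)"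
proof -
  have lt: "w * s < M" if "w \<le> b" for w
    using mult_right_mono[OF that, of s] assms by linarith
  have "((\<lambda>w. W (w * s)) has_integral (T (b * s) / s - T (0 * s) / s)) {0..b}"
  proof (rule fundamental_theorem_of_calculus_interior[OF assms(2)])
    have "continuous_on {0..b} (\<lambda>w. T (w * s))"
      using assms lt by (intro continuous_on_compose2[OF T_cont] continuous_intros) auto
    then show "continuous_on {0..b} (\<lambda>w. T (w * s) / s)"
      using assms by (intro continuous_intros) auto
    fix w assume "w \<in> {0<..<b}"
    then have "0 < w * s" "w * s < M" using assms lt by auto
    from T_deriv[OF this] have "((\<lambda>w. T (w * s)) has_real_derivative (W (w * s) * s)) (at w)"
      by (rule DERIV_chain2) (auto intro!: derivative_eq_intros)
    then have "((\<lambda>w. T (w * s) / s) has_real_derivative (W (w * s) * s / s)) (at w)"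
      by (rule DERIV_cdivide)
    then show "((\<lambda>w. T (w * s) / s) has_vector_derivative W (w * s)) (at w)"
      using assms by (simp add: has_real_derivative_iff_has_vector_derivative)
  qed
  then have "((\<lambda>w. W (w * s)) has_integral T (b * s) / s) {0..b}" using T0 by simp
  then have "(\<integral>\<^sup>+w. ennreal (W (w * s)) * indicator {0..b} w \<partial>lborel) = ennreal (T (b * s) / s)"
    using assms lt by (intro nn_integral_has_integral_lebesgue' W_nonneg) auto
  moreover have "(\<integral>\<^sup>+w. ennreal (W (w * s)) * indicator {0<..<b} w \<partial>lborel)
      = (\<integral>\<^sup>+w. ennreal (W (w * s)) * indicator {0..b} w \<partial>lborel)"
  proof (rule nn_integral_cong_AE)
    have "AE x in lborel. x \<noteq> 0" "AE x in lborel. x \<noteq> b" by (rule AE_lborel_singleton)+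
    then show "AE w in lborel. ennreal (W (w * s)) * indicator {0<..<b} w = ennreal (W (w * s)) * indicator {0..b} w"
      by eventually_elim (auto simp: indicator_def)
  qed
  ultimately show ?thesis by simp
qed

lemma T_nonneg:
  assumes "0 \<le> y" "y < M"
  shows "0 \<le> T y"
proof (cases "y = 0")
  case False
  then have "0 < y" using assms by simp
  have "T 0 \<le> T y"
  proof (rule DERIV_nonneg_imp_increasing_open[OF assms(1)])
    show "continuous_on {0..y} T" using T_cont assms by (auto intro: continuous_on_subset)
    fix x assume "0 < x" "x < y"
    then show "\<exists>y. (T has_real_derivative y) (at x) \<and> y \<ge> 0"
      using T_deriv[of x] W_nonneg[of x] assms by auto
  qed
  then show ?thesis by (simp add: T0)
qed (simp add: T0)

text \<open>The region under the graph is cut along \<open>w = z0\<close>. A level with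
  \<open>z0 < z s\<close> meets both parts, and what it contributes below \<open>z0\<close> fills
  the rectangle with sides \<open>z0\<close> and \<open>u z0\<close>; this is \<open>J\<close>.
  Moving \<open>J\<close> from one side of the cut to the other gives both identities.\<close>

lemma level_exchange_nn:
  fixes F H :: "real \<Rightarrow> ennreal" and J :: ennreal
  defines "F \<equiv> \<lambda>s. ennreal (T (z s * s) / s)" and "H \<equiv> \<lambda>w. ennreal (T (w * u w) / w)"
    and "J \<equiv> (\<integral>\<^sup>+s. ennreal (T (z0 * s) / s) * indicator {0<..<u z0} s \<partial>lborel)"
  shows "(\<integral>\<^sup>+s. F s * indicator {s. 0 < s \<and> z0 < z s} s \<partial>lborel) = J + (\<integral>\<^sup>+w. H w * indicator {z0<..} w \<partial>lborel)" (is ?S1)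
    and "(\<integral>\<^sup>+s. F s * indicator {s. 0 < s \<and> z s \<le> z0} s \<partial>lborel) + J = (\<integral>\<^sup>+w. H w * indicator {0<..z0} w \<partial>lborel)" (is ?S2)
proof -
  have ub: "w * u w < M" if "0 < w" for w
    using mult_u_le[of M1, OF M1_bound that] M1 by simp
  have zb: "z s * s < M" if "0 < s" for s
    using M1_bound[OF that] M1 by simp
  let ?W = "\<lambda>y. ennreal (W y)"
  have H_eq: "(\<integral>\<^sup>+s. ?W (w * s) * indicator {0<..<u w} s \<partial>lborel) = H w" if "0 < w" for w
    using T_slice[OF that u_nonneg[of w]] ub[OF that] unfolding H_def by (simp add: mult.commute)
  have F_eq: "(\<integral>\<^sup>+w. ?W (w * s) * indicator {0<..<z s} w \<partial>lborel) = F s" if "0 < s" for s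
    using T_slice[OF that z_nonneg[of s] zb[OF that]] unfolding F_def .
  define A where "A Z s = (\<integral>\<^sup>+w. ?W (w * s) * indicator Z w * indicator {0<..<z s} w \<partial>lborel)" for Z s
  have A_sets [measurable]: "A Z \<in> borel_measurable borel" if [measurable]: "Z \<in> sets borel" for Z
    unfolding A_def indicator_def greaterThanLessThan_iff by measurable
  have HZ: "(\<integral>\<^sup>+s. A Z s * indicator {0<..} s \<partial>lborel) = (\<integral>\<^sup>+w. H w * indicator ({0<..} \<inter> Z) w \<partial>lborel)"
    if [measurable]: "Z \<in> sets borel" for Z
  proof -
    have "(\<integral>\<^sup>+s. A Z s * indicator {0<..} s \<partial>lborel)
      = (\<integral>\<^sup>+w. (\<integral>\<^sup>+s. ?W (w * s) * indicator {0<..<u w} s \<partial>lborel) * indicator ({0<..} \<inter> Z) w \<partial>lborel)"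
      unfolding A_def by (rule level_tonelli) measurable
    also have "\<dots> = (\<integral>\<^sup>+w. H w * indicator ({0<..} \<inter> Z) w \<partial>lborel)"
      by (intro nn_integral_cong) (auto simp: H_eq split: split_indicator)
    finally show ?thesis .
  qed
  have split: "F s = A {..z0} s + A {z0<..} s" if "0 < s" for s
    unfolding F_eq[OF that, symmetric] A_def
    by (subst nn_integral_add[symmetric], measurable) (auto intro!: nn_integral_cong simp: indicator_def)
  have big: "A {..z0} s = ennreal (T (z0 * s) / s)" if "0 < s" "z0 < z s" for s
  proof -
    have "z0 * s < M" using zb[OF that(1)] mult_strict_right_mono[OF that(2,1)] by linarith
    then have "(\<integral>\<^sup>+w. ?W (w * s) * indicator {0<..<z0} w \<partial>lborel) = ennreal (T (z0 * s) / s)"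
      using that z0 by (intro T_slice) auto
    moreover have "A {..z0} s = (\<integral>\<^sup>+w. ?W (w * s) * indicator {0<..<z0} w \<partial>lborel)"
      unfolding A_def
    proof (rule nn_integral_cong_AE)
      have "AE x in lborel. x \<noteq> z0" by (rule AE_lborel_singleton)
      then show "AE w in lborel. ?W (w * s) * indicator {..z0} w * indicator {0<..<z s} w = ?W (w * s) * indicator {0<..<z0} w"
        by eventually_elim (use that in \<open>auto simp: indicator_def\<close>)
    qed
    ultimately show ?thesis by simp
  qed
  have small: "A {z0<..} s = 0" if "z s \<le> z0" for s
  proof -
    have "?W (w * s) * indicator {z0<..} w * indicator {0<..<z s} w = 0" for w
      using that by (auto split: split_indicator)
    then show ?thesis unfolding A_def by (simp only: nn_integral_const) simp
  qed
  have J: "(\<integral>\<^sup>+s. A {..z0} s * indicator {s. 0 < s \<and> z0 < z s} s \<partial>lborel) = J"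
    unfolding J_def using big galois z0 by (intro nn_integral_cong) (auto simp: indicator_def)
  have "(\<integral>\<^sup>+s. F s * indicator {s. 0 < s \<and> z0 < z s} s \<partial>lborel)
    = (\<integral>\<^sup>+s. A {..z0} s * indicator {s. 0 < s \<and> z0 < z s} s + A {z0<..} s * indicator {0<..} s \<partial>lborel)"
    using split small by (intro nn_integral_cong) (auto simp: indicator_def not_less)
  also have "\<dots> = J + (\<integral>\<^sup>+s. A {z0<..} s * indicator {0<..} s \<partial>lborel)"
    by (subst nn_integral_add, measurable) (simp add: J)
  also have "(\<integral>\<^sup>+s. A {z0<..} s * indicator {0<..} s \<partial>lborel) = (\<integral>\<^sup>+w. H w * indicator {z0<..} w \<partial>lborel)"
    using z0 by (subst HZ, simp) (intro nn_integral_cong, auto simp: indicator_def)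
  finally show ?S1 .
  have "(\<integral>\<^sup>+s. F s * indicator {s. 0 < s \<and> z s \<le> z0} s \<partial>lborel) + J
    = (\<integral>\<^sup>+s. A {..z0} s * indicator {s. 0 < s \<and> z s \<le> z0} s \<partial>lborel) + (\<integral>\<^sup>+s. A {..z0} s * indicator {s. 0 < s \<and> z0 < z s} s \<partial>lborel)"
    unfolding J using split small by (intro arg_cong2[where f="(+)"] nn_integral_cong) (auto simp: indicator_def)
  also have "\<dots> = (\<integral>\<^sup>+s. A {..z0} s * indicator {0<..} s \<partial>lborel)"
    by (subst nn_integral_add[symmetric], measurable) (auto intro!: nn_integral_cong simp: indicator_def)
  also have "\<dots> = (\<integral>\<^sup>+w. H w * indicator {0<..z0} w \<partial>lborel)"
    by (subst HZ, simp) (intro nn_integral_cong, auto simp: indicator_def)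
  finally show ?S2 .
qed

text \<open>Without signs the two integrals agree. With the sign change at \<open>z0\<close> the
  rectangle counts positively in the integral over \<open>s\<close> and negatively in the integral
  over \<open>w\<close>, hence the factor 2.\<close>

lemma level_exchange:
  assumes F: "integrable lborel (\<lambda>s. indicator {0<..} s * (T (z s * s) / s))"
  shows "integrable lborel (\<lambda>w. indicator {0<..} w * (T (w * u w) / w))" (is ?S1)
    and "(LBINT s. indicator {0<..} s * (T (z s * s) / s)) = (LBINT w. indicator {0<..} w * (T (w * u w) / w))" (is ?S2)
    and "integrable lborel (\<lambda>s. indicator {0<..<u z0} s * (T (z0 * s) / s))" (is ?S3)
    and "(LBINT s. (if z0 < z s then 1 else - 1) * (indicator {0<..} s * (T (z s * s) / s)))
       - (LBINT w. (if z0 < w then 1 else - 1) * (indicator {0<..} w * (T (w * u w) / w)))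
       = 2 * (LBINT s. indicator {0<..<u z0} s * (T (z0 * s) / s))" (is ?S4)
proof -
  let ?f = "\<lambda>s. indicator {0<..} s * (T (z s * s) / s)" and ?h = "\<lambda>w. indicator {0<..} w * (T (w * u w) / w)" and ?j = "\<lambda>s. indicator {0<..<u z0} s * (T (z0 * s) / s)"
  have ub: "w * u w < M" if "0 < w" for w
    using mult_u_le[of M1, OF M1_bound that] M1 by simp
  have zb: "z s * s < M" if "0 < s" for s
    using M1_bound[OF that] M1 by simp
  define f where "f s = ?f s" for s
  define h where "h w = ?h w" for w
  define j where "j s = ?j s" for s
  have f0: "0 \<le> f s" for s
    using T_nonneg[of "z s * s"] zb[of s] z_nonneg[of s] by (auto simp: f_def indicator_def)
  have h0: "0 \<le> h w" for w
    using T_nonneg[of "w * u w"] ub[of w] u_nonneg[of w] by (auto simp: h_def indicator_def)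
  have j0: "0 \<le> j s" for s
  proof (cases "0 < s \<and> s < u z0")
    case True
    then have "z0 * s < M" using ub[OF z0] mult_strict_left_mono[of s "u z0" z0] z0 by linarith
    then show ?thesis using T_nonneg[of "z0 * s"] True z0 by (auto simp: j_def)
  qed (auto simp: j_def)
  have fm [measurable]: "f \<in> borel_measurable borel" and hm [measurable]: "h \<in> borel_measurable borel"
    and jm [measurable]: "j \<in> borel_measurable borel" unfolding f_def h_def j_def by measurable
  have F': "integrable lborel f" using F unfolding f_def .
  let ?P = "{s. z0 < z s}" and ?N = "{s. z s \<le> z0}"
  have [measurable]: "?P \<in> sets borel" "?N \<in> sets borel" by measurable
  define fP where "fP s = f s * indicator ?P s" for s
  define fN where "fN s = f s * indicator ?N s" for s
  define hP where "hP s = h s * indicator {z0<..} s" for s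
  define hN where "hN s = h s * indicator {..z0} s" for s
  have m [measurable]: "fP \<in> borel_measurable borel" "fN \<in> borel_measurable borel"
    "hP \<in> borel_measurable borel" "hN \<in> borel_measurable borel"
    unfolding fP_def fN_def hP_def hN_def by measurable
  have n0: "0 \<le> fP s" "0 \<le> fN s" "0 \<le> hP s" "0 \<le> hN s" for s
    using f0 h0 by (auto simp: fP_def fN_def hP_def hN_def)
  have iP: "integrable lborel fP" "integrable lborel fN"
    unfolding fP_def fN_def using F' by (auto intro!: integrable_real_mult_indicator simp: mult.commute)
  have e1: "(\<integral>\<^sup>+s. fP s \<partial>lborel) = (\<integral>\<^sup>+s. j s \<partial>lborel) + (\<integral>\<^sup>+s. hP s \<partial>lborel)"
  proof -
    have "(\<integral>\<^sup>+s. fP s \<partial>lborel) = (\<integral>\<^sup>+s. ennreal (T (z s * s) / s) * indicator {s. 0 < s \<and> z0 < z s} s \<partial>lborel)"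
      by (intro nn_integral_cong) (auto simp: fP_def f_def indicator_def)
    also have "\<dots> = (\<integral>\<^sup>+s. ennreal (T (z0 * s) / s) * indicator {0<..<u z0} s \<partial>lborel)
        + (\<integral>\<^sup>+w. ennreal (T (w * u w) / w) * indicator {z0<..} w \<partial>lborel)"
      by (rule level_exchange_nn(1))
    also have "\<dots> = (\<integral>\<^sup>+s. j s \<partial>lborel) + (\<integral>\<^sup>+s. hP s \<partial>lborel)"
      using z0 by (intro arg_cong2[where f="(+)"] nn_integral_cong) (auto simp: j_def hP_def h_def indicator_def)
    finally show ?thesis .
  qed
  have e2: "(\<integral>\<^sup>+s. fN s \<partial>lborel) + (\<integral>\<^sup>+s. j s \<partial>lborel) = (\<integral>\<^sup>+s. hN s \<partial>lborel)"
  proof -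
    have "(\<integral>\<^sup>+s. hN s \<partial>lborel) = (\<integral>\<^sup>+w. ennreal (T (w * u w) / w) * indicator {0<..z0} w \<partial>lborel)"
      by (intro nn_integral_cong) (auto simp: hN_def h_def indicator_def)
    also have "\<dots> = (\<integral>\<^sup>+s. ennreal (T (z s * s) / s) * indicator {s. 0 < s \<and> z s \<le> z0} s \<partial>lborel)
       + (\<integral>\<^sup>+s. ennreal (T (z0 * s) / s) * indicator {0<..<u z0} s \<partial>lborel)"
      by (rule level_exchange_nn(2)[symmetric])
    also have "\<dots> = (\<integral>\<^sup>+s. fN s \<partial>lborel) + (\<integral>\<^sup>+s. j s \<partial>lborel)"
      by (intro arg_cong2[where f="(+)"] nn_integral_cong) (auto simp: j_def fN_def f_def indicator_def)
    finally show ?thesis by simp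
  qed
  \<comment> \<open>Integrability is assumed only in the variable \<open>s\<close>; finiteness
    passes to \<open>J\<close> and to the integrals over \<open>w\<close> through the identities in
    extended reals.\<close>
  have fin: "(\<integral>\<^sup>+s. fP s \<partial>lborel) < \<infinity>" "(\<integral>\<^sup>+s. fN s \<partial>lborel) < \<infinity>"
    using iP n0 by (auto simp: nn_integral_eq_integral)
  have jfin: "(\<integral>\<^sup>+s. j s \<partial>lborel) < \<infinity>" "(\<integral>\<^sup>+s. hP s \<partial>lborel) < \<infinity>"
    using fin(1) unfolding e1 by (auto simp: ennreal_add_less_top)
  have hNfin: "(\<integral>\<^sup>+s. hN s \<partial>lborel) < \<infinity>" unfolding e2[symmetric] using fin jfin by simp
  have ij: "integrable lborel j" using jfin j0 by (intro integrableI_nonneg) auto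
  have ihP: "integrable lborel hP" using jfin n0 by (intro integrableI_nonneg) auto
  have ihN: "integrable lborel hN" using hNfin n0 by (intro integrableI_nonneg) auto
  show ?S3 using ij unfolding j_def .
  have hsplit: "h = (\<lambda>s. hP s + hN s)" by (auto simp: hP_def hN_def indicator_def)
  have fsplit: "f = (\<lambda>s. fP s + fN s)" by (auto simp: fP_def fN_def indicator_def)
  have "integrable lborel h" unfolding hsplit using ihP ihN by (rule Bochner_Integration.integrable_add)
  then show ?S1 unfolding h_def .
  have "ennreal (LBINT s. fP s) = ennreal ((LBINT s. j s) + (LBINT s. hP s))"
    using e1 iP ij ihP n0 j0 by (simp add: nn_integral_eq_integral integral_nonneg_AE)
  then have r1: "(LBINT s. fP s) = (LBINT s. j s) + (LBINT s. hP s)"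
    using n0 j0 by (subst (asm) ennreal_inj) (auto intro!: integral_nonneg_AE add_nonneg_nonneg)
  have "ennreal ((LBINT s. fN s) + (LBINT s. j s)) = ennreal (LBINT s. hN s)"
    using e2 iP ij ihN n0 j0 by (simp add: nn_integral_eq_integral integral_nonneg_AE)
  then have r2: "(LBINT s. fN s) + (LBINT s. j s) = (LBINT s. hN s)"
    using n0 j0 by (subst (asm) ennreal_inj) (auto intro!: integral_nonneg_AE add_nonneg_nonneg)
  have "(LBINT s. f s) = (LBINT s. h s)"
    unfolding hsplit fsplit using r1 r2 ihP ihN iP by simp
  then show ?S2
    unfolding f_def h_def .
  have "(LBINT s. (if z0 < z s then 1 else - 1) * f s) = (LBINT s. fP s - fN s)"
    by (intro Bochner_Integration.integral_cong) (auto simp: fP_def fN_def indicator_def)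
  also have "\<dots> = (LBINT s. fP s) - (LBINT s. fN s)" using iP by simp
  finally have x1: "(LBINT s. (if z0 < z s then 1 else - 1) * f s) = (LBINT s. fP s) - (LBINT s. fN s)" .
  have "(LBINT s. (if z0 < s then 1 else - 1) * h s) = (LBINT s. hP s - hN s)"
    by (intro Bochner_Integration.integral_cong) (auto simp: hP_def hN_def indicator_def)
  also have "\<dots> = (LBINT s. hP s) - (LBINT s. hN s)" using ihP ihN by simp
  finally have x2: "(LBINT s. (if z0 < s then 1 else - 1) * h s) = (LBINT s. hP s) - (LBINT s. hN s)" .
  have "(LBINT s. (if z0 < z s then 1 else - 1) * f s) - (LBINT s. (if z0 < s then 1 else - 1) * h s) = 2 * (LBINT s. j s)"
    unfolding x1 x2 using r1 r2 by simp
  then show ?S4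
    unfolding f_def h_def j_def .
qed

end

text \<open>In the logarithmic variable the extremals solve \<open>(v')\<^sup>2 = (profile_speed M k v)\<^sup>2\<close>, where \<open>M\<close>
  is the maximum of \<open>v\<close> and \<open>k = q - 2\<close>.\<close>

definition profile_speed :: "real \<Rightarrow> real \<Rightarrow> real \<Rightarrow> real" where
  "profile_speed M k y = y / 2 * sqrt (1 - (y / M) powr k)"

lemma profile_speed_meas [measurable]: "profile_speed M k \<in> borel_measurable borel"
  unfolding profile_speed_def by measurable

lemma profile_speed_bounds:
  assumes "0 \<le> y" "y \<le> M"  "0 < k"
  shows "0 \<le> profile_speed M k y" "profile_speed M k y \<le> y / 2"
proof -
  have "y / M \<le> 1" using assms by (cases "M = 0") auto
  then have "(y / M) powr k \<le> 1 powr k" using assms by (intro powr_mono2) auto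
  then have w: "0 \<le> 1 - (y / M) powr k" "1 - (y / M) powr k \<le> 1" by auto
  show "0 \<le> profile_speed M k y" unfolding profile_speed_def using w assms by simp
  have "y / 2 * sqrt (1 - (y / M) powr k) \<le> y / 2 * 1"
    using w assms by (intro mult_left_mono) auto
  then show "profile_speed M k y \<le> y / 2" unfolding profile_speed_def by simp
qed

context level_pair
begin

text \<open>The parts linear in \<open>G\<close> match up to the rectangle at \<open>z0\<close>. The
  square of \<open>G\<close> yields the rest, because \<open>(G y)\<^sup>2 = y\<^sup>2 / 4 - M powr
  (- k) * y powr (k + 2) / 4\<close>. The result is an exact identity; the inequalities enter only
  when it is applied to a function.\<close>

lemma calibration_identity:
  fixes p k M M1 z0 :: real
  defines "G \<equiv> profile_speed M k" and "\<epsilon> \<equiv> (\<lambda>x. if z0 < x then 1 else - 1 :: real)"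
  assumes p: "0 < p" and k: "0 < k" and M: "0 < M" and M1: "M1 < M"
    and bound: "\<And>s. 0 < s \<Longrightarrow> z s * s \<le> M1" and z0: "0 < z0"
    and I2: "integrable lborel (\<lambda>s. indicator {0<..} s * (s * (z s)\<^sup>2))"
  shows "integrable lborel (\<lambda>s. indicator {0<..} s * (p * s * (z s)\<^sup>2 + \<epsilon> (z s) * (z s * G (z s * s))))" (is ?S1)
    and "integrable lborel (\<lambda>w. indicator {0<..} w * (w * (p * u w + \<epsilon> w * G (w * u w) / w)\<^sup>2))" (is ?S2)
    and "integrable lborel (\<lambda>s. indicator {0<..} s * ((z s * s) powr (k + 2) / s))" (is ?S3)
    and "2 * (LBINT s. indicator {0<..} s * (p * s * (z s)\<^sup>2 + \<epsilon> (z s) * (z s * G (z s * s))))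
      - (LBINT w. indicator {0<..} w * (w * (p * u w + \<epsilon> w * G (w * u w) / w)\<^sup>2)) / p
      = (p - 1 / (4 * p)) * (LBINT s. indicator {0<..} s * (s * (z s)\<^sup>2))
        + M powr (- k) / (4 * p) * (LBINT s. indicator {0<..} s * ((z s * s) powr (k + 2) / s))
        + 4 * (LBINT s. indicator {0<..<u z0} s * (z0 * G (z0 * s)))" (is ?S4)
proof -
  let ?b = "\<lambda>s. p * s * (z s)\<^sup>2 + \<epsilon> (z s) * (z s * G (z s * s))" and ?c = "\<lambda>w. p * u w + \<epsilon> w * G (w * u w) / w"
  define R where "R y = sqrt (1 - (y / M) powr k)" for y
  have R_lt: "(y / M) powr k < 1" if "0 \<le> y" "y < M" for y
    using powr_less_mono2[of k "y / M" 1] that k M by simp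
  have R0: "0 < R y" "R y \<le> 1" if "0 \<le> y" "y < M" for y
    using R_lt[OF that] by (auto simp: R_def)
  \<comment> \<open>\<open>y * G y\<close> is not monotone; it is the difference of \<open>T1\<close> and \<open>T2\<close>, which are.\<close>
  define T1 where "T1 y = y\<^sup>2 / 2" for y :: real
  define T2 where "T2 y = y\<^sup>2 / 2 * (1 - R y)" for y
  \<comment> \<open>The derivative of \<open>T2\<close>. It is nonnegative, unlike that of
    \<open>y * G y\<close>, and its denominator \<open>R y\<close> vanishes at \<open>y = M\<close>;
    this is why all arguments must stay strictly below \<open>M\<close>.\<close>
  define W2 where "W2 y = y * (1 - R y) + k / 4 * y * (y / M) powr k / R y" for y
  define T3 where "T3 y = y powr (k + 2)" for y
  have Rm [measurable]: "R \<in> borel_measurable borel" unfolding R_def by measurable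
  have Tm [measurable]: "T1 \<in> borel_measurable borel" "T2 \<in> borel_measurable borel" "T3 \<in> borel_measurable borel"
    unfolding T1_def T2_def T3_def by measurable
  have TG: "T1 y - T2 y = y * G y" for y by (simp add: T1_def T2_def G_def profile_speed_def R_def power2_eq_square algebra_simps)
  have P1: "level_potential z u T1 (\<lambda>y. y) M M1 z0"
  proof unfold_locales
    show "continuous_on {0..<M} T1" unfolding T1_def by (intro continuous_intros) auto
    show "(T1 has_real_derivative y) (at y)" for y
      unfolding T1_def by (auto intro!: derivative_eq_intros)
    show "T1 \<in> borel_measurable borel" unfolding T1_def by measurable
  qed (use M1 bound z0 in \<open>auto simp: T1_def\<close>)
  have R_deriv: "(R has_real_derivative (- (k * (y / M) powr k / y) / (2 * R y))) (at y)" if "0 < y" "y < M" for y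
  proof -
    have "((\<lambda>y. (y / M) powr k) has_real_derivative (k * (y / M) powr (k - 1) * (1 / M))) (at y)"
      using that M by (auto intro!: derivative_eq_intros simp: powr_diff)
    moreover have "k * (y / M) powr (k - 1) * (1 / M) = k * (y / M) powr k / y"
      using that M by (simp add: powr_diff field_simps)
    ultimately have "((\<lambda>y. 1 - (y / M) powr k) has_real_derivative (- (k * (y / M) powr k / y))) (at y)"
      using DERIV_diff[OF DERIV_const[of 1]] by force
    moreover have "1 - (y / M) powr k > 0" using R_lt[of y] that by simp
    ultimately have "((\<lambda>y. sqrt (1 - (y / M) powr k)) has_real_derivative
        inverse (sqrt (1 - (y / M) powr k)) / 2 * (- (k * (y / M) powr k / y))) (at y)"
      by (intro DERIV_chain2[OF DERIV_real_sqrt])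
    then show ?thesis unfolding R_def[abs_def] by (simp add: field_simps)
  qed
  have P2: "level_potential z u T2 W2 M M1 z0"
  proof unfold_locales
    show "T2 0 = 0" by (simp add: T2_def)
    show "continuous_on {0..<M} T2"
      unfolding T2_def R_def using M k by (auto intro!: continuous_intros continuous_on_powr')
    show "(T2 has_real_derivative W2 y) (at y)" if "0 < y" "y < M" for y
    proof -
      have "(T2 has_real_derivative (y * (1 - R y) + y\<^sup>2 / 2 * (k * (y / M) powr k / y / (2 * R y)))) (at y)"
        unfolding T2_def using R_deriv[OF that] by (auto intro!: derivative_eq_intros)
      moreover have "y\<^sup>2 / 2 * (k * (y / M) powr k / y / (2 * R y)) = k / 4 * y * (y / M) powr k / R y"
        using that by (simp add: power2_eq_square)
      ultimately show ?thesis by (simp add: W2_def)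
    qed
    show "0 \<le> W2 y" if "0 \<le> y" "y < M" for y
      unfolding W2_def using R0[OF that] that k by simp
    show "W2 \<in> borel_measurable borel" "T2 \<in> borel_measurable borel"
      unfolding W2_def T2_def by measurable
  qed (use M1 bound z0 in auto)
  have P3: "level_potential z u T3 (\<lambda>y. (k + 2) * y powr (k + 1)) M M1 z0"
  proof unfold_locales
    show "continuous_on {0..<M} T3"
      unfolding T3_def using k by (auto intro!: continuous_intros continuous_on_powr')
    show "(T3 has_real_derivative (k + 2) * y powr (k + 1)) (at y)" if "0 < y" "y < M" for y
      unfolding T3_def using has_real_derivative_powr[OF that(1), of "k + 2"] by (simp add: add.commute)
    show "T3 \<in> borel_measurable borel" unfolding T3_def by measurable
  qed (use M1 bound z0 k in \<open>auto simp: T3_def\<close>)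
  have zb: "0 \<le> z s * s" "z s * s < M" if "0 < s" for s
    using bound[OF that] M1 z_nonneg[of s] that by auto
  have ub: "0 \<le> w * u w" "w * u w < M" if "0 < w" for w
    using mult_u_le[of M1, OF bound that] M1 u_nonneg[of w] that by auto
  define f1 where "f1 s = indicator {0<..} s * (T1 (z s * s) / s)" for s
  define f2 where "f2 s = indicator {0<..} s * (T2 (z s * s) / s)" for s
  define f3 where "f3 s = indicator {0<..} s * (T3 (z s * s) / s)" for s
  define h1 where "h1 s = indicator {0<..} s * (T1 (s * u s) / s)" for s
  define h2 where "h2 s = indicator {0<..} s * (T2 (s * u s) / s)" for s
  define h3 where "h3 s = indicator {0<..} s * (T3 (s * u s) / s)" for s
  have m [measurable]: "f1 \<in> borel_measurable borel" "f2 \<in> borel_measurable borel" "f3 \<in> borel_measurable borel"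
     "h1 \<in> borel_measurable borel" "h2 \<in> borel_measurable borel" "h3 \<in> borel_measurable borel"
    unfolding f1_def f2_def f3_def h1_def h2_def h3_def by measurable
  have f1_eq: "indicator {0<..} s * (s * (z s)\<^sup>2) = 2 * f1 s" for s
    by (simp add: f1_def T1_def power2_eq_square indicator_def)
  have if1: "integrable lborel f1" using I2 unfolding f1_eq by simp
  have I2_eq: "(LBINT s. indicator {0<..} s * (s * (z s)\<^sup>2)) = 2 * (LBINT s. f1 s)"
    unfolding f1_eq by simp
  \<comment> \<open>Everything is dominated by \<open>T1\<close>: \<open>T2 \<le> T1\<close> as
    \<open>R\<close> lies between 0 and 1, and \<open>T3\<close> is at most
    \<open>2 * M powr k\<close> times \<open>T1\<close> on the range in question.\<close>
  have if2: "integrable lborel f2"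
  proof (rule Bochner_Integration.integrable_bound[OF if1])
    show "AE s in lborel. norm (f2 s) \<le> norm (f1 s)"
    proof (rule AE_I2)
      fix s :: real
      show "norm (f2 s) \<le> norm (f1 s)"
      proof (cases "0 < s")
        case True
        have "(z s * s)\<^sup>2 / 2 * (1 - R (z s * s)) \<le> (z s * s)\<^sup>2 / 2 * 1"
          using R0[OF zb[OF True]] by (intro mult_left_mono) auto
        then show ?thesis using True R0[OF zb[OF True]]
          by (simp add: f1_def f2_def T1_def T2_def abs_mult divide_right_mono)
      qed (simp add: f1_def f2_def)
    qed
  qed measurable
  have if3: "integrable lborel f3"
  proof (rule Bochner_Integration.integrable_bound[OF integrable_mult_right[OF if1, of "2 * M powr k"]])
    show "AE s in lborel. norm (f3 s) \<le> norm (2 * M powr k * f1 s)"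
    proof (rule AE_I2)
      fix s :: real
      show "norm (f3 s) \<le> norm (2 * M powr k * f1 s)"
      proof (cases "0 < s")
        case True
        have "(z s * s) powr (k + 2) = (z s * s) powr k * (z s * s)\<^sup>2"
          using zb[OF True] by (cases "z s * s = 0") (auto simp: powr_add powr_numeral)
        also have "\<dots> \<le> M powr k * (z s * s)\<^sup>2"
          using zb[OF True] k by (intro mult_right_mono powr_mono2) auto
        finally show ?thesis using True by (simp add: f1_def f3_def T1_def T3_def divide_right_mono abs_mult)
      qed (simp add: f1_def f3_def)
    qed
  qed measurable
  have f3_eq: "f3 = (\<lambda>s. indicator {0<..} s * ((z s * s) powr (k + 2) / s))" by (auto simp: f3_def T3_def)
  show ?S3 using if3 unfolding f3_eq .
  have \<epsilon>m [measurable]: "\<epsilon> \<in> borel_measurable borel" unfolding \<epsilon>_def by measurable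
  have sg: "integrable lborel (\<lambda>s. \<epsilon> (z s) * f s)" "integrable lborel (\<lambda>s. \<epsilon> s * f s)" if "integrable lborel f" for f
  proof -
    have [measurable]: "f \<in> borel_measurable borel" using borel_measurable_integrable[OF that] by simp
    have abs_eps: "\<bar>\<epsilon> x\<bar> = 1" for x by (simp add: \<epsilon>_def)
    show "integrable lborel (\<lambda>s. \<epsilon> (z s) * f s)"
      by (rule Bochner_Integration.integrable_bound[OF that]) (measurable, simp add: abs_mult abs_eps)
    show "integrable lborel (\<lambda>s. \<epsilon> s * f s)"
      by (rule Bochner_Integration.integrable_bound[OF that]) (measurable, simp add: abs_mult abs_eps)
  qed
  note ih1 = level_potential.level_exchange(1)[OF P1 if1[unfolded f1_def], folded h1_def]
  note ih2 = level_potential.level_exchange(1)[OF P2 if2[unfolded f2_def], folded h2_def]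
  note ih3 = level_potential.level_exchange(1)[OF P3 if3[unfolded f3_def], folded h3_def]
  note eq1 = level_potential.level_exchange(2)[OF P1 if1[unfolded f1_def], folded h1_def f1_def]
  note eq3 = level_potential.level_exchange(2)[OF P3 if3[unfolded f3_def], folded h3_def f3_def]
  note ij1 = level_potential.level_exchange(3)[OF P1 if1[unfolded f1_def]]
  note ij2 = level_potential.level_exchange(3)[OF P2 if2[unfolded f2_def]]
  note b1 = level_potential.level_exchange(4)[OF P1 if1[unfolded f1_def], folded h1_def f1_def]
  note b2 = level_potential.level_exchange(4)[OF P2 if2[unfolded f2_def], folded h2_def f2_def]
  have b1: "(LBINT s. \<epsilon> (z s) * f1 s) - (LBINT s. \<epsilon> s * h1 s) = 2 * (LBINT s. indicator {0<..<u z0} s * (T1 (z0 * s) / s))"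
    using b1 unfolding \<epsilon>_def .
  have b2: "(LBINT s. \<epsilon> (z s) * f2 s) - (LBINT s. \<epsilon> s * h2 s) = 2 * (LBINT s. indicator {0<..<u z0} s * (T2 (z0 * s) / s))"
    using b2 unfolding \<epsilon>_def .
  have J: "(LBINT s. indicator {0<..<u z0} s * (z0 * G (z0 * s)))
     = (LBINT s. indicator {0<..<u z0} s * (T1 (z0 * s) / s)) - (LBINT s. indicator {0<..<u z0} s * (T2 (z0 * s) / s))"
  proof -
    have "(LBINT s. indicator {0<..<u z0} s * (z0 * G (z0 * s)))
      = (LBINT s. indicator {0<..<u z0} s * (T1 (z0 * s) / s) - indicator {0<..<u z0} s * (T2 (z0 * s) / s))"
    proof (rule Bochner_Integration.integral_cong[OF refl])
      fix s :: real
      show "indicator {0<..<u z0} s * (z0 * G (z0 * s)) = indicator {0<..<u z0} s * (T1 (z0 * s) / s) - indicator {0<..<u z0} s * (T2 (z0 * s) / s)"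
        using TG[of "z0 * s"] by (cases "0 < s") (auto simp: right_diff_distrib[symmetric] diff_divide_distrib[symmetric])
    qed
    also have "\<dots> = (LBINT s. indicator {0<..<u z0} s * (T1 (z0 * s) / s)) - (LBINT s. indicator {0<..<u z0} s * (T2 (z0 * s) / s))"
      by (rule Bochner_Integration.integral_diff[OF ij1 ij2])
    finally show ?thesis .
  qed
  have A_pt: "(\<lambda>s. indicator {0<..} s * ?b s)
    = (\<lambda>s. 2 * p * f1 s + (\<epsilon> (z s) * f1 s - \<epsilon> (z s) * f2 s))"
  proof
    fix s
    show "indicator {0<..} s * ?b s = 2 * p * f1 s + (\<epsilon> (z s) * f1 s - \<epsilon> (z s) * f2 s)"
    proof (cases "0 < s")
      case True
      have "f1 s - f2 s = z s * G (z s * s)"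
        using True TG[of "z s * s"] by (simp add: f1_def f2_def diff_divide_distrib[symmetric])
      moreover have "2 * f1 s = s * (z s)\<^sup>2" using f1_eq[of s] True by simp
      ultimately show ?thesis using True by (simp add: right_diff_distrib[symmetric] mult.assoc)
    qed (simp add: f1_def f2_def)
  qed
  have B_pt: "(\<lambda>w. indicator {0<..} w * (w * (?c w)\<^sup>2))
    = (\<lambda>w. (2 * p\<^sup>2 + 1 / 2) * h1 w + (2 * p * (\<epsilon> w * h1 w - \<epsilon> w * h2 w) - M powr (- k) / 4 * h3 w))"
  proof
    fix w
    show "indicator {0<..} w * (w * (?c w)\<^sup>2)
      = (2 * p\<^sup>2 + 1 / 2) * h1 w + (2 * p * (\<epsilon> w * h1 w - \<epsilon> w * h2 w) - M powr (- k) / 4 * h3 w)"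
    proof (cases "0 < w")
      case True
      let ?y = "w * u w"
      have d: "h1 w - h2 w = u w * G ?y"
        using True TG[of ?y] by (simp add: h1_def h2_def diff_divide_distrib[symmetric])
      have h1': "h1 w = w * (u w)\<^sup>2 / 2" using True by (simp add: h1_def T1_def power2_eq_square)
      have "(?y / M) powr k = M powr (- k) * ?y powr k"
        using True M u_nonneg[of w] by (simp add: powr_divide powr_minus field_simps)
      moreover have "(G ?y)\<^sup>2 = (?y / 2)\<^sup>2 * (1 - (?y / M) powr k)"
        unfolding G_def profile_speed_def power_mult_distrib using R_lt[OF ub[OF True]] by simp
      ultimately have G2: "(G ?y)\<^sup>2 = ?y\<^sup>2 / 4 - M powr (- k) / 4 * (?y\<^sup>2 * ?y powr k)"
        by (simp add: power_divide right_diff_distrib mult_ac)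
      have "?y\<^sup>2 * ?y powr k = ?y powr (k + 2)"
        using ub[OF True] by (cases "?y = 0") (auto simp: powr_add powr_numeral)
      then have G2': "(G ?y)\<^sup>2 / w = h1 w / 2 - M powr (- k) / 4 * h3 w"
        using True unfolding G2 by (simp add: h1_def T1_def h3_def T3_def diff_divide_distrib)
      have e2: "(\<epsilon> w)\<^sup>2 = 1" by (simp add: \<epsilon>_def)
      have "w * (p * u w + \<epsilon> w * G ?y / w)\<^sup>2 = p\<^sup>2 * (w * (u w)\<^sup>2) + 2 * p * \<epsilon> w * (u w * G ?y) + (\<epsilon> w)\<^sup>2 * (G ?y)\<^sup>2 / w"
        using True by (simp add: power2_eq_square field_simps)
      also have "\<dots> = p\<^sup>2 * (2 * h1 w) + 2 * p * \<epsilon> w * (h1 w - h2 w) + (h1 w / 2 - M powr (- k) / 4 * h3 w)"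
        unfolding e2 d G2'[symmetric] using h1' by simp
      finally show ?thesis using True by (simp add: algebra_simps)
    qed (simp add: h1_def h2_def h3_def)
  qed
  show ?S1
    unfolding A_pt using if1 sg(1)[OF if1] sg(1)[OF if2] by simp
  show ?S2
    unfolding B_pt using ih1 ih3 sg(2)[OF ih1] sg(2)[OF ih2] by simp
  have A: "(LBINT s. indicator {0<..} s * ?b s)
     = 2 * p * (LBINT s. f1 s) + ((LBINT s. \<epsilon> (z s) * f1 s) - (LBINT s. \<epsilon> (z s) * f2 s))"
    unfolding A_pt using if1 sg(1)[OF if1] sg(1)[OF if2] by simp
  have B: "(LBINT w. indicator {0<..} w * (w * (?c w)\<^sup>2))
     = (2 * p\<^sup>2 + 1 / 2) * (LBINT s. h1 s) + (2 * p * ((LBINT s. \<epsilon> s * h1 s) - (LBINT s. \<epsilon> s * h2 s)) - M powr (- k) / 4 * (LBINT s. h3 s))"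
    unfolding B_pt using ih1 ih3 sg(2)[OF ih1] sg(2)[OF ih2] by simp
  \<comment> \<open>Here \<open>x1\<close>, \<open>x3\<close> are the unsigned integrals for
    \<open>T1\<close>, \<open>T3\<close>; \<open>a1\<close>, \<open>a2\<close> and
    \<open>c1\<close>, \<open>c2\<close> are the signed ones over \<open>s\<close> and over
    \<open>w\<close>; \<open>j1\<close>, \<open>j2\<close> are the rectangles for \<open>T1\<close>,
    \<open>T2\<close>; and \<open>m\<close> stands for \<open>M powr (- k)\<close>.\<close>
  have alg: "2 * (2 * p * x1 + (a1 - a2)) - ((2 * p\<^sup>2 + 1 / 2) * x1 + (2 * p * (c1 - c2) - m / 4 * x3)) / p
    = (p - 1 / (4 * p)) * (2 * x1) + m / (4 * p) * x3 + 4 * (j1 - j2)"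
    if "a1 - c1 = 2 * j1" "a2 - c2 = 2 * j2" for x1 a1 a2 c1 c2 m x3 j1 j2 :: real
  proof -
    have "a1 = c1 + 2 * j1" "a2 = c2 + 2 * j2" using that by auto
    then show ?thesis using p by (simp add: field_simps power2_eq_square)
  qed
  show ?S4
    unfolding A B I2_eq J f3_eq[symmetric] eq1[symmetric] eq3[symmetric] by (rule alg[OF b1 b2])
qed

end

section \<open>Rearrangement\<close>

lemma nn_integral_powr_from_0:
  fixes a c :: real
  assumes "a > -1" "c \<ge> 0"
  shows "(\<integral>\<^sup>+x. ennreal (x powr a) * indicator {0<..<c} x \<partial>lborel) = ennreal (c powr (a + 1) / (a + 1))"
proof -
  have "(\<integral>\<^sup>+x. ennreal (x powr a) * indicator {0..c} x \<partial>lborel) = ennreal (c powr (a + 1) / (a + 1))"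
    by (rule nn_integral_has_integral_lebesgue'[OF _ has_integral_powr_from_0[OF assms]]) auto
  moreover have "(\<integral>\<^sup>+x. ennreal (x powr a) * indicator {0<..<c} x \<partial>lborel)
      = (\<integral>\<^sup>+x. ennreal (x powr a) * indicator {0..c} x \<partial>lborel)"
  proof (rule nn_integral_cong_AE)
    have "AE x in lborel. x \<noteq> 0" "AE x in lborel. x \<noteq> c" by (rule AE_lborel_singleton)+
    then show "AE x in lborel. ennreal (x powr a) * indicator {0<..<c} x = ennreal (x powr a) * indicator {0..c} x"
      by eventually_elim (auto simp: indicator_def)
  qed
  ultimately show ?thesis by simp
qed

lemma nn_integral_powr_to_inf:
  fixes a e :: real
  assumes "e < -1" "a > 0"
  shows "(\<integral>\<^sup>+x. ennreal (x powr e) * indicator {a..} x \<partial>lborel) = ennreal (- (a powr (e + 1)) / (e + 1))"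
  by (rule nn_integral_has_integral_lebesgue'[OF _ has_integral_powr_to_inf[OF assms]]) auto

lemma nn_integral_layer_cake_powr:
  fixes g :: "'a::euclidean_space \<Rightarrow> real" and w :: "'a \<Rightarrow> ennreal"
  assumes [measurable]: "g \<in> borel_measurable borel" "w \<in> borel_measurable borel"
    and g: "\<And>x. 0 \<le> g x" and m: "m > 0"
  shows "(\<integral>\<^sup>+x. w x * ennreal (g x powr m) \<partial>lborel)
    = (\<integral>\<^sup>+s. ennreal (m * s powr (m - 1)) * indicator {0<..} s * (\<integral>\<^sup>+x. w x * indicator {x. s < g x} x \<partial>lborel) \<partial>lborel)"
proof -
  let ?F = "\<lambda>x s. w x * ennreal (m * s powr (m - 1)) * of_bool (0 < s \<and> s < g x)"
  have Fm: "(\<lambda>(x, s). ?F x s) \<in> borel_measurable (lborel \<Otimes>\<^sub>M lborel)" by measurable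
  have "w x * ennreal (g x powr m) = (\<integral>\<^sup>+s. ?F x s \<partial>lborel)" for x
  proof -
    have "(\<integral>\<^sup>+s. ?F x s \<partial>lborel) = (\<integral>\<^sup>+s. (w x * ennreal m) * (ennreal (s powr (m - 1)) * indicator {0<..<g x} s) \<partial>lborel)"
      using m by (intro nn_integral_cong) (auto simp: indicator_def ennreal_mult mult_ac)
    also have "\<dots> = (w x * ennreal m) * ennreal (g x powr m / m)"
      using nn_integral_powr_from_0[of "m - 1" "g x"] m g[of x] by (subst nn_integral_cmult) auto
    also have "\<dots> = w x * ennreal (g x powr m)"
      using m by (simp add: mult.assoc ennreal_mult[symmetric])
    finally show ?thesis by simp
  qed
  then have "(\<integral>\<^sup>+x. w x * ennreal (g x powr m) \<partial>lborel) = (\<integral>\<^sup>+x. (\<integral>\<^sup>+s. ?F x s \<partial>lborel) \<partial>lborel)"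
    by (intro nn_integral_cong) simp
  also have "\<dots> = (\<integral>\<^sup>+s. (\<integral>\<^sup>+x. ?F x s \<partial>lborel) \<partial>lborel)"
    using lborel_pair.Fubini'[OF Fm] by simp
  also have "\<dots> = (\<integral>\<^sup>+s. ennreal (m * s powr (m - 1)) * indicator {0<..} s * (\<integral>\<^sup>+x. w x * indicator {x. s < g x} x \<partial>lborel) \<partial>lborel)"
    by (intro nn_integral_cong, subst nn_integral_cmult[symmetric], measurable)
       (auto intro!: nn_integral_cong simp: indicator_def mult_ac)
  finally show ?thesis .
qed

text \<open>Among sets of given volume the centred ball maximizes the integral of a radially
  decreasing weight. The weight is written as a superposition of indicators of balls of radius
  \<open>\<rho>\<close>, and the volume of such a ball intersected with \<open>A\<close> is at most
  the smaller of the two volumes.\<close>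

lemma nn_integral_norm_powr_le:
  fixes A :: "'a::euclidean_space set" and \<beta> r :: real
  assumes A [measurable]: "A \<in> sets borel" and Ar: "emeasure lborel A = ennreal (unit_ball_vol DIM('a) * r ^ DIM('a))"
    and r: "0 \<le> r" and \<beta>: "0 \<le> \<beta>" "\<beta> < DIM('a)"
  shows "(\<integral>\<^sup>+x. ennreal (norm x powr (- \<beta>)) * indicator A x \<partial>lborel)
    \<le> ennreal (DIM('a) * unit_ball_vol DIM('a) / (DIM('a) - \<beta>) * r powr (DIM('a) - \<beta>))"
proof (cases "\<beta> = 0 \<or> r = 0")
  case True
  then show ?thesis
  proof
    assume [simp]: "\<beta> = 0"
    have "(\<integral>\<^sup>+x. ennreal (norm x powr (- \<beta>)) * indicator A x \<partial>lborel) \<le> (\<integral>\<^sup>+x. indicator A x \<partial>lborel)"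
      by (intro nn_integral_mono) (auto simp: indicator_def)
    also have "\<dots> = ennreal (unit_ball_vol DIM('a) * r ^ DIM('a))" using Ar by simp
    also have "r ^ DIM('a) = r powr DIM('a)" using r by (simp add: powr_realpow')
    finally show ?thesis by simp
  next
    assume "r = 0"
    then have "A \<in> null_sets lborel" using Ar A by (auto simp: power_0_left)
    then have "AE x in lborel. x \<notin> A" by (rule AE_not_in)
    then have "(\<integral>\<^sup>+x. ennreal (norm x powr (- \<beta>)) * indicator A x \<partial>lborel) = (\<integral>\<^sup>+x. 0 \<partial>(lborel::'a measure))"
      by (intro nn_integral_cong_AE) (auto elim!: eventually_mono)
    then show ?thesis by simp
  qed
next
  case False
  let ?n = "real DIM('a)" and ?w = "unit_ball_vol (real DIM('a))"
  \<comment> \<open>\<open>?S\<close> bounds the intersection by the ball of radius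
    \<open>\<rho>\<close>, for \<open>\<rho> < r\<close>; \<open>?T\<close> bounds it by
    \<open>A\<close>, for \<open>\<rho> \<ge> r\<close>.\<close>
  let ?S = "\<lambda>\<rho>. ennreal (?w * \<beta>) * (ennreal (\<rho> powr (?n - \<beta> - 1)) * indicator {0<..<r} \<rho>)" and ?T = "\<lambda>\<rho>. ennreal (?w * \<beta> * r ^ DIM('a)) * (ennreal (\<rho> powr (- \<beta> - 1)) * indicator {r..} \<rho>)"
  have \<beta>0: "0 < \<beta>" and r0: "0 < r" using False \<beta> r by auto
  let ?F = "\<lambda>x \<rho>. ennreal (\<beta> * \<rho> powr (- \<beta> - 1)) * of_bool (norm x < \<rho>) * indicator A x"
  have Fm: "(\<lambda>(x, \<rho>). ?F x \<rho>) \<in> borel_measurable (lborel \<Otimes>\<^sub>M lborel)" by measurable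
  have pt: "ennreal (norm x powr (- \<beta>)) * indicator A x = (\<integral>\<^sup>+\<rho>. ?F x \<rho> \<partial>lborel)" if "x \<noteq> 0" for x :: 'a
  proof -
    have "(\<integral>\<^sup>+\<rho>. ?F x \<rho> \<partial>lborel) = (\<integral>\<^sup>+\<rho>. (indicator A x * ennreal \<beta>) * (ennreal (\<rho> powr (- \<beta> - 1)) * indicator {norm x..} \<rho>) \<partial>lborel)"
    proof (rule nn_integral_cong_AE)
      have "AE \<rho> in lborel. \<rho> \<noteq> norm x" by (rule AE_lborel_singleton)
      then show "AE \<rho> in lborel. ?F x \<rho> = (indicator A x * ennreal \<beta>) * (ennreal (\<rho> powr (- \<beta> - 1)) * indicator {norm x..} \<rho>)"
        by eventually_elim (use \<beta>0 in \<open>auto simp: indicator_def ennreal_mult mult_ac\<close>)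
    qed
    also have "\<dots> = indicator A x * ennreal \<beta> * ennreal (norm x powr (- \<beta>) / \<beta>)"
      using nn_integral_powr_to_inf[of "- \<beta> - 1" "norm x"] that \<beta>0 by (subst nn_integral_cmult) auto
    also have "\<dots> = ennreal (norm x powr (- \<beta>)) * indicator A x"
      using \<beta>0 by (cases "x \<in> A") (auto simp: ennreal_mult[symmetric])
    finally show ?thesis by simp
  qed
  have "(\<integral>\<^sup>+x. ennreal (norm x powr (- \<beta>)) * indicator A x \<partial>lborel) = (\<integral>\<^sup>+x. (\<integral>\<^sup>+\<rho>. ?F x \<rho> \<partial>lborel) \<partial>lborel)"
    using AE_lborel_singleton[of "0::'a"] by (intro nn_integral_cong_AE) (auto elim!: eventually_mono simp: pt)
  also have "\<dots> = (\<integral>\<^sup>+\<rho>. (\<integral>\<^sup>+x. ?F x \<rho> \<partial>lborel) \<partial>lborel)"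
    using lborel_pair.Fubini'[OF Fm] by simp
  also have "\<dots> \<le> (\<integral>\<^sup>+\<rho>. ?S \<rho>
      + ?T \<rho> \<partial>lborel)"
  proof (rule nn_integral_mono)
    fix \<rho> :: real
    have "(\<integral>\<^sup>+x. ?F x \<rho> \<partial>lborel) = (\<integral>\<^sup>+x. ennreal (\<beta> * \<rho> powr (- \<beta> - 1)) * indicator (ball 0 \<rho> \<inter> A) x \<partial>lborel)"
      by (intro nn_integral_cong) (auto simp: indicator_def)
    also have "\<dots> = ennreal (\<beta> * \<rho> powr (- \<beta> - 1)) * emeasure lborel (ball 0 \<rho> \<inter> A)"
      by (intro nn_integral_cmult_indicator) auto
    finally have F: "(\<integral>\<^sup>+x. ?F x \<rho> \<partial>lborel) = ennreal (\<beta> * \<rho> powr (- \<beta> - 1)) * emeasure lborel (ball 0 \<rho> \<inter> A)" .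
    consider "\<rho> \<le> 0" | "0 < \<rho>" "\<rho> < r" | "r \<le> \<rho>" by linarith
    then show "(\<integral>\<^sup>+x. ?F x \<rho> \<partial>lborel) \<le> ?S \<rho>
      + ?T \<rho>"
    proof cases
      case 1
      then show ?thesis unfolding F by (simp add: ball_empty)
    next
      case 2
      have "emeasure lborel (ball 0 \<rho> \<inter> A) \<le> ennreal (?w * \<rho> ^ DIM('a))"
        using 2 emeasure_ball[of \<rho> "0::'a"] emeasure_mono[of "ball 0 \<rho> \<inter> A" "ball 0 \<rho>" lborel] by simp
      then have "(\<integral>\<^sup>+x. ?F x \<rho> \<partial>lborel) \<le> ennreal (\<beta> * \<rho> powr (- \<beta> - 1)) * ennreal (?w * \<rho> ^ DIM('a))"
        unfolding F by (intro mult_left_mono) auto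
      also have "\<dots> = ennreal (?w * \<beta>) * ennreal (\<rho> powr (?n - \<beta> - 1))"
      proof -
        have "\<rho> powr (?n - \<beta> - 1) = \<rho> powr (- \<beta> - 1) * \<rho> ^ DIM('a)"
          using 2 by (simp add: powr_realpow[symmetric] powr_add[symmetric] algebra_simps)
        then show ?thesis using 2 \<beta>0 by (simp add: ennreal_mult[symmetric] mult_ac)
      qed
      finally show ?thesis using 2 by simp
    next
      case 3
      have "emeasure lborel (ball 0 \<rho> \<inter> A) \<le> ennreal (?w * r ^ DIM('a))"
        unfolding Ar[symmetric] by (intro emeasure_mono) auto
      then have "(\<integral>\<^sup>+x. ?F x \<rho> \<partial>lborel) \<le> ennreal (\<beta> * \<rho> powr (- \<beta> - 1)) * ennreal (?w * r ^ DIM('a))"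
        unfolding F by (intro mult_left_mono) auto
      also have "\<dots> = ennreal (?w * \<beta> * r ^ DIM('a)) * ennreal (\<rho> powr (- \<beta> - 1))"
        using r0 \<beta>0 by (simp add: ennreal_mult[symmetric] mult_ac)
      finally show ?thesis using 3 r0 by simp
    qed
  qed
  also have "\<dots> = ennreal (?w * \<beta>) * ennreal (r powr (?n - \<beta>) / (?n - \<beta>)) + ennreal (?w * \<beta> * r ^ DIM('a)) * ennreal (r powr (- \<beta>) / \<beta>)"
  proof -
    have 1: "(\<integral>\<^sup>+\<rho>. ?S \<rho> \<partial>lborel)
      = ennreal (?w * \<beta>) * ennreal (r powr (?n - \<beta>) / (?n - \<beta>))"
      using nn_integral_powr_from_0[of "?n - \<beta> - 1" r] \<beta> r0 by (subst nn_integral_cmult) auto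
    have 2: "(\<integral>\<^sup>+\<rho>. ?T \<rho> \<partial>lborel)
      = ennreal (?w * \<beta> * r ^ DIM('a)) * ennreal (r powr (- \<beta>) / \<beta>)"
      using nn_integral_powr_to_inf[of "- \<beta> - 1" r] \<beta>0 r0 by (subst nn_integral_cmult) auto
    show ?thesis unfolding 1[symmetric] 2[symmetric] by (rule nn_integral_add) measurable
  qed
  also have "\<dots> = ennreal (?w * \<beta> * (r powr (?n - \<beta>) / (?n - \<beta>)) + ?w * \<beta> * r ^ DIM('a) * (r powr (- \<beta>) / \<beta>))"
  proof -
    have "ennreal a * ennreal b + ennreal c * ennreal d = ennreal (a * b + c * d)"
      if "0 \<le> a" "0 \<le> b" "0 \<le> c" "0 \<le> d" for a b c d
      using that by (simp add: ennreal_mult)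
    then show ?thesis using r0 \<beta> \<beta>0 by (auto simp del: ennreal_plus)
  qed
  also have "?w * \<beta> * (r powr (?n - \<beta>) / (?n - \<beta>)) + ?w * \<beta> * r ^ DIM('a) * (r powr (- \<beta>) / \<beta>)
      = ?n * ?w / (?n - \<beta>) * r powr (?n - \<beta>)"
  proof -
    have "r ^ DIM('a) * r powr (- \<beta>) = r powr (?n - \<beta>)"
      using r0 by (simp add: powr_realpow[symmetric] powr_add[symmetric])
    then have "?w * \<beta> * r ^ DIM('a) * (r powr (- \<beta>) / \<beta>) = ?w * r powr (?n - \<beta>)"
      using \<beta>0 by (simp add: mult_ac)
    then show ?thesis using \<beta> by (simp add: field_simps)
  qed
  finally show ?thesis .
qed

text \<open>The rearrangement inequality for both lower order terms: the layer cake formula reduces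
  it to superlevel sets, each compared with the ball of the same volume. It serves for the Hardy
  term with \<open>\<beta> = m = 2\<close> and for the weighted \<open>L^q\<close> term.\<close>

lemma weighted_integral_le_profile:
  fixes g :: "'a::euclidean_space \<Rightarrow> real" and \<beta> m :: real
  assumes gm [measurable]: "g \<in> borel_measurable borel" and g: "\<And>x. 0 \<le> g x" and m: "m > 0"
    and \<beta>: "0 \<le> \<beta>" "\<beta> < DIM('a)"
    and r: "\<And>s. 0 < s \<Longrightarrow> 0 \<le> r s"
    and r_eq: "\<And>s. 0 < s \<Longrightarrow> emeasure lborel {x. s < g x} = ennreal (unit_ball_vol DIM('a) * r s ^ DIM('a))"
  shows "(\<integral>\<^sup>+x. ennreal (norm x powr (- \<beta>) * g x powr m) \<partial>lborel)
    \<le> (\<integral>\<^sup>+s. ennreal (m * s powr (m - 1) * (DIM('a) * unit_ball_vol DIM('a) / (DIM('a) - \<beta>) * r s powr (DIM('a) - \<beta>))) * indicator {0<..} s \<partial>lborel)"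
proof -
  let ?R = "\<lambda>s. DIM('a) * unit_ball_vol DIM('a) / (DIM('a) - \<beta>) * r s powr (DIM('a) - \<beta>)"
  have "(\<integral>\<^sup>+x. ennreal (norm x powr (- \<beta>) * g x powr m) \<partial>lborel) = (\<integral>\<^sup>+x. ennreal (norm x powr (- \<beta>)) * ennreal (g x powr m) \<partial>lborel)"
    by (simp add: ennreal_mult)
  also have "\<dots> = (\<integral>\<^sup>+s. ennreal (m * s powr (m - 1)) * indicator {0<..} s * (\<integral>\<^sup>+x. ennreal (norm x powr (- \<beta>)) * indicator {x. s < g x} x \<partial>lborel) \<partial>lborel)"
    by (rule nn_integral_layer_cake_powr[OF gm _ g m]) measurable
  also have "\<dots> \<le> (\<integral>\<^sup>+s. ennreal (m * s powr (m - 1) * (?R s)) * indicator {0<..} s \<partial>lborel)"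
  proof (rule nn_integral_mono)
    fix s :: real
    have [measurable]: "{x. s < g x} \<in> sets borel" by measurable
    show "ennreal (m * s powr (m - 1)) * indicator {0<..} s * (\<integral>\<^sup>+x. ennreal (norm x powr (- \<beta>)) * indicator {x. s < g x} x \<partial>lborel)
      \<le> ennreal (m * s powr (m - 1) * (?R s)) * indicator {0<..} s"
    proof (cases "0 < s")
      case True
      have "ennreal (m * s powr (m - 1)) * (\<integral>\<^sup>+x. ennreal (norm x powr (- \<beta>)) * indicator {x. s < g x} x \<partial>lborel)
        \<le> ennreal (m * s powr (m - 1)) * ennreal (?R s)"
        using r_eq[OF True] r[OF True] \<beta> by (intro mult_left_mono nn_integral_norm_powr_le) auto
      also have "\<dots> = ennreal (m * s powr (m - 1) * (?R s))"
        using m \<beta> by (intro ennreal_mult[symmetric]) auto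
      finally show ?thesis using True by simp
    qed simp
  qed
  finally show ?thesis .
qed

text \<open>The images of Lebesgue measure under \<open>g\<close> and of the power density under
  \<open>u\<close> agree on all half-lines above positive levels, hence on half-open intervals. In
  the application \<open>e = n / p\<close>, which turns the variable \<open>w\<close> back into
  volume.\<close>

lemma (in level_pair) nn_integral_equimeasurable_le:
  fixes g :: "'a::euclidean_space \<Rightarrow> real" and a :: "real \<Rightarrow> ennreal"
  assumes gm [measurable]: "g \<in> borel_measurable borel" and am [measurable]: "a \<in> borel_measurable borel"
    and e: "e > 0" and C: "C \<ge> 0"
    and dist: "\<And>s. 0 < s \<Longrightarrow> emeasure lborel {x. s < g x} = ennreal (C * z s powr e)"
  shows "(\<integral>\<^sup>+x. a (g x) * indicator {0<..} (g x) \<partial>lborel)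
    \<le> (\<integral>\<^sup>+w. a (u w) * indicator {0<..} (u w) * (ennreal (C * e * w powr (e - 1)) * indicator {0<..} w) \<partial>lborel)"
proof -
  let ?w = "\<lambda>w. ennreal (C * e * w powr (e - 1)) * indicator {0<..} w"
  define N where "N = distr lborel borel g"
  define M where "M = distr (density lborel ?w) borel u"
  have sets [measurable_cong]: "sets M = sets borel" "sets N = sets borel" by (auto simp: M_def N_def)
  have N: "emeasure N {s<..} = ennreal (C * z s powr e)" if "0 < s" for s
    unfolding N_def using dist[OF that] by (subst emeasure_distr) (auto simp: vimage_def)
  have M: "emeasure M {s<..} = ennreal (C * z s powr e)" if "0 < s" for s
  proof -
    have "u -` {s<..} \<in> sets borel" using measurable_sets[OF u_meas, of "{s<..}"] by simp
    then have "emeasure M {s<..} = (\<integral>\<^sup>+w. ?w w * indicator (u -` {s<..}) w \<partial>lborel)"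
      unfolding M_def by (subst emeasure_distr) (auto simp: emeasure_density)
    also have "\<dots> = (\<integral>\<^sup>+w. ennreal (C * e) * (ennreal (w powr (e - 1)) * indicator {0<..<z s} w) \<partial>lborel)"
      using C e that by (intro nn_integral_cong) (auto simp: indicator_def galois ennreal_mult)
    also have "\<dots> = ennreal (C * e) * ennreal (z s powr e / e)"
      using nn_integral_powr_from_0[of "e - 1" "z s"] e z_nonneg[of s] by (subst nn_integral_cmult) auto
    also have "\<dots> = ennreal (C * z s powr e)" using e C by (simp add: ennreal_mult[symmetric])
    finally show ?thesis .
  qed
  have Ioc: "emeasure K {t<..s} = emeasure K {t<..} - emeasure K {s<..}"
    if "sets K = sets borel" "t < s" "emeasure K {s<..} \<noteq> \<infinity>" for K and t s :: real
  proof -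
    have "{t<..s} = {t<..} - {s<..}" by auto
    then show ?thesis using that by (simp add: emeasure_Diff)
  qed
  have "(\<integral>\<^sup>+s. a s * indicator {0<..} s \<partial>N) \<le> (\<integral>\<^sup>+s. a s * indicator {0<..} s \<partial>M)"
  proof (rule nn_integral_le_of_Ioc[OF sets _ _ am])
    fix t s :: real assume ts: "0 < t" "t < s"
    then show "emeasure N {t<..s} \<le> emeasure M {t<..s}"
      using N M sets by (simp add: Ioc)
    have "emeasure M {t<..s} \<le> emeasure M {t<..}" using sets by (intro emeasure_mono) auto
    also have "\<dots> < \<infinity>" using M[OF ts(1)] by simp
    finally show "emeasure M {t<..s} < \<infinity>" .
  qed
  also have "(\<integral>\<^sup>+s. a s * indicator {0<..} s \<partial>N) = (\<integral>\<^sup>+x. a (g x) * indicator {0<..} (g x) \<partial>lborel)"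
    unfolding N_def by (subst nn_integral_distr) auto
  also have "(\<integral>\<^sup>+s. a s * indicator {0<..} s \<partial>M)
    = (\<integral>\<^sup>+w. a (u w) * indicator {0<..} (u w) * ?w w \<partial>lborel)"
    unfolding M_def by (subst nn_integral_distr, measurable) (subst nn_integral_density, auto simp: mult_ac)
  finally show ?thesis .
qed

text \<open>The conjugate is the generalized inverse of \<open>z\<close>. Right continuity, in the
  form of \<open>right\<close>, gives the strict inequality in the forward direction. The cut-off
  \<open>max w 0\<close> keeps the sets inside a bounded interval also for negative
  \<open>w\<close>.\<close>

lemma level_pair_conjugate:
  fixes z :: "real \<Rightarrow> real"
  assumes z0: "\<And>s. 0 \<le> z s" and zm [measurable]: "z \<in> borel_measurable borel"
    and mono: "\<And>s t. 0 < s \<Longrightarrow> s \<le> t \<Longrightarrow> z t \<le> z s" and S: "\<And>s. S \<le> s \<Longrightarrow> z s = 0"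
    and right: "\<And>s w. 0 < s \<Longrightarrow> 0 < w \<Longrightarrow> w < z s \<Longrightarrow> \<exists>s'>s. w < z s'"
  shows "level_pair z (\<lambda>w. measure lborel {s. 0 < s \<and> max w 0 < z s})"
proof unfold_locales
  have set: "{s. 0 < s \<and> max w 0 < z s} \<in> sets borel" for w by measurable
  have sub: "{s. 0 < s \<and> max w 0 < z s} \<subseteq> {0<..<S}" for w
    using S z0 by (auto simp: not_le[symmetric])
  have fm: "{s. 0 < s \<and> max w 0 < z s} \<in> fmeasurable lborel" for w
    using bounded_subset[OF bounded_Ioo sub] set by (intro fmeasurableI emeasure_bounded_finite) auto
  have "(\<lambda>w. measure lborel {s. 0 < s \<and> max w 0 < z s})
    = (\<lambda>w. enn2real (\<integral>\<^sup>+s. of_bool (0 < s \<and> max w 0 < z s) \<partial>lborel))"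
  proof
    fix w
    have "(\<integral>\<^sup>+s. of_bool (0 < s \<and> max w 0 < z s) \<partial>lborel) = (\<integral>\<^sup>+s. indicator {s. 0 < s \<and> max w 0 < z s} s \<partial>lborel)"
      by (intro nn_integral_cong) (auto simp: indicator_def)
    then show "measure lborel {s. 0 < s \<and> max w 0 < z s} = enn2real (\<integral>\<^sup>+s. of_bool (0 < s \<and> max w 0 < z s) \<partial>lborel)"
      using set by (simp add: measure_def)
  qed
  also have "\<dots> \<in> borel_measurable borel" by measurable
  finally show "(\<lambda>w. measure lborel {s. 0 < s \<and> max w 0 < z s}) \<in> borel_measurable borel" .
  fix s w :: real assume s: "0 < s" and w: "0 < w"
  show "w < z s \<longleftrightarrow> s < measure lborel {s. 0 < s \<and> max w 0 < z s}"
  proof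
    assume "w < z s"
    from right[OF s w this] obtain s' where s': "s' > s" "w < z s'" by blast
    have "{0<..s'} \<subseteq> {s. 0 < s \<and> max w 0 < z s}"
      using mono s' w by (auto intro: less_le_trans)
    then have "measure lborel {0<..s'} \<le> measure lborel {s. 0 < s \<and> max w 0 < z s}"
      using fm by (intro measure_mono_fmeasurable) auto
    then show "s < measure lborel {s. 0 < s \<and> max w 0 < z s}" using s s' by simp
  next
    assume lt: "s < measure lborel {s. 0 < s \<and> max w 0 < z s}"
    show "w < z s"
    proof (rule ccontr)
      assume "\<not> w < z s"
      then have "{s. 0 < s \<and> max w 0 < z s} \<subseteq> {0<..s}"
        using mono[OF s] w by (auto simp: not_less) (meson le_less_trans less_le_not_le linear not_less)
      then have "measure lborel {s. 0 < s \<and> max w 0 < z s} \<le> measure lborel {0<..s}"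
        using set s by (intro measure_mono_fmeasurable fmeasurableI) auto
      then show False using lt s by simp
    qed
  qed
qed (use z0 in auto)

section \<open>The sharp constant\<close>

lemma Gamma_legendre_duplication_real:
  fixes a :: real
  assumes a: "a > 0"
  shows "Gamma a * Gamma (a + 1/2) = 2 powr (1 - 2 * a) * sqrt pi * Gamma (2 * a)"
proof -
  have np: "complex_of_real x \<notin> \<int>\<^sub>\<le>\<^sub>0" if "x > 0" for x
    using that by (auto elim!: nonpos_Ints_cases simp: complex_eq_iff)
  have "complex_of_real (Gamma a * Gamma (a + 1/2)) = Gamma (complex_of_real a) * Gamma (complex_of_real a + 1/2)"
    using Gamma_complex_of_real[of a] Gamma_complex_of_real[of "a + 1/2"] by simp
  also have "\<dots> = exp ((1 - 2 * complex_of_real a) * of_real (ln 2)) * of_real (sqrt pi) * Gamma (2 * complex_of_real a)"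
    using np[of a] np[of "a + 1/2"] a by (intro Gamma_legendre_duplication) auto
  also have "\<dots> = complex_of_real (exp ((1 - 2 * a) * ln 2) * sqrt pi * Gamma (2 * a))"
    using Gamma_complex_of_real[of "2 * a"] by (simp add: exp_of_real[symmetric])
  finally have "Gamma a * Gamma (a + 1/2) = exp ((1 - 2 * a) * ln 2) * sqrt pi * Gamma (2 * a)"
    by (simp only: of_real_eq_iff)
  then show ?thesis by (simp add: powr_def)
qed

lemma profile_speed_cont:
  assumes "k > 0"
  shows "continuous_on {0..1} (profile_speed 1 k)"
  unfolding profile_speed_def using assms by (auto intro!: continuous_intros continuous_on_powr')

text \<open>The substitution \<open>y = t powr (1 / k)\<close> turns the integrand into that of a
  Beta integral, with \<open>3 / 2\<close> coming from the square root.\<close>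

lemma has_integral_profile_speed:
  assumes k: "k > 0"
  shows "(profile_speed 1 k has_integral Beta (2 / k) (3 / 2) / (2 * k)) {0..1}"
proof -
  let ?g = "\<lambda>t. t powr (1 / k)"
  have "((\<lambda>t. (1 / k * t powr (1 / k - 1)) *\<^sub>R profile_speed 1 k (?g t)) has_integral
      (integral {?g 0..?g 1} (profile_speed 1 k) - integral {?g 1..?g 0} (profile_speed 1 k))) {0..1}"
  \<comment> \<open>The point 0 is exempted from differentiability because
    \<open>t powr (1 / k)\<close> may have infinite slope there.\<close>
  proof (rule has_integral_substitution_general[of "{0}" 0 1 ?g 0 1])
    show "?g ` {0..1} \<subseteq> {0..1}" using k by (auto intro!: powr_le1)
    show "continuous_on {0..1} (profile_speed 1 k)" by (rule profile_speed_cont[OF k])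
    show "continuous_on {0..1} ?g" using k by (auto intro!: continuous_intros continuous_on_powr')
    fix x :: real assume "x \<in> {0..1} - {0}"
    then show "(?g has_real_derivative (1 / k * x powr (1 / k - 1))) (at x within {0..1})"
      by (intro has_field_derivative_at_within[OF has_real_derivative_powr]) auto
  qed auto
  then have "((\<lambda>t. (1 / k * t powr (1 / k - 1)) * profile_speed 1 k (?g t)) has_integral integral {0..1} (profile_speed 1 k)) {0..1}"
    using k by simp
  moreover have "((\<lambda>t. (1 / k * t powr (1 / k - 1)) * profile_speed 1 k (?g t)) has_integral Beta (2 / k) (3 / 2) / (2 * k)) {0..1}"
  proof (rule has_integral_eq)
    show "((\<lambda>t. t powr (2 / k - 1) * (1 - t) powr (3 / 2 - 1) / (2 * k)) has_integral Beta (2 / k) (3 / 2) / (2 * k)) {0..1}"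
      using k by (intro has_integral_divide has_integral_Beta_real) auto
    fix t :: real assume t: "t \<in> {0..1}"
    show "t powr (2 / k - 1) * (1 - t) powr (3 / 2 - 1) / (2 * k) = (1 / k * t powr (1 / k - 1)) * profile_speed 1 k (?g t)"
    proof (cases "t = 0")
      case False
      have "t powr (2 / k - 1) = t powr (1 / k - 1) * t powr (1 / k)" by (simp add: powr_add[symmetric])
      moreover have "(t powr (1 / k)) powr k = t" using k t by (simp add: powr_powr)
      moreover have "(1 - t) powr (3 / 2 - 1) = sqrt (1 - t)" using t by (simp add: powr_half_sqrt)
      ultimately show ?thesis by (simp add: profile_speed_def field_simps)
    qed simp
  qed
  ultimately have "integral {0..1} (profile_speed 1 k) = Beta (2 / k) (3 / 2) / (2 * k)"
    by (rule has_integral_unique)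
  moreover have "(profile_speed 1 k has_integral integral {0..1} (profile_speed 1 k)) {0..1}"
    by (intro integrable_integral integrable_continuous_interval profile_speed_cont k)
  ultimately show ?thesis by simp
qed

text \<open>Since \<open>2 / k = \<alpha> - 1\<close>, the Beta value contains
  \<open>Gamma (\<alpha> + 1/2)\<close> and \<open>sqrt pi\<close>; the duplication formula trades
  both for \<open>Gamma (2 * \<alpha>)\<close>, and the remaining powers of 2 are absorbed by
  \<open>4 powr (1 - \<alpha>)\<close>.\<close>

lemma profile_speed_constant:
  fixes k :: real
  defines "\<alpha> \<equiv> (k + 2) / k"
  assumes k: "k > 0"
  shows "4 powr (1 - \<alpha>) * (4 * \<alpha> * (Beta (2 / k) (3 / 2) / (2 * k))) = Gamma \<alpha> * Gamma (\<alpha> + 1) / Gamma (2 * \<alpha>)"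
proof -
  have \<alpha>1: "\<alpha> - 1 = 2 / k" and \<alpha>: "\<alpha> > 1" using k by (auto simp: \<alpha>_def field_simps)
  have np: "x \<notin> \<int>\<^sub>\<le>\<^sub>0" if "x > 0" for x :: real using that by (auto elim!: nonpos_Ints_cases)
  have G32: "Gamma (3 / 2 :: real) = sqrt pi / 2"
    using Gamma_plus1[of "1/2 :: real"] np[of "1/2"] by (simp add: Gamma_one_half_real)
  have Ga: "Gamma \<alpha> = (\<alpha> - 1) * Gamma (\<alpha> - 1)" "Gamma (\<alpha> + 1) = \<alpha> * Gamma \<alpha>"
    using Gamma_plus1[of "\<alpha> - 1"] Gamma_plus1[of \<alpha>] np[of "\<alpha> - 1"] np[of \<alpha>] \<alpha> by auto
  have pos: "Gamma \<alpha> > 0" "Gamma (\<alpha> + 1/2) > 0" "Gamma (2 * \<alpha>) > 0" using \<alpha> by auto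
  have B: "Beta (2 / k) (3 / 2) / (2 * k) = Gamma \<alpha> * sqrt pi / (8 * Gamma (\<alpha> + 1/2))"
  proof -
    have "Beta (2 / k) (3 / 2) = Gamma (\<alpha> - 1) * (sqrt pi / 2) / Gamma (\<alpha> + 1/2)"
      unfolding \<alpha>1[symmetric] Beta_def G32 by (simp add: algebra_simps)
    moreover have "Beta (2 / k) (3 / 2) / (2 * k) = Beta (2 / k) (3 / 2) * ((\<alpha> - 1) / 4)"
      using \<alpha>1 by simp
    ultimately show ?thesis unfolding Ga(1) by simp
  qed
  have frac: "g * w / (8 * h) = g * g / (8 * p * d)" if "g * h = p * w * d" "h > 0" "p > 0" "d > 0" for g h p d w :: real
  proof -
    have "g * g * (8 * h) = g * w * (8 * p * d)" using that(1) by (simp add: algebra_simps)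
    then show ?thesis using that by (simp add: frac_eq_eq)
  qed
  have "Beta (2 / k) (3 / 2) / (2 * k) = Gamma \<alpha> * Gamma \<alpha> / (8 * 2 powr (1 - 2 * \<alpha>) * Gamma (2 * \<alpha>))"
    unfolding B using Gamma_legendre_duplication_real[of \<alpha>] \<alpha> pos by (intro frac) auto
  moreover have "4 powr (1 - \<alpha>) = 2 * 2 powr (1 - 2 * \<alpha>)"
  proof -
    have "(4::real) powr (1 - \<alpha>) = (2 powr 2) powr (1 - \<alpha>)" by simp
    also have "\<dots> = 2 powr (2 * (1 - \<alpha>))" by (simp only: powr_powr)
    also have "\<dots> = 2 powr (1 + (1 - 2 * \<alpha>))" by (simp add: algebra_simps)
    also have "\<dots> = 2 * 2 powr (1 - 2 * \<alpha>)" by (simp only: powr_add) simp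
    finally show ?thesis .
  qed
  ultimately show ?thesis using Ga(2) by simp
qed

text \<open>Minimization over \<open>M\<close> by weighted Young: the exponents \<open>2 / q\<close>
  and \<open>1 / \<alpha> = k / q\<close> add up to 1 and are exactly those for which the powers
  \<open>M powr (- k)\<close> and \<open>M\<^sup>2\<close> cancel.\<close>

lemma young_optimization:
  fixes k \<gamma> \<sigma> M Q X :: real
  defines "q \<equiv> k + 2" and "\<alpha> \<equiv> (k + 2) / k"
  assumes k: "k > 0" and \<gamma>: "\<gamma> > 0" and \<sigma>: "\<sigma> > 0" and M: "M > 0" and Q: "Q \<ge> 0"
    and X: "M powr (- k) / 4 * Q + 4 * \<sigma> * M\<^sup>2 * \<gamma> \<le> X"
  shows "\<sigma> powr (1 / \<alpha>) * (q / 2) powr (2 / q) * (4 powr (1 - \<alpha>) * (4 * \<alpha> * \<gamma>)) powr (1 / \<alpha>) * Q powr (2 / q) \<le> X"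
proof (cases "Q = 0")
  case True
  have "0 \<le> 4 * \<sigma> * M\<^sup>2 * \<gamma>" using \<sigma> \<gamma> by (intro mult_nonneg_nonneg) auto
  also have "\<dots> \<le> X" using X True by simp
  finally show ?thesis using True by simp
next
  case False
  then have Q0: "Q > 0" using Q by simp
  have q: "q > 0" "q > 2" and \<alpha>: "\<alpha> > 0" using k by (auto simp: q_def \<alpha>_def)
  have inv: "1 / \<alpha> = k / q" by (simp add: \<alpha>_def q_def)
  \<comment> \<open>The factors \<open>q / 2\<close> and \<open>\<alpha>\<close> are the reciprocals
    of the Young weights, so that the weighted sum is the left side of \<open>X\<close>.\<close>
  let ?a = "M powr (- k) / 4 * Q * (q / 2)" and ?b = "4 * \<sigma> * M\<^sup>2 * \<gamma> * \<alpha>"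
  have "?a powr (2 / q) * ?b powr (1 / \<alpha>) \<le> 2 / q * ?a + 1 / \<alpha> * ?b"
  proof (rule Youngs_inequality_0)
    show "2 / q + 1 / \<alpha> = 1" unfolding inv using q by (simp add: add_divide_distrib[symmetric] q_def)
    show "0 < ?a" "0 < ?b" using q \<sigma> \<gamma> \<alpha> M Q0 by (intro mult_pos_pos divide_pos_pos; simp)+
  qed (use q \<alpha> in auto)
  also have "\<dots> = M powr (- k) / 4 * Q + 4 * \<sigma> * M\<^sup>2 * \<gamma>" using q \<alpha> by simp
  also note X
  finally have "?a powr (2 / q) * ?b powr (1 / \<alpha>) \<le> X" .
  moreover have "?a powr (2 / q) * ?b powr (1 / \<alpha>)
    = \<sigma> powr (1 / \<alpha>) * (q / 2) powr (2 / q) * (4 powr (1 - \<alpha>) * (4 * \<alpha> * \<gamma>)) powr (1 / \<alpha>) * Q powr (2 / q)"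
  proof -
    have a: "?a powr (2 / q) = (M powr (- k)) powr (2 / q) * (1 / 4) powr (2 / q) * Q powr (2 / q) * (q / 2) powr (2 / q)"
    proof -
      have "?a = M powr (- k) * (1 / 4) * Q * (q / 2)" by simp
      then show ?thesis using M Q0 q by (simp only: powr_mult)
    qed
    have b: "?b powr (1 / \<alpha>) = \<sigma> powr (1 / \<alpha>) * (M\<^sup>2) powr (1 / \<alpha>) * (4 * \<alpha> * \<gamma>) powr (1 / \<alpha>)"
    proof -
      have "?b = \<sigma> * M\<^sup>2 * (4 * \<alpha> * \<gamma>)" by simp
      then show ?thesis using M \<sigma> \<alpha> \<gamma> by (simp only: powr_mult)
    qed
    have "(M\<^sup>2) powr (1 / \<alpha>) = M powr (2 * k / q)"
      using M by (simp add: inv powr_powr flip: powr_numeral)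
    moreover have "(M powr (- k)) powr (2 / q) = M powr (- (2 * k / q))" by (simp add: powr_powr mult.commute)
    ultimately have MM: "(M powr (- k)) powr (2 / q) * (M\<^sup>2) powr (1 / \<alpha>) = 1"
      using M by (simp add: powr_add[symmetric])
    have "(1 / 4 :: real) powr (2 / q) = 4 powr (- (2 / q))" by (simp add: powr_minus powr_divide field_simps)
    also have "- (2 / q) = (1 - \<alpha>) * (1 / \<alpha>)"
      using \<alpha> q by (simp add: inv q_def \<alpha>_def field_simps)
    also have "4 powr \<dots> = (4 powr (1 - \<alpha>)) powr (1 / \<alpha>)" by (simp only: powr_powr)
    finally have four: "(1 / 4 :: real) powr (2 / q) = (4 powr (1 - \<alpha>)) powr (1 / \<alpha>)" .
    have c: "(4 powr (1 - \<alpha>) * (4 * \<alpha> * \<gamma>)) powr (1 / \<alpha>) = (1 / 4) powr (2 / q) * (4 * \<alpha> * \<gamma>) powr (1 / \<alpha>)"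
      unfolding four using \<alpha> \<gamma> by (simp only: powr_mult)
    have "?a powr (2 / q) * ?b powr (1 / \<alpha>) = ((M powr (- k)) powr (2 / q) * (M\<^sup>2) powr (1 / \<alpha>)) *
        (\<sigma> powr (1 / \<alpha>) * (q / 2) powr (2 / q) * ((1 / 4) powr (2 / q) * (4 * \<alpha> * \<gamma>) powr (1 / \<alpha>)) * Q powr (2 / q))"
      unfolding a b by (simp only: mult_ac)
    then show ?thesis unfolding MM c by simp
  qed
  ultimately show ?thesis by simp
qed

section \<open>Dirichlet integral\<close>

lemma norm_frechet_derivative_le:
  fixes f :: "real^'n \<Rightarrow> complex"
  assumes "f differentiable (at x)"
  shows "norm (frechet_derivative f (at x) h) \<le> sqrt (grad_norm_sq f x) * norm h"
proof -
  let ?D = "frechet_derivative f (at x)"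
  have lin: "linear ?D" using assms by (rule linear_frechet_derivative)
  have h: "(\<Sum>i\<in>UNIV. (h $ i) *\<^sub>R axis i (1::real)) = h"
    using basis_expansion[of h] by (simp add: scalar_mult_eq_scaleR)
  have "?D h = (\<Sum>i\<in>UNIV. (h $ i) *\<^sub>R partial_deriv i f x)"
    by (subst h[symmetric]) (simp add: linear_sum[OF lin] linear_scale[OF lin] partial_deriv_def)
  also have "norm \<dots> \<le> (\<Sum>i\<in>UNIV. norm ((h $ i) *\<^sub>R partial_deriv i f x))" by (rule norm_sum)
  also have "\<dots> = (\<Sum>i\<in>UNIV. \<bar>h $ i\<bar> * \<bar>norm (partial_deriv i f x)\<bar>)" by simp
  also have "\<dots> \<le> L2_set (\<lambda>i. h $ i) UNIV * L2_set (\<lambda>i. norm (partial_deriv i f x)) UNIV"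
    by (rule L2_set_mult_ineq)
  also have "L2_set (\<lambda>i. h $ i) UNIV = norm h" by (simp add: norm_vec_def L2_set_def)
  also have "L2_set (\<lambda>i. norm (partial_deriv i f x)) UNIV = sqrt (grad_norm_sq f x)"
    by (simp add: L2_set_def grad_norm_sq_def)
  finally show ?thesis by (simp add: mult.commute)
qed

section \<open>Level sets and square integrability under polynomial decay\<close>

context
  fixes h :: "'a::euclidean_space \<Rightarrow> real" and C :: real
  assumes C: "0 < C" and decay: "\<And>x. (1 + norm x) ^ DIM('a) * h x \<le> C" and h0: "\<And>x. 0 \<le> h x"
begin

lemma decay_bound: "h x \<le> C"
proof -
  have "1 * h x \<le> (1 + norm x) ^ DIM('a) * h x" by (intro mult_right_mono h0) simp
  then show ?thesis using decay[of x] by simp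
qed

lemma decay_level_subset:
  assumes s: "0 < s"
  shows "{x. s < h x} \<subseteq> ball 0 (root DIM('a) (C / s))"
proof
  fix x assume "x \<in> {x. s < h x}"
  then have x: "s < h x" by simp
  have "norm x ^ DIM('a) * s \<le> (1 + norm x) ^ DIM('a) * s" using s by (intro mult_right_mono power_mono) auto
  also have "\<dots> < (1 + norm x) ^ DIM('a) * h x"
    using x by (intro mult_strict_left_mono) (auto simp: add_pos_nonneg)
  also have "\<dots> \<le> C" by (rule decay)
  finally have "norm x ^ DIM('a) < C / s" using s by (simp add: field_simps)
  then have "root DIM('a) (norm x ^ DIM('a)) < root DIM('a) (C / s)" by simp
  then show "x \<in> ball 0 (root DIM('a) (C / s))" by (simp add: real_root_power_cancel)
qed

text \<open>With decay exponent equal to the dimension the level sets have volume of order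
  \<open>1 / s\<close>. This bound alone gives square integrability and later the integrability of
  \<open>s * (z s)\<^sup>2\<close>.\<close>

lemma decay_level_emeasure:
  assumes s: "0 < s" 
  shows "emeasure lborel {x. s < h x} \<le> ennreal (unit_ball_vol DIM('a) * (C / s))"
proof -
  have "emeasure lborel {x. s < h x} \<le> emeasure lborel (ball (0::'a) (root DIM('a) (C / s)))"
    by (intro emeasure_mono decay_level_subset s) auto
  also have "\<dots> = ennreal (unit_ball_vol DIM('a) * (C / s))"
    using C s by (subst emeasure_ball) auto
  finally show ?thesis .
qed

lemma decay_level_bounded: "0 < s \<Longrightarrow> bounded {x. s < h x}"
  using decay_level_subset bounded_ball bounded_subset by blast

text \<open>In the layer cake formula the factor \<open>s\<close> cancels the \<open>1 / s\<close>
  in the level volumes, and only the levels up to \<open>C\<close> contribute.\<close>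

lemma decay_square_integrable:
  assumes [measurable]: "h \<in> borel_measurable borel"
  shows "integrable lborel (\<lambda>x. (h x)\<^sup>2)"
proof (rule integrableI_nonneg)
  have "(\<integral>\<^sup>+x. ennreal ((h x)\<^sup>2) \<partial>lborel) = (\<integral>\<^sup>+x. 1 * ennreal (h x powr 2) \<partial>lborel)"
    using h0 by (intro nn_integral_cong) (simp add: powr_numeral)
  also have "\<dots> = (\<integral>\<^sup>+s. ennreal (2 * s powr (2 - 1)) * indicator {0<..} s * (\<integral>\<^sup>+x. 1 * indicator {x. s < h x} x \<partial>lborel) \<partial>lborel)"
    using h0 by (intro nn_integral_layer_cake_powr) auto
  also have "\<dots> \<le> (\<integral>\<^sup>+s. ennreal (2 * unit_ball_vol DIM('a) * C) * indicator {0..C} s \<partial>lborel)"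
  proof (rule nn_integral_mono)
    fix s :: real
    have [measurable]: "{x. s < h x} \<in> sets borel" by measurable
    show "ennreal (2 * s powr (2 - 1)) * indicator {0<..} s * (\<integral>\<^sup>+x. 1 * indicator {x. s < h x} x \<partial>lborel)
      \<le> ennreal (2 * unit_ball_vol DIM('a) * C) * indicator {0..C} s"
    proof (cases "0 < s \<and> s \<le> C")
      case True
      then have "ennreal (2 * s powr (2 - 1)) * emeasure lborel {x. s < h x} \<le> ennreal (2 * s) * ennreal (unit_ball_vol DIM('a) * (C / s))"
        using decay_level_emeasure by (intro mult_mono) auto
      also have "\<dots> = ennreal (2 * unit_ball_vol DIM('a) * C)"
        using True C by (subst ennreal_mult[symmetric]) auto
      finally show ?thesis using True by simp
    next
      case False
      have "{x. s < h x} = {}" if "s > C" using order_trans[OF decay_bound, of s] that by (auto simp: not_less)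
      then show ?thesis using False by (auto simp: indicator_def)
    qed
  qed
  also have "\<dots> < \<infinity>" using C by (simp add: nn_integral_cmult_indicator ennreal_mult_less_top)
  finally show "(\<integral>\<^sup>+x. ennreal ((h x)\<^sup>2) \<partial>lborel) < \<infinity>" .
qed auto

end

lemma integral_le_of_nn_integral_le:
  fixes f :: "'a \<Rightarrow> real"
  assumes "f \<in> borel_measurable M" "\<And>x. 0 \<le> f x" "(\<integral>\<^sup>+x. ennreal (f x) \<partial>M) \<le> ennreal c" "0 \<le> c"
  shows "(\<integral>x. f x \<partial>M) \<le> c"
proof -
  have "(\<integral>x. f x \<partial>M) = enn2real (\<integral>\<^sup>+x. ennreal (f x) \<partial>M)"
    using assms by (intro integral_eq_nn_integral) auto
  also have "\<dots> \<le> c" using assms by (intro enn2real_leI) auto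
  finally show ?thesis .
qed

section \<open>Scaling of the boundary term and its limit\<close>

lemma profile_speed_scale:
  assumes M: "0 < M" and c: "0 < c"
  shows "(LBINT s. indicator {0<..<v / c} s * (c * profile_speed M k (c * s)))
    = M\<^sup>2 * (LBINT y. indicator {0<..<v / M} y * profile_speed 1 k y)"
proof -
  have "(LBINT s. indicator {0<..<v / c} s * (c * profile_speed M k (c * s)))
    = \<bar>M / c\<bar> *\<^sub>R (LBINT y. indicator {0<..<v / c} (0 + M / c * y) * (c * profile_speed M k (c * (0 + M / c * y))))"
    using M c by (intro lborel_integral_real_affine) auto
  also have "(LBINT y. indicator {0<..<v / c} (0 + M / c * y) * (c * profile_speed M k (c * (0 + M / c * y))))
     = (LBINT y. (c * M) * (indicator {0<..<v / M} y * profile_speed 1 k y))"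
  proof (rule Bochner_Integration.integral_cong[OF refl])
    fix y
    have "profile_speed M k (c * (0 + M / c * y)) = M * profile_speed 1 k y"
      using M c by (simp add: profile_speed_def)
    moreover have "indicator {0<..<v / c} (0 + M / c * y) = (indicator {0<..<v / M} y :: real)"
      using M c by (auto simp: indicator_def field_simps zero_less_mult_iff)
    ultimately show "indicator {0<..<v / c} (0 + M / c * y) * (c * profile_speed M k (c * (0 + M / c * y)))
      = (c * M) * (indicator {0<..<v / M} y * profile_speed 1 k y)" by simp
  qed
  also have "\<dots> = (c * M) * (LBINT y. indicator {0<..<v / M} y * profile_speed 1 k y)" by simp
  finally show ?thesis using M c by (simp add: power2_eq_square)
qed

text \<open>The integrand is at most 1 on the unit interval, so the part missing between
  \<open>\<theta>\<close> and 1 is at most \<open>1 - \<theta>\<close>.\<close>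

lemma profile_speed_integral_limit:
  assumes k: "k > 0"
  shows "((\<lambda>\<theta>. \<integral>y. indicator {0<..<\<theta>} y * profile_speed 1 k y \<partial>lborel) \<longlongrightarrow> Beta (2 / k) (3 / 2) / (2 * k)) (at_left 1)"
proof -
  let ?\<gamma> = "Beta (2 / k) (3 / 2) / (2 * k)"
  let ?I = "\<lambda>\<theta>. \<integral>y. indicator {0<..<\<theta>} y * profile_speed 1 k y \<partial>lborel"
  have int: "integrable lborel (\<lambda>y. indicator {0<..<\<theta>} y * profile_speed 1 k y)" if "\<theta> \<le> 1" for \<theta>
  proof (rule Bochner_Integration.integrable_bound)
    show "integrable lborel (indicator {0<..<1::real} :: real \<Rightarrow> real)" by simp
    show "AE y in lborel. norm (indicator {0<..<\<theta>} y * profile_speed 1 k y) \<le> norm (indicator {0<..<1} y :: real)"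
    proof (rule AE_I2)
      fix y
      show "norm (indicator {0<..<\<theta>} y * profile_speed 1 k y) \<le> norm (indicator {0<..<1} y :: real)"
        using profile_speed_bounds[of y 1 k] k that by (auto simp: indicator_def)
    qed
  qed measurable
  have one: "?I 1 = ?\<gamma>"
  proof -
    have "((\<lambda>y. profile_speed 1 k y) has_integral ?\<gamma>) {0<..<1}"
      using has_integral_profile_speed[OF k] by (simp add: has_integral_Icc_iff_Ioo)
    then have "(\<integral>\<^sup>+y. ennreal (profile_speed 1 k y) * indicator {0<..<1} y \<partial>lborel) = ennreal ?\<gamma>"
      using profile_speed_bounds k by (intro nn_integral_has_integral_lebesgue') auto
    moreover have "?I 1 = enn2real (\<integral>\<^sup>+y. ennreal (indicator {0<..<1} y * profile_speed 1 k y) \<partial>lborel)"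
    proof (rule integral_eq_nn_integral)
      show "AE y in lborel. 0 \<le> indicator {0<..<1} y * profile_speed 1 k y"
        using profile_speed_bounds(1)[of _ 1 k] k by (intro AE_I2) (auto simp: indicator_def)
    qed measurable
    moreover have "(\<integral>\<^sup>+y. ennreal (indicator {0<..<1} y * profile_speed 1 k y) \<partial>lborel) = (\<integral>\<^sup>+y. ennreal (profile_speed 1 k y) * indicator {0<..<1} y \<partial>lborel)"
      by (intro nn_integral_cong) (auto simp: indicator_def)
    moreover have "0 \<le> ?\<gamma>"
      using has_integral_nonneg[OF has_integral_profile_speed[OF k]] profile_speed_bounds(1)[of _ 1 k] k by auto
    ultimately show ?thesis by simp
  qed
  have bound: "norm (?I \<theta> - ?\<gamma>) \<le> 1 - \<theta>" if "0 < \<theta>" "\<theta> < 1" for \<theta>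
  proof -
    have "?\<gamma> - ?I \<theta> = (LBINT y. indicator {0<..<1} y * profile_speed 1 k y - indicator {0<..<\<theta>} y * profile_speed 1 k y)"
      unfolding one[symmetric] using int that by simp
    also have "norm \<dots> \<le> (LBINT y. indicator {\<theta>..1} y)"
    proof (rule Bochner_Integration.integral_norm_bound_integral)
      show "integrable lborel (\<lambda>y. indicator {0<..<1} y * profile_speed 1 k y - indicator {0<..<\<theta>} y * profile_speed 1 k y)"
        using int that by simp
      fix y
      show "norm (indicator {0<..<1} y * profile_speed 1 k y - indicator {0<..<\<theta>} y * profile_speed 1 k y) \<le> indicator {\<theta>..1} y"
        using profile_speed_bounds[of y 1 k] k that by (auto simp: indicator_def)
    qed (use that in \<open>auto intro!: integrable_real_indicator\<close>)
    also have "\<dots> = 1 - \<theta>" using that by simp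
    finally show ?thesis by (simp add: norm_minus_commute)
  qed
  have "((\<lambda>\<theta>. ?I \<theta> - ?\<gamma>) \<longlongrightarrow> 0) (at_left 1)"
  proof (rule Lim_null_comparison)
    have "eventually (\<lambda>\<theta>. \<theta> \<in> {0<..<1::real}) (at_left 1)" by (rule eventually_at_left_real) simp
    then show "eventually (\<lambda>\<theta>. norm (?I \<theta> - ?\<gamma>) \<le> 1 - \<theta>) (at_left 1)"
      by eventually_elim (use bound in auto)
    show "((\<lambda>\<theta>::real. 1 - \<theta>) \<longlongrightarrow> 0) (at_left 1)" by (auto intro!: tendsto_eq_intros)
  qed
  then show ?thesis by (simp add: LIM_zero_iff)
qed

text \<open>The parameter \<open>\<theta>\<close> accounts for the supremum of \<open>s * z s\<close> possibly not being attained; the sharp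
  inequality is the limit \<open>\<theta> \<rightarrow> 1\<close>.\<close>

lemma energy_calibration:
  fixes f :: "'a::euclidean_space \<Rightarrow> 'b::real_normed_vector" and q \<theta> :: real
  defines "n \<equiv> real DIM('a)" and "\<omega> \<equiv> unit_ball_vol (real DIM('a))"
  assumes n3: "DIM('a) \<ge> 3"
    and q: "2 < q" "q \<le> 2 * n / (n - 2)"
    and L: "L \<ge> 0" and lip: "\<And>x y. norm (f x - f y) \<le> L * norm (x - y)"
    and C: "0 < C" and decay: "\<And>x. (1 + norm x) ^ DIM('a) * norm (f x) \<le> C"
    and der: "\<And>x. (f has_derivative D x) (at x)"
    and DG: "\<And>x h. norm (D x h) \<le> dn x * norm h" and dn0: "\<And>x. 0 \<le> dn x" and dnK: "\<And>x. dn x \<le> K"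
    and dnm [measurable]: "dn \<in> borel_measurable borel"
    and E: "integrable lborel (\<lambda>x. (dn x)\<^sup>2)"
    and f_nz: "f x0 \<noteq> 0"
    and \<theta>: "0 < \<theta>" "\<theta> < 1"
  obtains M where "0 < M"
    "M powr (- (q - 2)) / 4 * (LBINT x. norm x powr (- (n - (n - 2) / 2 * q)) * norm (f x) powr q)
      + 4 * (n * \<omega>) * M\<^sup>2 * (LBINT y. indicator {0<..<\<theta>} y * profile_speed 1 (q - 2) y)
      \<le> (LBINT x. (dn x)\<^sup>2) - (n - 1) * (n - 3) / 4 * (LBINT x. (norm (f x))\<^sup>2 / (norm x)\<^sup>2)"
proof -
  define g where "g x = norm (f x)" for x
  define p where "p = (n - 2) / 2"
  define \<sigma> where "\<sigma> = n * \<omega>"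
  define k where "k = q - 2"
  have n: "n \<ge> 3" using n3 by (simp add: n_def)
  have p: "p \<ge> 1 / 2" "p > 0" using n by (auto simp: p_def)
  have np: "n = 2 * p + 2" by (simp add: p_def field_simps)
  have wn: "unit_ball_vol n = \<omega>" by (simp add: \<omega>_def n_def)
  have p2: "p * 2 = n - 2" by (simp add: np)
  have k: "k > 0" using q by (simp add: k_def)
  have \<omega>: "\<omega> > 0" by (simp add: \<omega>_def)
  have \<sigma>: "\<sigma> > 0" using \<omega> n by (simp add: \<sigma>_def)
  have pq: "0 < p * q" "p * q \<le> n" using q n p by (auto simp: p_def field_simps)
  have contf: "continuous_on UNIV f"
    using der by (meson has_derivative_continuous continuous_at_imp_continuous_on)
  have contg: "continuous_on UNIV g" unfolding g_def by (intro continuous_on_norm contf)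
  have gm [measurable]: "g \<in> borel_measurable borel" by (rule borel_measurable_continuous_onI[OF contg])
  have g0: "0 \<le> g x" for x by (simp add: g_def)
  have gdecay: "(1 + norm x) ^ DIM('a) * g x \<le> C" for x using decay by (simp add: g_def)
  note gC = decay_bound[OF C gdecay g0]
  note gbdd = decay_level_bounded[OF C gdecay g0]
  note gem = decay_level_emeasure[OF C gdecay g0]
  define \<mu> where "\<mu> s = measure lborel {x. s < g x}" for s
  have lev [measurable]: "{x. s < g x} \<in> sets borel" for s by measurable
  have fin: "emeasure lborel {x. s < g x} < \<infinity>" if "0 < s" for s
    using emeasure_bounded_finite[OF gbdd[OF that]] by simp
  have em: "emeasure lborel {x. s < g x} = ennreal (\<mu> s)" if "0 < s" for s
    using fin[OF that] unfolding \<mu>_def by (intro emeasure_eq_ennreal_measure) auto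
  have fmg: "{x. s < g x} \<in> fmeasurable lborel" if "0 < s" for s
    using fin[OF that] by (intro fmeasurableI) auto
  have \<mu>0: "0 \<le> \<mu> s" for s by (simp add: \<mu>_def)
  have \<mu>_mono: "\<mu> t \<le> \<mu> s" if "0 < s" "s \<le> t" for s t
    unfolding \<mu>_def using that fmg by (intro measure_mono_fmeasurable) auto
  have \<mu>_zero: "\<mu> s = 0" if "C \<le> s" for s
  proof -
    have "{x. s < g x} = {}" using order_trans[OF gC that] by (auto simp: not_less)
    then show ?thesis by (simp add: \<mu>_def)
  qed
  have \<mu>_le: "\<mu> s \<le> \<omega> * (C / s)" if "0 < s" for s
    using gem[OF that] C that \<omega> unfolding em[OF that] \<omega>_def[symmetric] by (subst (asm) ennreal_le_iff) auto
  have \<mu>_meas [measurable]: "\<mu> \<in> borel_measurable borel"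
  proof -
    have "\<mu> = (\<lambda>s. enn2real (\<integral>\<^sup>+x. of_bool (s < g x) \<partial>lborel))"
    proof
      fix s
      have "(\<integral>\<^sup>+x. of_bool (s < g x) \<partial>lborel) = (\<integral>\<^sup>+x. indicator {x. s < g x} x \<partial>lborel)"
        by (intro nn_integral_cong) (auto simp: indicator_def)
      then show "\<mu> s = enn2real (\<integral>\<^sup>+x. of_bool (s < g x) \<partial>lborel)" by (simp add: \<mu>_def measure_def)
    qed
    then show ?thesis by simp
  qed
  define r where "r s = root DIM('a) (\<mu> s / \<omega>)" for s
  have r0: "0 \<le> r s" for s using \<mu>0 \<omega> by (simp add: r_def)
  have rm [measurable]: "r \<in> borel_measurable borel" unfolding r_def by measurable
  have r_pow: "\<omega> * r s ^ DIM('a) = \<mu> s" for s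
    using \<mu>0[of s] \<omega> by (simp add: r_def)
  have r_powr: "r s powr n = \<mu> s / \<omega>" for s
    using r_pow[of s] r0[of s] \<omega> n by (cases "r s = 0") (auto simp: n_def powr_realpow power_0_left field_simps)
  \<comment> \<open>The radius in the variable \<open>w = \<bar>x\<bar> powr p\<close>; in it the
    function \<open>v\<close> of the calibration is simply \<open>w * u w\<close>.\<close>
  define z where "z s = (if 0 < s then r s powr p else 0)" for s
  have z0': "0 \<le> z s" for s by (simp add: z_def)
  have zm [measurable]: "z \<in> borel_measurable borel" unfolding z_def by measurable
  have z_mono: "z t \<le> z s" if "0 < s" "s \<le> t" for s t
    using that \<mu>_mono[OF that] p r0[of t] \<omega>
    by (auto simp: z_def r_def intro!: powr_mono2 divide_right_mono)
  have z_zero: "z s = 0" if "C \<le> s" for s using \<mu>_zero[OF that] p by (simp add: z_def r_def)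
  have zr: "z s powr a = r s powr (p * a)" if "0 < s" for s a using that by (simp add: z_def powr_powr)
  \<comment> \<open>Right continuity of \<open>z\<close>: the sets \<open>{x. t j < g x}\<close>
    increase to \<open>{x. s < g x}\<close> as \<open>t j\<close> decreases to
    \<open>s\<close>.\<close>
  have right: "\<exists>s'>s. w < z s'" if s: "0 < s" and w: "0 < w" "w < z s" for s w
  proof -
    define t where "t j = s + 1 / (real j + 1)" for j :: nat
    have ts: "s < t j" for j by (simp add: t_def)
    have "(\<lambda>j. measure lborel {x. t j < g x}) \<longlonglongrightarrow> measure lborel (\<Union>j. {x. t j < g x})"
    proof (rule Lim_measure_incseq)
      show "range (\<lambda>j. {x. t j < g x}) \<subseteq> sets lborel" by auto
      show "incseq (\<lambda>j. {x. t j < g x})"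
      proof (rule monoI)
        fix i j :: nat assume "i \<le> j"
        then have "t j \<le> t i" by (simp add: t_def frac_le)
        then show "{x. t i < g x} \<subseteq> {x. t j < g x}" by auto
      qed
      have "(\<Union>j. {x. t j < g x}) \<subseteq> {x. s < g x}" using ts less_trans by blast
      then have "emeasure lborel (\<Union>j. {x. t j < g x}) \<le> emeasure lborel {x. s < g x}"
        by (intro emeasure_mono) auto
      then show "emeasure lborel (\<Union>j. {x. t j < g x}) \<noteq> \<infinity>" using fin[OF s] by (auto simp: top_unique)
    qed
    also have "(\<Union>j. {x. t j < g x}) = {x. s < g x}"
    proof (intro equalityI subsetI)
      fix x assume "x \<in> {x. s < g x}"
      then obtain j where "1 / (real j + 1) < g x - s"
        using reals_Archimedean[of "g x - s"] by (auto simp: inverse_eq_divide add.commute)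
      then show "x \<in> (\<Union>j. {x. t j < g x})" by (auto simp: t_def intro!: exI[of _ j])
    qed (use ts less_trans in blast)
    finally have "(\<lambda>j. \<mu> (t j)) \<longlonglongrightarrow> \<mu> s" unfolding \<mu>_def .
    moreover have "r s \<noteq> 0" using w s p by (auto simp: z_def)
    ultimately have "(\<lambda>j. r (t j) powr p) \<longlonglongrightarrow> r s powr p"
      unfolding r_def using \<omega> by (intro tendsto_powr tendsto_real_root tendsto_divide tendsto_const) auto
    then have "eventually (\<lambda>j. w < r (t j) powr p) sequentially"
      using w s by (intro order_tendstoD) (auto simp: z_def)
    then obtain j where "w < r (t j) powr p" by (auto simp: eventually_sequentially)
    then show ?thesis using ts[of j] s by (intro exI[of _ "t j"]) (auto simp: z_def)
  qed
  define u where "u = (\<lambda>w. measure lborel {s. 0 < s \<and> max w 0 < z s})"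
  interpret level_pair z u
    unfolding u_def by (rule level_pair_conjugate[OF z0' zm z_mono z_zero right])
  \<comment> \<open>Since \<open>(z s)\<^sup>2\<close> is the power \<open>2 * p / n\<close> of
    \<open>\<mu> s / \<omega> \<le> C / s\<close>, the exponent being below 1 and
    \<open>C / s > 1\<close>, it is at most \<open>C / s\<close>.\<close>
  have zsq: "s * (z s)\<^sup>2 \<le> C" if s: "0 < s" for s
  proof (cases "s < C")
    case True
    have "(z s)\<^sup>2 = z s powr 2" using z0'[of s] by (simp add: powr_numeral)
    also have "\<dots> = r s powr (n * (2 * p / n))" using zr[OF s] n by (simp add: mult.commute)
    also have "\<dots> = (\<mu> s / \<omega>) powr (2 * p / n)" by (simp only: powr_powr[symmetric] r_powr)
    also have "\<dots> \<le> (C / s) powr (2 * p / n)"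
      using \<mu>_le[OF s] \<mu>0[of s] \<omega> p n by (intro powr_mono2) (auto simp: field_simps)
    also have "\<dots> \<le> (C / s) powr 1"
      using True s n by (intro powr_mono) (auto simp: np field_simps)
    also have "\<dots> = C / s" using C s by simp
    finally show ?thesis using s by (simp add: field_simps)
  next
    case False
    then show ?thesis using z_zero[of s] C by simp
  qed
  have zC: "z s * s \<le> C" if s: "0 < s" for s
  proof (cases "s < C")
    case True
    have "(z s * s)\<^sup>2 = s * (s * (z s)\<^sup>2)" by (simp add: power2_eq_square)
    also have "\<dots> \<le> C * C" using zsq[OF s] True s by (intro mult_mono) auto
    finally show ?thesis using C by (intro power2_le_imp_le[of "z s * s" C]) (auto simp: power2_eq_square)
  next
    case False
    then show ?thesis using z_zero[of s] C by simp
  qed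
  define V where "V = (SUP s\<in>{0<..}. z s * s)"
  have bdd: "bdd_above ((\<lambda>s. z s * s) ` {0<..})" using zC by (intro bdd_aboveI2[where M=C]) auto
  have zV: "z s * s \<le> V" if "0 < s" for s unfolding V_def using bdd that by (intro cSUP_upper) auto
  have V: "0 < V"
  proof -
    define s where "s = g x0 / 2"
    have s: "0 < s" "s < g x0" using f_nz by (auto simp: s_def g_def)
    have "open {x. s < g x}" using open_Collect_less[OF continuous_on_const contg] by auto
    then obtain e where e: "e > 0" "ball x0 e \<subseteq> {x. s < g x}" using s(2) open_contains_ball by blast
    have "0 < measure lborel (ball x0 e)" using e(1) by (rule content_ball_pos)
    also have "\<dots> \<le> \<mu> s" unfolding \<mu>_def using e(2) fmg[OF s(1)] by (intro measure_mono_fmeasurable) auto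
    finally have "\<mu> s > 0" .
    then have "0 < z s * s" using s \<omega> by (simp add: z_def r_def)
    then show ?thesis using zV[OF s(1)] by linarith
  qed
  \<comment> \<open>A nearly maximal level \<open>s1\<close>, and below it a radius
    \<open>z0\<close> slightly under \<open>z s1\<close>. Then \<open>s1 < u z0\<close>, so the
    rectangle at \<open>z0\<close> has area above \<open>\<theta> * V\<close>.\<close>
  obtain s1 where s1: "0 < s1" "\<theta> * V < z s1 * s1"
  proof -
    have "\<theta> * V < V" using \<theta> V by simp
    then have "\<exists>s\<in>{0<..}. \<theta> * V < z s * s"
      unfolding V_def by (subst (asm) less_cSUP_iff) (use bdd in auto)
    then show ?thesis using that by auto
  qed
  have "\<theta> * V / s1 < z s1" using s1 by (simp add: field_simps)
  then obtain z0 where z0: "\<theta> * V / s1 < z0" "z0 < z s1" using dense by blast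
  have "0 < \<theta> * V / s1" using \<theta> V s1 by simp
  then have z0_pos: "0 < z0" using z0(1) by linarith
  have "s1 < u z0" using galois[OF s1(1) z0_pos] z0(2) by simp
  then have "z0 * s1 < z0 * u z0" using z0_pos by simp
  moreover have "\<theta> * V < z0 * s1" using z0(1) s1(1) by (simp add: field_simps)
  ultimately have v0: "\<theta> * V < z0 * u z0" by linarith
  \<comment> \<open>This makes \<open>z0 * u z0\<close> exactly \<open>\<theta> * M\<close>, the
    upper limit of the boundary integral, while \<open>M\<close> still exceeds the supremum
    \<open>V\<close> as the calibration requires.\<close>
  define M where "M = z0 * u z0 / \<theta>"
  have VM: "V < M" using v0 \<theta> by (simp add: M_def field_simps)
  have M: "0 < M" using V VM by simp
  let ?G = "profile_speed M k"
  define \<epsilon> where "\<epsilon> x = (if z0 < x then 1 else - 1 :: real)" for x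
  have \<epsilon>m [measurable]: "\<epsilon> \<in> borel_measurable borel" unfolding \<epsilon>_def by measurable
  let ?b = "\<lambda>s. p * s * (z s)\<^sup>2 + \<epsilon> (z s) * (z s * ?G (z s * s))" and ?c = "\<lambda>w. p * u w + \<epsilon> w * ?G (w * u w) / w"
  define I2 where "I2 = (LBINT s. indicator {0<..} s * (s * (z s)\<^sup>2))"
  define Iq where "Iq = (LBINT s. indicator {0<..} s * ((z s * s) powr (k + 2) / s))"
  have I2: "integrable lborel (\<lambda>s. indicator {0<..} s * (s * (z s)\<^sup>2))"
  proof (rule Bochner_Integration.integrable_bound)
    show "integrable lborel (\<lambda>s. C * indicator {0..C} s)" using C by simp
    show "AE s in lborel. norm (indicator {0<..} s * (s * (z s)\<^sup>2)) \<le> norm (C * indicator {0..C} s)"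
    proof (rule AE_I2)
      fix s
      show "norm (indicator {0<..} s * (s * (z s)\<^sup>2)) \<le> norm (C * indicator {0..C} s)"
        using zsq[of s] z_zero[of s] C by (auto simp: indicator_def abs_mult)
    qed
  qed measurable
  define A where "A = (LBINT s. indicator {0<..} s * ?b s)"
  define B where "B = (LBINT w. indicator {0<..} w * (w * (?c w)\<^sup>2))"
  have A_int: "integrable lborel (\<lambda>s. indicator {0<..} s * ?b s)"
    unfolding \<epsilon>_def by (rule calibration_identity(1)[OF p(2) k M VM _ z0_pos I2]) (rule zV)
  have B_int: "integrable lborel (\<lambda>w. indicator {0<..} w * (w * (?c w)\<^sup>2))"
    unfolding \<epsilon>_def by (rule calibration_identity(2)[OF p(2) k M VM _ z0_pos I2]) (rule zV)
  have Iq_int: "integrable lborel (\<lambda>s. indicator {0<..} s * ((z s * s) powr (k + 2) / s))"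
    by (rule calibration_identity(3)[OF p(2) k M VM _ z0_pos I2]) (rule zV)
  have J: "(LBINT s. indicator {0<..<u z0} s * (z0 * ?G (z0 * s)))
     = M\<^sup>2 * (LBINT y. indicator {0<..<\<theta>} y * profile_speed 1 k y)"
  proof -
    have "u z0 = z0 * u z0 / z0" "\<theta> = z0 * u z0 / M"
      using z0_pos v0 V \<theta> M by (auto simp: M_def)
    then show ?thesis using profile_speed_scale[OF M z0_pos, of "z0 * u z0" k] by simp
  qed
  have AB: "2 * A - B / p = (p - 1 / (4 * p)) * I2 + M powr (- k) / (4 * p) * Iq
      + 4 * (M\<^sup>2 * (LBINT y. indicator {0<..<\<theta>} y * profile_speed 1 k y))"
    unfolding A_def B_def I2_def Iq_def J[symmetric] \<epsilon>_def
    by (rule calibration_identity(4)[OF p(2) k M VM _ z0_pos I2]) (rule zV)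
  have Gb: "0 \<le> ?G (z s * s)" "?G (z s * s) \<le> z s * s / 2" if "0 < s" for s
    using profile_speed_bounds[of "z s * s" M k] zV[OF that] VM k z0'[of s] that by auto
  \<comment> \<open>With the negative sign this is where \<open>p \<ge> 1 / 2\<close> is needed:
    \<open>G y \<le> y / 2\<close>, so the term with \<open>p\<close> dominates.\<close>
  have b_nonneg: "0 \<le> ?b s" if s: "0 < s" for s
  proof -
    have "z s * ?G (z s * s) \<le> z s * (z s * s / 2)" using Gb(2)[OF s] z0' by (intro mult_left_mono)
    also have "\<dots> = 1 / 2 * (s * (z s)\<^sup>2)" by (simp add: power2_eq_square)
    also have "\<dots> \<le> p * (s * (z s)\<^sup>2)" using p s by (intro mult_right_mono) auto
    finally have "z s * ?G (z s * s) \<le> p * s * (z s)\<^sup>2" by (simp add: mult.assoc)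
    moreover have "0 \<le> z s * ?G (z s * s)" using Gb(1)[OF s] z0' by simp
    ultimately show ?thesis using s p by (auto simp: \<epsilon>_def)
  qed
  \<comment> \<open>A jump of \<open>z\<close> corresponds to a level set of positive volume. Being
    the discontinuities of a monotone function, these levels are countable.\<close>
  define Ds where "Ds = {s\<in>{0<..}. \<not> isCont z s}"
  have "mono_on {0<..} (\<lambda>s. - z s)" using z_mono by (intro mono_onI) auto
  then have "countable {s\<in>{0<..}. \<not> isCont (\<lambda>s. - z s) s}" by (rule mono_on_ctble_discont_open[OF open_greaterThan])
  moreover have "isCont (\<lambda>s. - z s) s \<longleftrightarrow> isCont z s" for s
    using continuous_minus[of "at s" z] continuous_minus[of "at s" "\<lambda>s. - z s"] by auto
  ultimately have Ds: "countable Ds" by (simp add: Ds_def)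
  have Ds_sets [measurable]: "Ds \<in> sets borel" using Ds by (rule sets.countable[rotated]) auto
  \<comment> \<open>The calibrated gradient modulus as a function of the level;
    \<open>z s powr (- 1 / p)\<close> is the reciprocal of the radius. The value 0 on
    \<open>Ds\<close> changes a null set of levels on the linear side and removes the flat pieces of
    \<open>u\<close> from the quadratic side.\<close>
  define a where "a s = (if 0 < s \<and> 0 < z s \<and> s \<notin> Ds then z s powr (- 1 / p) * (p * s + \<epsilon> (z s) * ?G (z s * s) / z s) else 0)" for s
  have am [measurable]: "a \<in> borel_measurable borel" unfolding a_def by measurable
  have a_val: "a s * r s ^ (DIM('a) - 1) = ?b s" if s: "0 < s" "s \<notin> Ds" for s
  proof (cases "0 < z s")
    case True
    have rz: "r s = z s powr (1 / p)" using zr[OF s(1), of "1 / p"] p r0[of s] by simp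
    have rs: "0 < r s" using True r0[of s] s(1) p by (cases "r s = 0") (auto simp: z_def)
    have "r s ^ (DIM('a) - 1) = r s powr (n - 1)"
      using rs n3 by (simp add: powr_realpow[symmetric] n_def of_nat_diff)
    also have "\<dots> = z s powr ((n - 1) / p)" unfolding rz by (simp add: powr_powr)
    finally have e: "r s ^ (DIM('a) - 1) = z s powr ((n - 1) / p)" .
    have "z s powr (- 1 / p) * r s ^ (DIM('a) - 1) = z s powr (- 1 / p + (n - 1) / p)"
      by (simp only: e powr_add)
    also have "- 1 / p + (n - 1) / p = 2" using p by (simp add: np field_simps)
    finally have *: "z s powr (- 1 / p) * r s ^ (DIM('a) - 1) = (z s)\<^sup>2" using True by (simp add: powr_numeral)
    have "a s * r s ^ (DIM('a) - 1) = (z s powr (- 1 / p) * r s ^ (DIM('a) - 1)) * (p * s + \<epsilon> (z s) * ?G (z s * s) / z s)"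
      using True s by (simp add: a_def)
    also have "\<dots> = ?b s"
      unfolding * using True by (simp add: field_simps power2_eq_square)
    finally show ?thesis .
  next
    case False
    then have "z s = 0" using z0'[of s] by simp
    then show ?thesis by (simp add: a_def)
  qed
  have a0: "0 \<le> a s" for s
  proof (cases "0 < s \<and> 0 < z s \<and> s \<notin> Ds")
    case True
    have "(p * s + \<epsilon> (z s) * ?G (z s * s) / z s) * (z s)\<^sup>2 = ?b s"
      using True by (simp add: field_simps power2_eq_square)
    also have "\<dots> \<ge> 0" using b_nonneg True by simp
    finally have "0 \<le> p * s + \<epsilon> (z s) * ?G (z s * s) / z s" using True by (simp add: zero_le_mult_iff)
    then show ?thesis using True by (simp add: a_def)
  qed (auto simp: a_def)
  have lhs: "(\<integral>\<^sup>+v. ennreal (a v) * indicator {0<..} v * ennreal (DIM('a) * unit_ball_vol DIM('a) * r v ^ (DIM('a) - 1)) \<partial>lborel)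
     = ennreal (\<sigma> * A)"
  proof -
    have "AE s in lborel. s \<notin> Ds" using Ds by (intro AE_not_in countable_imp_null_set_lborel)
    then have "(\<integral>\<^sup>+v. ennreal (a v) * indicator {0<..} v * ennreal (DIM('a) * unit_ball_vol DIM('a) * r v ^ (DIM('a) - 1)) \<partial>lborel)
      = (\<integral>\<^sup>+s. ennreal (\<sigma> * (indicator {0<..} s * ?b s)) \<partial>lborel)"
    proof (intro nn_integral_cong_AE, eventually_elim)
      case (elim s)
      show ?case
      proof (cases "0 < s")
        case True
        have "ennreal (a s) * ennreal (\<sigma> * r s ^ (DIM('a) - 1)) = ennreal (\<sigma> * (a s * r s ^ (DIM('a) - 1)))"
          using a0 \<sigma> r0 by (subst ennreal_mult[symmetric]) (auto simp: mult_ac)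
        then show ?thesis using True a_val[OF True elim(2)] by (simp add: \<sigma>_def n_def \<omega>_def)
      qed simp
    qed
    also have "\<dots> = ennreal (LBINT s. \<sigma> * (indicator {0<..} s * ?b s))"
      using A_int b_nonneg \<sigma> by (intro nn_integral_eq_integral) (auto simp: indicator_def)
    finally show ?thesis by (simp add: A_def)
  qed
  have dist: "emeasure lborel {x. s < g x} = ennreal (\<omega> * z s powr (n / p))" if "0 < s" for s
    using em[OF that] zr[OF that, of "n / p"] p r_powr[of s] \<omega> by simp
  \<comment> \<open>Off \<open>Ds\<close> the generalized inverses are true inverses: levels below
    \<open>u w\<close> have \<open>z s > w\<close>, and left continuity carries this to
    \<open>u w\<close> itself.\<close>
  have cont_inv: "z (u w) = w" if w: "0 < w" "0 < u w" "u w \<notin> Ds" for w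
  proof (rule antisym)
    show "z (u w) \<le> w" using galois[OF w(2,1)] by simp
    have "isCont z (u w)" using w by (simp add: Ds_def)
    then have lim: "(z \<longlongrightarrow> z (u w)) (at_left (u w))"
      by (simp add: isCont_def filterlim_at_split)
    show "w \<le> z (u w)"
    proof (rule tendsto_lowerbound[OF lim])
      have "eventually (\<lambda>s. s \<in> {0<..<u w}) (at_left (u w))" using w(2) by (rule eventually_at_left_real)
      then show "eventually (\<lambda>s. w \<le> z s) (at_left (u w))"
        by eventually_elim (use galois w(1) in \<open>auto simp: less_imp_le\<close>)
    qed simp
  qed
  \<comment> \<open>The quadratic term is computed in the variable \<open>w\<close>. The powers of
    \<open>w\<close> combine to exponent \<open>(n - 2) / p - 1 = 1\<close>. Where
    \<open>u w\<close> lies in \<open>Ds\<close> the left integrand is 0, so only an inequality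
    results.\<close>
  have rhs: "(\<integral>\<^sup>+x. ennreal ((a (g x))\<^sup>2) * indicator {0<..} (g x) \<partial>lborel) \<le> ennreal (\<sigma> / p * B)"
  proof -
    have "(\<integral>\<^sup>+x. ennreal ((a (g x))\<^sup>2) * indicator {0<..} (g x) \<partial>lborel)
      \<le> (\<integral>\<^sup>+w. ennreal ((a (u w))\<^sup>2) * indicator {0<..} (u w) * (ennreal (\<omega> * (n / p) * w powr (n / p - 1)) * indicator {0<..} w) \<partial>lborel)"
      using p n \<omega> dist by (intro nn_integral_equimeasurable_le) auto
    also have "\<dots> \<le> (\<integral>\<^sup>+w. ennreal (\<sigma> / p * (indicator {0<..} w * (w * (?c w)\<^sup>2))) \<partial>lborel)"
    proof (rule nn_integral_mono)
      fix w :: real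
      show "ennreal ((a (u w))\<^sup>2) * indicator {0<..} (u w) * (ennreal (\<omega> * (n / p) * w powr (n / p - 1)) * indicator {0<..} w)
        \<le> ennreal (\<sigma> / p * (indicator {0<..} w * (w * (?c w)\<^sup>2)))"
      proof (cases "0 < w \<and> 0 < u w \<and> u w \<notin> Ds")
        case True
        then have zu: "z (u w) = w" using cont_inv by simp
        have "a (u w) = w powr (- 1 / p) * ?c w"
          using True by (simp add: a_def zu)
        then have "(a (u w))\<^sup>2 * (\<omega> * (n / p) * w powr (n / p - 1))
          = \<sigma> / p * ((w powr (- 1 / p))\<^sup>2 * w powr (n / p - 1)) * (?c w)\<^sup>2"
          by (simp add: \<sigma>_def power_mult_distrib)
        also have "(w powr (- 1 / p))\<^sup>2 * w powr (n / p - 1) = w powr (- 1 / p + - 1 / p + (n / p - 1))"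
          by (simp only: power2_eq_square powr_add)
        also have "- 1 / p + - 1 / p + (n / p - 1) = 1" using p by (simp add: np field_simps)
        also have "w powr 1 = w" using True by simp
        finally have eq: "(a (u w))\<^sup>2 * (\<omega> * (n / p) * w powr (n / p - 1))
          = \<sigma> / p * (w * (?c w)\<^sup>2)" by (simp only: mult.assoc)
        have "ennreal ((a (u w))\<^sup>2) * ennreal (\<omega> * (n / p) * w powr (n / p - 1))
          = ennreal ((a (u w))\<^sup>2 * (\<omega> * (n / p) * w powr (n / p - 1)))"
          using \<omega> n p by (intro ennreal_mult[symmetric]) auto
        then show ?thesis using True by (simp only: eq) simp
      next
        case False
        then show ?thesis by (auto simp: a_def indicator_def)
      qed
    qed
    also have "\<dots> = ennreal (LBINT w. \<sigma> / p * (indicator {0<..} w * (w * (?c w)\<^sup>2)))"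
      using B_int \<sigma> p by (intro nn_integral_eq_integral) (auto simp: indicator_def)
    finally show ?thesis by (simp add: B_def)
  qed
  have A0: "0 \<le> A" unfolding A_def using b_nonneg by (intro integral_nonneg_AE AE_I2) (auto simp: indicator_def)
  have B0: "0 \<le> B" unfolding B_def by (intro integral_nonneg_AE AE_I2) (auto simp: indicator_def)
  define En where "En = (LBINT x. (dn x)\<^sup>2)"
  \<comment> \<open>The pointwise bound \<open>2 * a * dn \<le> dn\<^sup>2 + a\<^sup>2\<close> is
    integrated, with the coarea inequality below and the equimeasurability bound \<open>rhs\<close>
    above.\<close>
  have energy: "2 * (\<sigma> * A) \<le> En + \<sigma> / p * B"
  proof -
    have "ennreal (\<sigma> * A) \<le> (\<integral>\<^sup>+x. ennreal (a (norm (f x))) * indicator {0<..} (norm (f x)) * ennreal (dn x) \<partial>lborel)"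
      unfolding lhs[symmetric]
    proof (rule coarea_isoperimetric[OF _ L lip _ der DG dn0 dnK dnm rm])
      show "2 \<le> DIM('a)" using n3 by simp
      show "bounded {x. t < norm (f x)}" if "0 < t" for t using gbdd[OF that] by (simp add: g_def)
      show "measure lborel {x. v < norm (f x)} = unit_ball_vol DIM('a) * r v ^ DIM('a)" if "0 < v" for v
        using r_pow[of v] by (simp add: \<mu>_def g_def \<omega>_def)
    qed (use r0 in auto)
    then have "2 * ennreal (\<sigma> * A) \<le> 2 * (\<integral>\<^sup>+x. ennreal (a (g x)) * indicator {0<..} (g x) * ennreal (dn x) \<partial>lborel)"
      unfolding g_def by (intro mult_left_mono) auto
    also have "\<dots> = (\<integral>\<^sup>+x. 2 * (ennreal (a (g x)) * indicator {0<..} (g x) * ennreal (dn x)) \<partial>lborel)"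
      by (rule nn_integral_cmult[symmetric]) measurable
    also have "\<dots> \<le> (\<integral>\<^sup>+x. ennreal ((dn x)\<^sup>2) + ennreal ((a (g x))\<^sup>2) * indicator {0<..} (g x) \<partial>lborel)"
    proof (rule nn_integral_mono)
      fix x
      have "2 * (a (g x) * dn x) \<le> (dn x)\<^sup>2 + (a (g x))\<^sup>2"
        using sum_squares_bound[of "a (g x)" "dn x"] by (simp add: mult.assoc add.commute)
      then have "ennreal (2 * (a (g x) * dn x)) \<le> ennreal ((dn x)\<^sup>2 + (a (g x))\<^sup>2)" by (rule ennreal_leI)
      then have "2 * (ennreal (a (g x)) * ennreal (dn x)) \<le> ennreal ((dn x)\<^sup>2) + ennreal ((a (g x))\<^sup>2)"
        using a0[of "g x"] dn0[of x] by (simp add: ennreal_mult)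
      then show "2 * (ennreal (a (g x)) * indicator {0<..} (g x) * ennreal (dn x))
        \<le> ennreal ((dn x)\<^sup>2) + ennreal ((a (g x))\<^sup>2) * indicator {0<..} (g x)"
        by (auto simp: indicator_def)
    qed
    also have "\<dots> = (\<integral>\<^sup>+x. ennreal ((dn x)\<^sup>2) \<partial>lborel) + (\<integral>\<^sup>+x. ennreal ((a (g x))\<^sup>2) * indicator {0<..} (g x) \<partial>lborel)"
      by (rule nn_integral_add) measurable
    also have "\<dots> \<le> ennreal En + ennreal (\<sigma> / p * B)"
      using rhs E by (intro add_mono) (auto simp: En_def nn_integral_eq_integral)
    finally have "ennreal (2 * (\<sigma> * A)) \<le> ennreal (En + \<sigma> / p * B)"
      using A0 B0 \<sigma> p by (simp add: ennreal_mult En_def)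
    moreover have "0 \<le> En + \<sigma> / p * B" using B0 \<sigma> p by (simp add: En_def)
    ultimately show ?thesis by (simp add: ennreal_le_iff)
  qed
  have I20: "0 \<le> I2" unfolding I2_def by (intro integral_nonneg_AE AE_I2) (auto simp: indicator_def)
  have Iq0: "0 \<le> Iq" unfolding Iq_def by (intro integral_nonneg_AE AE_I2) (auto simp: indicator_def)
  have rem: "emeasure lborel {x. s < g x} = ennreal (unit_ball_vol DIM('a) * r s ^ DIM('a))" if "0 < s" for s
    using em[OF that] r_pow[of s] by (simp add: \<omega>_def)
  define H where "H = (LBINT x. (norm (f x))\<^sup>2 / (norm x)\<^sup>2)"
  have [measurable]: "(\<lambda>x. norm (f x)) \<in> borel_measurable borel" using gm unfolding g_def .
  have H: "H \<le> \<sigma> / p * I2"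
    unfolding H_def
  proof (rule integral_le_of_nn_integral_le)
    have "(\<integral>\<^sup>+x. ennreal ((norm (f x))\<^sup>2 / (norm x)\<^sup>2) \<partial>lborel) = (\<integral>\<^sup>+x. ennreal (norm x powr (- 2) * g x powr 2) \<partial>lborel)"
      by (intro nn_integral_cong) (auto simp: g_def powr_minus powr_numeral divide_inverse mult.commute)
    also have "\<dots> \<le> (\<integral>\<^sup>+s. ennreal (2 * s powr (2 - 1) * (DIM('a) * unit_ball_vol DIM('a) / (real DIM('a) - 2) * r s powr (real DIM('a) - 2))) * indicator {0<..} s \<partial>lborel)"
      using n r0 rem g0 by (intro weighted_integral_le_profile) (auto simp: n_def)
    also have "\<dots> = (\<integral>\<^sup>+s. ennreal (\<sigma> / p * (indicator {0<..} s * (s * (z s)\<^sup>2))) \<partial>lborel)"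
    proof (rule nn_integral_cong)
      fix s :: real
      show "ennreal (2 * s powr (2 - 1) * (DIM('a) * unit_ball_vol DIM('a) / (real DIM('a) - 2) * r s powr (real DIM('a) - 2))) * indicator {0<..} s
        = ennreal (\<sigma> / p * (indicator {0<..} s * (s * (z s)\<^sup>2)))"
      proof (cases "0 < s")
        case True
        have "r s powr (real DIM('a) - 2) = (z s)\<^sup>2"
          using zr[OF True, of 2, unfolded p2] z0'[of s] by (simp add: powr_numeral n_def)
        then have "2 * s powr (2 - 1) * (DIM('a) * unit_ball_vol DIM('a) / (real DIM('a) - 2) * r s powr (real DIM('a) - 2))
          = \<sigma> / p * (s * (z s)\<^sup>2)"
          using True by (simp add: n_def[symmetric] wn \<sigma>_def p2[symmetric])
        then show ?thesis using True by simp
      qed simp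
    qed
    also have "\<dots> = ennreal (LBINT s. \<sigma> / p * (indicator {0<..} s * (s * (z s)\<^sup>2)))"
      using I2 \<sigma> p by (intro nn_integral_eq_integral) (auto simp: indicator_def)
    finally show "(\<integral>\<^sup>+x. ennreal ((norm (f x))\<^sup>2 / (norm x)\<^sup>2) \<partial>lborel) \<le> ennreal (\<sigma> / p * I2)"
      by (simp add: I2_def)
  qed (use \<sigma> p I20 in auto)
  define Q where "Q = (LBINT x. norm x powr (- (n - p * q)) * norm (f x) powr q)"
  have Q: "Q \<le> \<sigma> / p * Iq"
    unfolding Q_def
  proof (rule integral_le_of_nn_integral_le)
    have "(\<integral>\<^sup>+x. ennreal (norm x powr (- (n - p * q)) * norm (f x) powr q) \<partial>lborel)
      \<le> (\<integral>\<^sup>+s. ennreal (q * s powr (q - 1) * (DIM('a) * unit_ball_vol DIM('a) / (DIM('a) - (n - p * q)) * r s powr (DIM('a) - (n - p * q)))) * indicator {0<..} s \<partial>lborel)"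
      unfolding g_def[symmetric] using q pq r0 rem g0 by (intro weighted_integral_le_profile) (auto simp: n_def)
    also have "\<dots> = (\<integral>\<^sup>+s. ennreal (\<sigma> / p * (indicator {0<..} s * ((z s * s) powr (k + 2) / s))) \<partial>lborel)"
    proof (rule nn_integral_cong)
      fix s :: real
      show "ennreal (q * s powr (q - 1) * (DIM('a) * unit_ball_vol DIM('a) / (DIM('a) - (n - p * q)) * r s powr (DIM('a) - (n - p * q)))) * indicator {0<..} s
        = ennreal (\<sigma> / p * (indicator {0<..} s * ((z s * s) powr (k + 2) / s)))"
      proof (cases "0 < s")
        case True
        have "(z s * s) powr (k + 2) / s = z s powr q * (s powr q / s powr 1)"
          using True z0'[of s] by (simp add: k_def powr_mult)
        also have "\<dots> = r s powr (p * q) * s powr (q - 1)" using zr[OF True, of q] by (simp add: powr_diff)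
        finally show ?thesis using True p q by (simp add: n_def[symmetric] wn \<sigma>_def mult_ac)
      qed simp
    qed
    also have "\<dots> = ennreal (LBINT s. \<sigma> / p * (indicator {0<..} s * ((z s * s) powr (k + 2) / s)))"
      using \<sigma> p by (intro nn_integral_eq_integral integrable_mult_right Iq_int AE_I2) (auto simp: indicator_def)
    finally show "(\<integral>\<^sup>+x. ennreal (norm x powr (- (n - p * q)) * norm (f x) powr q) \<partial>lborel) \<le> ennreal (\<sigma> / p * Iq)"
      by (simp only: Iq_def integral_mult_right_zero)
  qed (use \<sigma> p Iq0 in auto)
  define \<Gamma> where "\<Gamma> = (LBINT y. indicator {0<..<\<theta>} y * profile_speed 1 k y)"
  have "\<sigma> * (2 * A - B / p) \<le> En" using energy by (simp add: algebra_simps)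
  then have *: "\<sigma> * ((p - 1 / (4 * p)) * I2) + \<sigma> * (M powr (- k) / (4 * p) * Iq) + 4 * \<sigma> * M\<^sup>2 * \<Gamma> \<le> En"
    unfolding AB \<Gamma>_def[symmetric] by (simp add: algebra_simps)
  \<comment> \<open>The Hardy coefficient is nonnegative because \<open>p \<ge> 1 / 2\<close>, so
    \<open>H\<close> may be replaced by its rearranged upper bound.\<close>
  have "(n - 1) * (n - 3) / 4 = p\<^sup>2 - 1 / 4" by (simp add: p_def power2_eq_square field_simps)
  moreover have "(1 / 2)\<^sup>2 \<le> p\<^sup>2" using p by (intro power_mono) auto
  ultimately have c0: "0 \<le> (n - 1) * (n - 3) / 4" and ceq: "(n - 1) * (n - 3) / 4 = p\<^sup>2 - 1 / 4"
    by (auto simp: power_divide)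
  have "(n - 1) * (n - 3) / 4 * H \<le> (n - 1) * (n - 3) / 4 * (\<sigma> / p * I2)" using H c0 by (rule mult_left_mono)
  also have "\<dots> = \<sigma> * ((p - 1 / (4 * p)) * I2)" unfolding ceq using p by (simp add: field_simps power2_eq_square)
  finally have 1: "(n - 1) * (n - 3) / 4 * H \<le> \<sigma> * ((p - 1 / (4 * p)) * I2)" .
  have "M powr (- k) / 4 * Q \<le> M powr (- k) / 4 * (\<sigma> / p * Iq)" using Q by (intro mult_left_mono) auto
  also have "\<dots> = \<sigma> * (M powr (- k) / (4 * p) * Iq)" by simp
  finally have 2: "M powr (- k) / 4 * Q \<le> \<sigma> * (M powr (- k) / (4 * p) * Iq)" .
  have "M powr (- k) / 4 * Q + 4 * \<sigma> * M\<^sup>2 * \<Gamma> \<le> En - (n - 1) * (n - 3) / 4 * H"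
    using * 1 2 by linarith
  then show ?thesis
    using that[OF M] unfolding Q_def H_def En_def \<Gamma>_def \<sigma>_def k_def p_def by simp
qed

section \<open>Schwartz functions and the sharp inequality\<close>

lemma schwartz_decay:
  fixes f :: "real^'n \<Rightarrow> complex"
  assumes "schwartz f"
  obtains C where "0 < C" "\<And>x. (1 + norm x) ^ N * norm (iter_partial is f x) \<le> C"
proof -
  obtain C where "\<And>x. (1 + norm x) ^ N * norm (iter_partial is f x) \<le> C"
    using assms unfolding schwartz_def by blast
  then have "(1 + norm x) ^ N * norm (iter_partial is f x) \<le> max C 1" for x by (meson max.coboundedI1)
  then show ?thesis using that[of "max C 1"] by simp
qed

theorem theorem1:
  fixes f :: "real^'n \<Rightarrow> complex" and q :: real
  assumes "CARD('n) \<ge> 3"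
    and "2 < q" and "q \<le> 2 * real CARD('n) / (real CARD('n) - 2)"
    and "schwartz f"
  shows "let n = real CARD('n); qs = 2 * n / (n - 2); \<alpha> = q / (q - 2);
             Cq = (2 * pi powr (n / 2) / Gamma (n / 2)) powr (1 / \<alpha>) * (q / 2) powr (2 / q)
                  * (Gamma \<alpha> * Gamma (\<alpha> + 1) / Gamma (2 * \<alpha>)) powr (1 / \<alpha>)
         in (\<integral>x. grad_norm_sq f x \<partial>lborel)
            \<ge> (n - 1) * (n - 3) / 4 * (\<integral>x. (norm (f x))\<^sup>2 / (norm x)\<^sup>2 \<partial>lborel)
              + Cq * (\<integral>x. norm x powr (- n * (qs - q) / qs) * norm (f x) powr q \<partial>lborel) powr (2 / q)"
proof -
  define n where "n = real CARD('n)"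
  define k where "k = q - 2"
  define \<alpha> where "\<alpha> = q / (q - 2)"
  define \<sigma> where "\<sigma> = n * unit_ball_vol n"
  define qs where "qs = 2 * n / (n - 2)"
  have n: "n \<ge> 3" using assms(1) by (simp add: n_def)
  have k: "k > 0" using assms(2) by (simp add: k_def)
  have q: "q = k + 2" "q > 0" using k by (auto simp: k_def)
  have \<alpha>k: "\<alpha> = (k + 2) / k" by (simp add: \<alpha>_def k_def)
  have \<alpha>: "\<alpha> > 0" using k by (simp add: \<alpha>k)
  have \<sigma>: "\<sigma> > 0" using n by (simp add: \<sigma>_def)
  have \<sigma>_eq: "2 * pi powr (n / 2) / Gamma (n / 2) = \<sigma>"
  proof -
    have "n / 2 \<notin> \<int>\<^sub>\<le>\<^sub>0" using n by (auto elim!: nonpos_Ints_cases)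
    from Gamma_plus1[OF this] have "Gamma (n / 2 + 1) = n / 2 * Gamma (n / 2)" by simp
    then have "\<sigma> = n * (pi powr (n / 2) / (n / 2 * Gamma (n / 2)))" by (simp only: \<sigma>_def unit_ball_vol_def)
    then show ?thesis using n by simp
  qed
  \<comment> \<open>By the choice of \<open>qs\<close> one has \<open>n / qs = (n - 2) / 2\<close>,
    which gives the exponent in the form used by the calibration.\<close>
  have expo: "- n * (qs - q) / qs = - (n - (n - 2) / 2 * q)"
    using n by (simp add: qs_def field_simps)
  define E where "E = (\<integral>x. grad_norm_sq f x \<partial>lborel)"
  define H where "H = (\<integral>x. (norm (f x))\<^sup>2 / (norm x)\<^sup>2 \<partial>lborel)"
  define Q where "Q = (\<integral>x. norm x powr (- (n - (n - 2) / 2 * q)) * norm (f x) powr q \<partial>lborel)"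
  define X where "X = E - (n - 1) * (n - 3) / 4 * H"
  have Q0: "0 \<le> Q" unfolding Q_def by (intro integral_nonneg_AE AE_I2) auto
  have diff: "iter_partial is f differentiable (at x)" for "is" x
    using assms(4) by (auto simp: schwartz_def)
  have fdiff: "f differentiable (at x)" for x using diff[of "[]"] by simp
  have pdiff: "partial_deriv i f differentiable (at x)" for i x using diff[of "[i]"] by simp
  have pm [measurable]: "partial_deriv i f \<in> borel_measurable borel" for i
    using pdiff by (intro borel_measurable_continuous_onI)
      (meson continuous_at_imp_continuous_on differentiable_imp_continuous_within)
  have gradm [measurable]: "grad_norm_sq f \<in> borel_measurable borel"
    unfolding grad_norm_sq_def[abs_def] by measurable
  have grad0: "0 \<le> grad_norm_sq f x" for x unfolding grad_norm_sq_def by (intro sum_nonneg) auto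
  define dn where "dn x = sqrt (grad_norm_sq f x)" for x
  have dnsq: "(dn x)\<^sup>2 = grad_norm_sq f x" for x using grad0 by (simp add: dn_def)
  have "\<exists>C. \<forall>x. norm (partial_deriv i f x) \<le> C" for i
    using schwartz_decay[OF assms(4), of 0 "[i]"] by (metis iter_partial.simps mult_1 power_0)
  then obtain c where c: "\<And>i x. norm (partial_deriv i f x) \<le> c i" by metis
  define K where "K = sqrt (\<Sum>i\<in>UNIV. (c i)\<^sup>2)"
  have dnK: "dn x \<le> K" for x
    unfolding dn_def K_def grad_norm_sq_def using c by (intro real_sqrt_le_mono sum_mono power_mono) auto
  have der: "(f has_derivative frechet_derivative f (at x)) (at x)" for x
    using fdiff by (simp add: frechet_derivative_works)
  have DG: "norm (frechet_derivative f (at x) h) \<le> dn x * norm h" for x h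
    unfolding dn_def by (rule norm_frechet_derivative_le[OF fdiff])
  have K0: "0 \<le> K" unfolding K_def by (intro real_sqrt_ge_zero sum_nonneg) auto
  \<comment> \<open>A global Lipschitz constant from the bounded gradient by the mean value
    inequality; the coarea estimate uses it for domination.\<close>
  have lip: "norm (f x - f y) \<le> K * norm (x - y)" for x y
  proof (rule differentiable_bound[of UNIV f "\<lambda>x. frechet_derivative f (at x)"])
    show "onorm (frechet_derivative f (at x)) \<le> K" for x
    proof (rule onorm_bound[OF K0])
      fix h :: "real^'n"
      have "dn x * norm h \<le> K * norm h" using dnK by (intro mult_right_mono) auto
      then show "norm (frechet_derivative f (at x) h) \<le> K * norm h" using DG[of x h] by linarith
    qed
  qed (use der in auto)
  have psq: "integrable lborel (\<lambda>x. (norm (partial_deriv i f x))\<^sup>2)" for i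
  proof -
    obtain C where "0 < C" "\<And>x. (1 + norm x) ^ DIM(real^'n) * norm (iter_partial [i] f x) \<le> C"
      using schwartz_decay[OF assms(4)] by metis
    then show ?thesis by (intro decay_square_integrable[of C]) auto
  qed
  have Eint: "integrable lborel (\<lambda>x. (dn x)\<^sup>2)"
    unfolding dnsq grad_norm_sq_def using psq by (intro Bochner_Integration.integrable_sum) auto
  define \<gamma> where "\<gamma> = Beta (2 / k) (3 / 2) / (2 * k)"
  define I where "I \<theta> = (\<integral>y. indicator {0<..<\<theta>} y * profile_speed 1 k y \<partial>lborel)" for \<theta>
  \<comment> \<open>The sharp lower bound with the profile integral left as a variable, so that the
    limit \<open>\<theta> \<rightarrow> 1\<close> becomes continuity of \<open>F\<close> at
    \<open>\<gamma>\<close>.\<close>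
  define F where "F y = \<sigma> powr (1 / \<alpha>) * (q / 2) powr (2 / q) * (4 powr (1 - \<alpha>) * (4 * \<alpha> * y)) powr (1 / \<alpha>) * Q powr (2 / q)" for y
  have \<gamma>: "\<gamma> > 0" unfolding \<gamma>_def Beta_def using k
    by (intro divide_pos_pos mult_pos_pos Gamma_real_pos add_pos_pos) auto
  have "F \<gamma> \<le> X"
  proof (cases "f = (\<lambda>x. 0)")
    case True
    have "Q = 0" unfolding Q_def using True q by simp
    moreover have "H = 0" unfolding H_def using True by simp
    moreover have "0 \<le> E" unfolding E_def using grad0 by (intro integral_nonneg_AE) auto
    ultimately show ?thesis using q by (simp add: F_def X_def)
  next
    case False
    then obtain x0 where x0: "f x0 \<noteq> 0" by auto
    obtain C where C: "0 < C" "\<And>x. (1 + norm x) ^ DIM(real^'n) * norm (f x) \<le> C"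
      using schwartz_decay[OF assms(4), of "DIM(real^'n)" "[]"] by auto
    \<comment> \<open>The constant \<open>M\<close> depends on \<open>\<theta>\<close>, but
      optimization over \<open>M\<close> removes it before the limit is taken. Positivity of
      \<open>I \<theta>\<close> holds for \<open>\<theta>\<close> near 1, since the limit
      \<open>\<gamma>\<close> is positive.\<close>
    have step: "F (I \<theta>) \<le> X" if \<theta>: "0 < \<theta>" "\<theta> < 1" and pos: "I \<theta> > 0" for \<theta>
    proof -
      have nD: "real DIM(real^'n) = n" by (simp add: n_def)
      obtain M where M: "0 < M" "M powr (- k) / 4 * Q + 4 * \<sigma> * M\<^sup>2 * I \<theta> \<le> X"
      proof (rule energy_calibration[OF _ assms(2) _ K0 lip C der DG _ dnK _ Eint x0 \<theta>])
        show "3 \<le> DIM(real^'n)" using assms(1) by simp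
        show "q \<le> 2 * real DIM(real^'n) / (real DIM(real^'n) - 2)" using assms(3) by simp
        show "0 \<le> dn x" for x using grad0 by (simp add: dn_def)
        show "dn \<in> borel_measurable borel" unfolding dn_def by measurable
      next
        fix M assume M: "0 < M" and le: "M powr - (q - 2) / 4 *
          (LBINT x. norm x powr - (real DIM(real^'n) - (real DIM(real^'n) - 2) / 2 * q) * norm (f x) powr q) +
          4 * (real DIM(real^'n) * unit_ball_vol (real DIM(real^'n))) * M\<^sup>2 *
          (LBINT y. indicator {0<..<\<theta>} y * profile_speed 1 (q - 2) y)
          \<le> (LBINT x. (dn x)\<^sup>2) - (real DIM(real^'n) - 1) * (real DIM(real^'n) - 3) / 4 * (LBINT x. (norm (f x))\<^sup>2 / (norm x)\<^sup>2)"
        show thesis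
          using that[OF M] le unfolding nD dnsq k_def[symmetric] Q_def[symmetric] I_def[symmetric] \<sigma>_def[symmetric]
            E_def[symmetric] H_def[symmetric] X_def[symmetric] by simp
      qed
      show ?thesis
        using young_optimization[OF k pos \<sigma> M(1) Q0 M(2)] unfolding F_def \<alpha>k q(1) .
    qed
    have lim: "(I \<longlongrightarrow> \<gamma>) (at_left 1)"
      unfolding I_def[abs_def] \<gamma>_def by (rule profile_speed_integral_limit[OF k])
    have "((\<lambda>\<theta>. F (I \<theta>)) \<longlongrightarrow> F \<gamma>) (at_left 1)"
      unfolding F_def using \<gamma> \<alpha> by (intro tendsto_intros lim) auto
    moreover have "eventually (\<lambda>\<theta>. F (I \<theta>) \<le> X) (at_left 1)"
      using eventually_at_left_real[of 0 "1::real", OF zero_less_one] order_tendstoD(1)[OF lim \<gamma>]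
      by eventually_elim (use step in auto)
    ultimately show ?thesis by (intro tendsto_upperbound) auto
  qed
  moreover have "4 powr (1 - \<alpha>) * (4 * \<alpha> * \<gamma>) = Gamma \<alpha> * Gamma (\<alpha> + 1) / Gamma (2 * \<alpha>)"
    unfolding \<gamma>_def \<alpha>k by (rule profile_speed_constant[OF k])
  ultimately show ?thesis
    unfolding Let_def n_def[symmetric] \<alpha>_def[symmetric] qs_def[symmetric] expo \<sigma>_eq F_def
      E_def[symmetric] H_def[symmetric] Q_def[symmetric] X_def by simp
qed

end
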